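(* Let $G$ be a compact matrix quantum group, let $\Gamma$ be a discrete group, and let $(G,\Gamma,\alpha)$ be a compact CQG dynamical system. Then the subgroup $\Gamma_\chi=\{\gamma\in\Gamma : \alpha_\gamma\in\mathrm{Aut}_\chi(G)\}$ of $\Gamma$ has finite index in $\Gamma$.
   Context: A compact quantum group $G$ is given by a unital $C^*$-algebra with a coassociative comultiplication $\Delta$ satisfying Woronowicz's density conditions. Its CQG algebra is the dense Hopf $*$-algebra spanned by matrix coefficients of the irreducible finite-dimensional unitary representations of $G$; $\mathrm{Irr}(G)$ is the set of equivalence classes of irreducible representations, and $C(G)$ denotes the full (universal) enveloping $C^*$-algebra of the CQG algebra. $G$ is a compact matrix quantum group if it has a finite-dimensional unitary representation whose matrix coefficients generate the $C^*$-algebra. $\mathrm{Aut}(G)$ is the group of comultiplication-preserving $*$-automorphisms of $C(G)$, and $\mathrm{Aut}_\chi(G)$ is the normal subgroup of those $\alpha\in\mathrm{Aut}(G)$ with $\alpha(\chi_V)=\chi_V$ for the character $\chi_V$ of every $V\in\mathrm{Irr}(G)$. A CQG dynamical system $(G,\Gamma,\alpha)$ consists of a compact quantum group $G$, a discrete group $\Gamma$ and a group homomorphism $\alpha:\Gamma\to\mathrm{Aut}(G)$, $\gamma\mapsto\alpha_\gamma$. Let $h$ be the Haar state, $L^2$ its GNS Hilbert space with norm $\|\cdot\|_{2,h}$, and $\Omega_h$ the canonical cyclic vector. The system (action) is compact if for every $a\in C(G)$ the set $\{\alpha_\gamma(a)\Omega_h : \gamma\in\Gamma\}$ is relatively compact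 in $L^2$ with respect to $\|\cdot\|_{2,h}$. *)

theory Defs
  imports
    "HOL-Analysis.Elementary_Topology"
    "HOL-Algebra.Coset"
    "Jordan_Normal_Form.Matrix"
begin

section \<open>Complex normed spaces, unital C*-algebras, Hilbert spaces\<close>

class scaleC =
  fixes scaleC :: "complex \<Rightarrow> 'a \<Rightarrow> 'a" (infixr "*\<^sub>C" 75)

class complex_normed_vector = real_normed_vector + scaleC +
  assumes scaleC_add_right: "c *\<^sub>C (x + y) = c *\<^sub>C x + c *\<^sub>C y"
    and scaleC_add_left: "(c + d) *\<^sub>C x = c *\<^sub>C x + d *\<^sub>C x"
    and scaleC_scaleC: "c *\<^sub>C d *\<^sub>C x = (c * d) *\<^sub>C x"
    and scaleR_scaleC: "r *\<^sub>R x = complex_of_real r *\<^sub>C x"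
    and norm_scaleC: "norm (c *\<^sub>C x) = cmod c * norm x"

global_interpretation complex_vector: vector_space
  "scaleC :: complex \<Rightarrow> 'a \<Rightarrow> 'a :: complex_normed_vector"
proof
  show "1 *\<^sub>C x = x" for x :: 'a
    using scaleR_scaleC[of 1 x] by simp
qed (simp_all add: scaleC_add_right scaleC_add_left scaleC_scaleC)

abbreviation cspan :: "'a::complex_normed_vector set \<Rightarrow> 'a set"
  where "cspan \<equiv> module.span scaleC"

abbreviation cindependent :: "'a::complex_normed_vector set \<Rightarrow> bool"
  where "cindependent B \<equiv> \<not> module.dependent scaleC B"

definition clinear :: "('a::complex_normed_vector \<Rightarrow> 'b::complex_normed_vector) \<Rightarrow> bool"
  where "clinear f \<longleftrightarrow> Vector_Spaces.linear scaleC scaleC f"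

class unital_cstar_algebra = complex_normed_vector + banach + real_normed_algebra_1 +
  fixes star :: "'a \<Rightarrow> 'a"
  assumes scaleC_mult_left: "(c *\<^sub>C x) * y = c *\<^sub>C (x * y)"
    and scaleC_mult_right: "x * (c *\<^sub>C y) = c *\<^sub>C (x * y)"
    and star_add: "star (x + y) = star x + star y"
    and star_scaleC: "star (c *\<^sub>C x) = cnj c *\<^sub>C star x"
    and star_mult: "star (x * y) = star y * star x"
    and star_star: "star (star x) = x"
    and norm_star_mult_self: "norm (star x * x) = (norm x)\<^sup>2"

text \<open>The inner product is linear in the second argument.\<close>

class complex_hilbert_space = complex_normed_vector + banach +
  fixes cinner :: "'a \<Rightarrow> 'a \<Rightarrow> complex"
  assumes cinner_add_right: "cinner x (y + z) = cinner x y + cinner x z"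
    and cinner_scaleC_right: "cinner x (c *\<^sub>C y) = c * cinner x y"
    and cinner_commute: "cinner y x = cnj (cinner x y)"
    and cinner_self: "cinner x x = complex_of_real ((norm x)\<^sup>2)"

instantiation complex :: unital_cstar_algebra
begin
definition scaleC_complex :: "complex \<Rightarrow> complex \<Rightarrow> complex"
  where "scaleC_complex = (*)"
definition star_complex :: "complex \<Rightarrow> complex"
  where "star_complex = cnj"
instance
  by standard
    (simp_all add: scaleC_complex_def star_complex_def algebra_simps scaleR_conv_of_real
      norm_mult power2_eq_square)
end

definition star_hom_on ::
    "'a::unital_cstar_algebra set \<Rightarrow> ('a \<Rightarrow> 'b::unital_cstar_algebra) \<Rightarrow> bool"
  where "star_hom_on S f \<longleftrightarrow>
    (\<forall>x\<in>S. \<forall>y\<in>S. f (x + y) = f x + f y \<and> f (x * y) = f x * f y) \<and>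
    (\<forall>x\<in>S. (\<forall>c. f (c *\<^sub>C x) = c *\<^sub>C f x) \<and> f (star x) = star (f x)) \<and>
    f 1 = 1"

abbreviation star_hom :: "('a::unital_cstar_algebra \<Rightarrow> 'b::unital_cstar_algebra) \<Rightarrow> bool"
  where "star_hom \<equiv> star_hom_on UNIV"

definition unital_cstar_subalgebra :: "'a::unital_cstar_algebra set \<Rightarrow> bool"
  where "unital_cstar_subalgebra B \<longleftrightarrow>
    1 \<in> B \<and> closed B \<and>
    (\<forall>x\<in>B. \<forall>y\<in>B. x + y \<in> B \<and> x * y \<in> B) \<and>
    (\<forall>x\<in>B. star x \<in> B \<and> (\<forall>c. c *\<^sub>C x \<in> B))"

definition cstar_seminorm_on :: "'a::unital_cstar_algebra set \<Rightarrow> ('a \<Rightarrow> real) \<Rightarrow> bool"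
  where "cstar_seminorm_on S p \<longleftrightarrow>
    (\<forall>x\<in>S. 0 \<le> p x \<and> (\<forall>c. p (c *\<^sub>C x) = cmod c * p x) \<and> p (star x * x) = (p x)\<^sup>2) \<and>
    (\<forall>x\<in>S. \<forall>y\<in>S. p (x + y) \<le> p x + p y \<and> p (x * y) \<le> p x * p y)"

text \<open>A state is a positive linear functional of norm one.\<close>

definition state :: "('a::unital_cstar_algebra \<Rightarrow> complex) \<Rightarrow> bool"
  where "state h \<longleftrightarrow> clinear h \<and> h 1 = 1 \<and>
    (\<forall>a. cmod (h a) \<le> norm a) \<and>
    (\<forall>a. h (star a * a) \<in> \<real> \<and> 0 \<le> Re (h (star a * a)))"

section \<open>Minimal tensor products\<close>

text \<open>
  The library has no tensor products of C*-algebras, so a C*-algebra is recognised as the minimal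
  tensor product of two others through the map \<open>t a b\<close>, standing for the elementary tensor of
  \<open>a\<close> and \<open>b\<close>: the span of the elementary tensors is a copy of the algebraic tensor product (third
  and fourth conjunct: the product structure, and injectivity of the induced linear map), it is
  dense, and the norm is the smallest C*-norm on it.
\<close>

definition min_tensor ::
    "('a::unital_cstar_algebra \<Rightarrow> 'b::unital_cstar_algebra \<Rightarrow> 'c::unital_cstar_algebra) \<Rightarrow> bool"
  where "min_tensor t \<longleftrightarrow>
    (\<forall>a. clinear (\<lambda>b. t a b)) \<and> (\<forall>b. clinear (\<lambda>a. t a b)) \<and>
    (\<forall>a b a' b'. t a b * t a' b' = t (a * a') (b * b') \<and> star (t a b) = t (star a) (star b)) \<and>
    (\<forall>B f. finite B \<and> cindependent B \<and> (\<Sum>b\<in>B. t (f b) b) = 0 \<longrightarrow> (\<forall>b\<in>B. f b = 0)) \<and>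
    closure (cspan {t a b | a b. True}) = UNIV \<and>
    (\<forall>p. cstar_seminorm_on (cspan {t a b | a b. True}) p \<and>
         (\<forall>x \<in> cspan {t a b | a b. True}. p x = 0 \<longrightarrow> x = 0) \<longrightarrow>
         (\<forall>x \<in> cspan {t a b | a b. True}. norm x \<le> p x))"

definition tensor_hom ::
    "('a::unital_cstar_algebra \<Rightarrow> 'b::unital_cstar_algebra \<Rightarrow> 'c::unital_cstar_algebra) \<Rightarrow>
     ('d::unital_cstar_algebra \<Rightarrow> 'e::unital_cstar_algebra \<Rightarrow> 'f::unital_cstar_algebra) \<Rightarrow>
     ('a \<Rightarrow> 'd) \<Rightarrow> ('b \<Rightarrow> 'e) \<Rightarrow> ('c \<Rightarrow> 'f) \<Rightarrow> bool"
  where "tensor_hom t t' f g F \<longleftrightarrow> star_hom F \<and> (\<forall>a b. F (t a b) = t' (f a) (g b))"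

section \<open>Compact quantum groups\<close>

text \<open>
  \<open>t\<close> is the elementary-tensor map into \<open>A \<otimes> A\<close> and \<open>s\<close> the one into \<open>(A \<otimes> A) \<otimes> A\<close>.
  In the coassociativity condition, \<open>D1\<close> is \<open>\<Delta> \<otimes> id\<close>, \<open>J\<close> is the embedding \<open>y \<mapsto> 1 \<otimes> y\<close> of
  \<open>A \<otimes> A\<close> into the triple tensor product, and \<open>D2\<close> is \<open>id \<otimes> \<Delta>\<close>, since
  \<open>a \<otimes> \<Delta> b = (a \<otimes> 1 \<otimes> 1) (1 \<otimes> \<Delta> b)\<close>.
\<close>

definition coassociative ::
    "('a::unital_cstar_algebra \<Rightarrow> 'a \<Rightarrow> 'b::unital_cstar_algebra) \<Rightarrow>
     ('b \<Rightarrow> 'a \<Rightarrow> 'c::unital_cstar_algebra) \<Rightarrow> ('a \<Rightarrow> 'b) \<Rightarrow> bool"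
  where "coassociative t s \<Delta> \<longleftrightarrow>
    (\<exists>D1 D2 J. tensor_hom t s \<Delta> id D1 \<and>
      star_hom J \<and> (\<forall>b c. J (t b c) = s (t 1 b) c) \<and>
      star_hom D2 \<and> (\<forall>a b. D2 (t a b) = s (t a 1) 1 * J (\<Delta> b)) \<and>
      (\<forall>a. D1 (\<Delta> a) = D2 (\<Delta> a)))"

definition compact_quantum_group ::
    "('a::unital_cstar_algebra \<Rightarrow> 'a \<Rightarrow> 'b::unital_cstar_algebra) \<Rightarrow>
     ('b \<Rightarrow> 'a \<Rightarrow> 'c::unital_cstar_algebra) \<Rightarrow> ('a \<Rightarrow> 'b) \<Rightarrow> bool"
  where "compact_quantum_group t s \<Delta> \<longleftrightarrow>
    min_tensor t \<and> min_tensor s \<and> star_hom \<Delta> \<and> coassociative t s \<Delta> \<and>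
    closure (cspan {\<Delta> a * t 1 b | a b. True}) = UNIV \<and>
    closure (cspan {\<Delta> a * t b 1 | a b. True}) = UNIV"

definition star_mat :: "'a::unital_cstar_algebra mat \<Rightarrow> 'a mat"
  where "star_mat u = map_mat star (transpose_mat u)"

text \<open>The inclusion \<open>x \<mapsto> x \<otimes> 1\<close> of scalar matrices into matrices over \<open>A\<close>.\<close>

definition scalar_mat :: "complex mat \<Rightarrow> 'a::unital_cstar_algebra mat"
  where "scalar_mat x = map_mat (\<lambda>c. c *\<^sub>C 1) x"

definition unitary_rep ::
    "('a::unital_cstar_algebra \<Rightarrow> 'a \<Rightarrow> 'b::unital_cstar_algebra) \<Rightarrow> ('a \<Rightarrow> 'b) \<Rightarrow>
     nat \<Rightarrow> 'a mat \<Rightarrow> bool"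
  where "unitary_rep t \<Delta> n u \<longleftrightarrow>
    u \<in> carrier_mat n n \<and> u * star_mat u = 1\<^sub>m n \<and> star_mat u * u = 1\<^sub>m n \<and>
    (\<forall>i<n. \<forall>j<n. \<Delta> (u $$ (i, j)) = (\<Sum>k<n. t (u $$ (i, k)) (u $$ (k, j))))"

text \<open>
  A linear subspace of \<open>\<complex>\<^sup>n\<close> is given by the orthogonal projection \<open>p\<close> onto it; it is invariant if
  \<open>(p \<otimes> 1) u (p \<otimes> 1) = u (p \<otimes> 1)\<close>.
\<close>

definition irreducible_rep ::
    "('a::unital_cstar_algebra \<Rightarrow> 'a \<Rightarrow> 'b::unital_cstar_algebra) \<Rightarrow> ('a \<Rightarrow> 'b) \<Rightarrow>
     nat \<Rightarrow> 'a mat \<Rightarrow> bool"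
  where "irreducible_rep t \<Delta> n u \<longleftrightarrow>
    unitary_rep t \<Delta> n u \<and> 0 < n \<and>
    (\<forall>p \<in> carrier_mat n n. p * p = p \<and> star_mat p = p \<and>
       scalar_mat p * u * scalar_mat p = u * scalar_mat p \<longrightarrow> p = 0\<^sub>m n n \<or> p = 1\<^sub>m n)"

definition rep_character :: "nat \<Rightarrow> 'a::unital_cstar_algebra mat \<Rightarrow> 'a"
  where "rep_character n u = (\<Sum>i<n. u $$ (i, i))"

definition coefficients :: "nat \<Rightarrow> 'a mat \<Rightarrow> 'a set"
  where "coefficients n u = {u $$ (i, j) | i j. i < n \<and> j < n}"

definition cqg_algebra ::
    "('a::unital_cstar_algebra \<Rightarrow> 'a \<Rightarrow> 'b::unital_cstar_algebra) \<Rightarrow> ('a \<Rightarrow> 'b) \<Rightarrow> 'a set"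
  where "cqg_algebra t \<Delta> = cspan (\<Union>{coefficients n u | n u. irreducible_rep t \<Delta> n u})"

definition compact_matrix_quantum_group ::
    "('a::unital_cstar_algebra \<Rightarrow> 'a \<Rightarrow> 'b::unital_cstar_algebra) \<Rightarrow>
     ('b \<Rightarrow> 'a \<Rightarrow> 'c::unital_cstar_algebra) \<Rightarrow> ('a \<Rightarrow> 'b) \<Rightarrow> bool"
  where "compact_matrix_quantum_group t s \<Delta> \<longleftrightarrow>
    compact_quantum_group t s \<Delta> \<and>
    (\<exists>n u. unitary_rep t \<Delta> n u \<and>
      (\<forall>B. unital_cstar_subalgebra B \<and> coefficients n u \<subseteq> B \<longrightarrow> B = UNIV))"

text \<open>
  \<open>h\<close> is the Haar state: \<open>(h \<otimes> id) (\<Delta> a) = h a 1 = (id \<otimes> h) (\<Delta> a)\<close>.  The slice maps \<open>h \<otimes> id\<close> and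
  \<open>id \<otimes> h\<close> are the (unique) bounded extensions of their values on elementary tensors.
\<close>

definition haar_state ::
    "('a::unital_cstar_algebra \<Rightarrow> 'a \<Rightarrow> 'b::unital_cstar_algebra) \<Rightarrow> ('a \<Rightarrow> 'b) \<Rightarrow>
     ('a \<Rightarrow> complex) \<Rightarrow> bool"
  where "haar_state t \<Delta> h \<longleftrightarrow> state h \<and>
    (\<exists>L. clinear L \<and> bounded_linear L \<and> (\<forall>a b. L (t a b) = h a *\<^sub>C b) \<and>
      (\<forall>a. L (\<Delta> a) = h a *\<^sub>C 1)) \<and>
    (\<exists>R. clinear R \<and> bounded_linear R \<and> (\<forall>a b. R (t a b) = h b *\<^sub>C a) \<and>
      (\<forall>a. R (\<Delta> a) = h a *\<^sub>C 1))"

section \<open>The full C*-algebra \<open>C(G)\<close> and its automorphisms\<close>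

text \<open>
  \<open>\<iota>\<close> exhibits its codomain as the completion of the CQG algebra of \<open>(A, \<Delta>)\<close> in the supremum of all
  its C*-seminorms; \<open>tU\<close> is the elementary-tensor map into \<open>C(G) \<otimes> C(G)\<close>, and \<open>\<Delta>U\<close> the
  comultiplication extending that of the CQG algebra.  Only the values of \<open>\<iota>\<close> on the CQG algebra
  matter.
\<close>

definition full_cstar_algebra ::
    "('a::unital_cstar_algebra \<Rightarrow> 'a \<Rightarrow> 'b::unital_cstar_algebra) \<Rightarrow> ('a \<Rightarrow> 'b) \<Rightarrow>
     ('a \<Rightarrow> 'u::unital_cstar_algebra) \<Rightarrow>
     ('u \<Rightarrow> 'u \<Rightarrow> 'v::unital_cstar_algebra) \<Rightarrow> ('u \<Rightarrow> 'v) \<Rightarrow> bool"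
  where "full_cstar_algebra t \<Delta> \<iota> tU \<Delta>U \<longleftrightarrow>
    star_hom_on (cqg_algebra t \<Delta>) \<iota> \<and>
    closure (\<iota> ` cqg_algebra t \<Delta>) = UNIV \<and>
    (\<forall>a \<in> cqg_algebra t \<Delta>. norm (\<iota> a) = (SUP p \<in> {p. cstar_seminorm_on (cqg_algebra t \<Delta>) p}. p a)) \<and>
    min_tensor tU \<and> star_hom \<Delta>U \<and>
    (\<forall>a \<in> cqg_algebra t \<Delta>. \<forall>n f g.
       (\<forall>k<n. f k \<in> cqg_algebra t \<Delta> \<and> g k \<in> cqg_algebra t \<Delta>) \<and>
       \<Delta> a = (\<Sum>k<(n::nat). t (f k) (g k)) \<longrightarrow>
       \<Delta>U (\<iota> a) = (\<Sum>k<n. tU (\<iota> (f k)) (\<iota> (g k))))"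

text \<open>\<open>F\<close> below is \<open>\<alpha> \<otimes> \<alpha>\<close>, so the condition is \<open>(\<alpha> \<otimes> \<alpha>) \<circ> \<Delta> = \<Delta> \<circ> \<alpha>\<close>.\<close>

definition cqg_aut ::
    "('u::unital_cstar_algebra \<Rightarrow> 'u \<Rightarrow> 'v::unital_cstar_algebra) \<Rightarrow> ('u \<Rightarrow> 'v) \<Rightarrow> ('u \<Rightarrow> 'u) set"
  where "cqg_aut t \<Delta> = {\<alpha>. star_hom \<alpha> \<and> bij \<alpha> \<and>
    (\<exists>F. tensor_hom t t \<alpha> \<alpha> F \<and> bij F \<and> (\<forall>a. F (\<Delta> a) = \<Delta> (\<alpha> a)))}"

definition cqg_aut_group ::
    "('u::unital_cstar_algebra \<Rightarrow> 'u \<Rightarrow> 'v::unital_cstar_algebra) \<Rightarrow> ('u \<Rightarrow> 'v) \<Rightarrow> ('u \<Rightarrow> 'u) monoid"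
  where "cqg_aut_group t \<Delta> = \<lparr>carrier = cqg_aut t \<Delta>, monoid.mult = (\<circ>), one = id\<rparr>"

text \<open>
  The character of a class in \<open>Irr(G)\<close> is that of any irreducible unitary matrix representing it, so
  the condition is stated for all irreducible unitary matrices of \<open>(A, \<Delta>)\<close>.
\<close>

definition cqg_aut_chi ::
    "('a::unital_cstar_algebra \<Rightarrow> 'a \<Rightarrow> 'b::unital_cstar_algebra) \<Rightarrow> ('a \<Rightarrow> 'b) \<Rightarrow>
     ('a \<Rightarrow> 'u::unital_cstar_algebra) \<Rightarrow>
     ('u \<Rightarrow> 'u \<Rightarrow> 'v::unital_cstar_algebra) \<Rightarrow> ('u \<Rightarrow> 'v) \<Rightarrow> ('u \<Rightarrow> 'u) set"
  where "cqg_aut_chi t \<Delta> \<iota> tU \<Delta>U = {\<alpha> \<in> cqg_aut tU \<Delta>U.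
    \<forall>n u. irreducible_rep t \<Delta> n u \<longrightarrow> \<alpha> (\<iota> (rep_character n u)) = \<iota> (rep_character n u)}"

definition cqg_dynamical_system ::
    "('u::unital_cstar_algebra \<Rightarrow> 'u \<Rightarrow> 'v::unital_cstar_algebra) \<Rightarrow> ('u \<Rightarrow> 'v) \<Rightarrow>
     ('g, 'm) monoid_scheme \<Rightarrow> ('g \<Rightarrow> 'u \<Rightarrow> 'u) \<Rightarrow> bool"
  where "cqg_dynamical_system tU \<Delta>U \<Gamma> \<alpha> \<longleftrightarrow> group \<Gamma> \<and> \<alpha> \<in> hom \<Gamma> (cqg_aut_group tU \<Delta>U)"

definition gns_triple ::
    "('u::unital_cstar_algebra \<Rightarrow> complex) \<Rightarrow> ('u \<Rightarrow> 'h::complex_hilbert_space \<Rightarrow> 'h) \<Rightarrow> 'h \<Rightarrow> bool"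
  where "gns_triple h \<pi> \<Omega> \<longleftrightarrow>
    (\<forall>a. clinear (\<pi> a) \<and> bounded_linear (\<pi> a)) \<and>
    (\<forall>a b x. \<pi> (a + b) x = \<pi> a x + \<pi> b x \<and> \<pi> (a * b) x = \<pi> a (\<pi> b x)) \<and>
    (\<forall>c a x. \<pi> (c *\<^sub>C a) x = c *\<^sub>C \<pi> a x) \<and> \<pi> 1 = id \<and>
    (\<forall>a x y. cinner (\<pi> a x) y = cinner x (\<pi> (star a) y)) \<and>
    (\<forall>a. h a = cinner \<Omega> (\<pi> a \<Omega>)) \<and>
    closure (range (\<lambda>a. \<pi> a \<Omega>)) = UNIV"

definition compact_action ::
    "('g, 'm) monoid_scheme \<Rightarrow> ('g \<Rightarrow> 'u \<Rightarrow> 'u) \<Rightarrow> ('u \<Rightarrow> 'h::complex_hilbert_space \<Rightarrow> 'h) \<Rightarrow> 'h \<Rightarrow> bool"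
  where "compact_action \<Gamma> \<alpha> \<pi> \<Omega> \<longleftrightarrow>
    (\<forall>a. compact (closure {\<pi> (\<alpha> \<gamma> a) \<Omega> | \<gamma>. \<gamma> \<in> carrier \<Gamma>}))"

end

theory Submission
  imports
    Defs
    "HOL-Library.Function_Algebras"
    "HOL-Analysis.Elementary_Metric_Spaces"
    "Jordan_Normal_Form.Char_Poly"
    "HOL-Computational_Algebra.Fundamental_Theorem_Algebra"
begin

text \<open>
  Characters of inequivalent irreducible representations are orthonormal in \<open>L\<^sup>2\<close>, so a relatively
  compact orbit of a character is finite and each character has a stabilizer of finite index. The
  fundamental representation is a sum of finitely many irreducible ones, and an automorphism \<open>\<alpha>\<^sub>\<gamma>\<close>
  fixing their characters acts on the span of their coefficients by a matrix \<open>c(\<gamma>)\<close>. These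
  coefficients generate the CQG algebra as a *-algebra, so the condition that \<open>\<alpha>\<^sub>\<gamma>\<close> fixes any
  further character is a system of polynomial equations in the entries of \<open>c(\<gamma>)\<close> and their
  conjugates. By Hilbert's basis theorem the equations for finitely many characters imply all
  others. Hence \<open>\<Gamma>\<^sub>\<chi>\<close> contains the stabilizer of finitely many points with finite orbits.
\<close>

section \<open>Matrices over C*-algebras\<close>

text \<open>Infinitely many subgroups of finite index can intersect in one of infinite index, so
  compactness alone does not suffice when there are infinitely many characters. The basis theorem
  needs each character to be a star-polynomial in finitely many coefficients, whereas the generating
  hypothesis only gives norm density of such polynomials. A coalgebra argument closes this gap: a
  dense subspace D with \<Delta>(D) inside the algebraic tensor square of D contains every
  coefficient of every irreducible. A second obstacle is that the Haar state is not assumed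
  faithful. What is needed is nondegeneracy on the coefficients of one representation, and this is
  extracted from the density conditions; it makes the conjugate of a representation unitarizable, so
  that the CQG algebra is closed under \<open>star\<close>. Finally, irreducibles live in one
  algebra while automorphisms act on C(G). Schur theory is therefore developed in a locale
  interpreted on both sides, and irreducibility travels between them as the property of having a
  scalar commutant.\<close>

lemma clinear_iff:
  "clinear f \<longleftrightarrow> (\<forall>x y. f (x + y) = f x + f y) \<and> (\<forall>c x. f (c *\<^sub>C x) = c *\<^sub>C f x)"
  by (simp add: clinear_def Vector_Spaces.linear_iff complex_vector.vector_space_axioms)

lemma clinear_add: "clinear f \<Longrightarrow> f (x + y) = f x + f y"
  and clinear_scaleC: "clinear f \<Longrightarrow> f (c *\<^sub>C x) = c *\<^sub>C f x"
  by (auto simp: clinear_iff)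

lemma clinear_0: "clinear f \<Longrightarrow> f 0 = 0"
  using clinear_add[of f 0 0] by simp

lemma clinear_minus: "clinear f \<Longrightarrow> f (- x) = - f x"
  using clinear_add[of f x "- x"] by (simp add: clinear_0 add_eq_0_iff)

lemma clinear_diff: "clinear f \<Longrightarrow> f (x - y) = f x - f y"
  using clinear_add[of f x "- y"] by (simp add: clinear_minus)

lemma clinear_sum: "clinear f \<Longrightarrow> f (sum g I) = (\<Sum>i\<in>I. f (g i))"
  by (induction I rule: infinite_finite_induct) (auto simp: clinear_0 clinear_add)

lemma scaleC_complex_eq [simp]: "(c::complex) *\<^sub>C x = c * x"
  by (simp add: scaleC_complex_def)

lemma star_complex_eq [simp]: "star (c::complex) = cnj c"
  by (simp add: star_complex_def)

lemma scaleC_sum_left: "(\<Sum>i\<in>I. c i) *\<^sub>C (x::'a::complex_normed_vector) = (\<Sum>i\<in>I. c i *\<^sub>C x)"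
  by (rule complex_vector.scale_sum_left)

lemma scaleC_sum_right: "c *\<^sub>C (\<Sum>i\<in>I. x i :: 'a::complex_normed_vector) = (\<Sum>i\<in>I. c *\<^sub>C x i)"
  by (rule complex_vector.scale_sum_right)

lemma bounded_linear_scaleC: "bounded_linear (\<lambda>x::'a::complex_normed_vector. c *\<^sub>C x)"
proof
  show "\<exists>K. \<forall>x::'a. norm (c *\<^sub>C x) \<le> norm x * K"
    by (rule exI[of _ "cmod c"]) (simp add: norm_scaleC)
qed (simp_all add: scaleC_add_right scaleR_scaleC scaleC_scaleC mult.commute)

lemma star_0 [simp]: "star (0::'a::unital_cstar_algebra) = 0"
  using star_add[of 0 "0::'a"] by simp

lemma star_1 [simp]: "star (1::'a::unital_cstar_algebra) = 1"
  by (metis mult.left_neutral star_mult star_star)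

lemma star_minus: "star (- x :: 'a::unital_cstar_algebra) = - star x"
  using star_add[of x "- x"] by (simp add: add_eq_0_iff)

lemma star_diff: "star (x - y :: 'a::unital_cstar_algebra) = star x - star y"
  using star_add[of x "- y"] by (simp add: star_minus)

lemma star_sum: "star (sum f I) = (\<Sum>i\<in>I. star (f i :: 'a::unital_cstar_algebra))"
  by (induction I rule: infinite_finite_induct) (auto simp: star_add)

lemma norm_star: "norm (star x) = norm (x::'a::unital_cstar_algebra)"
proof -
  have *: "norm y \<le> norm (star y)" for y :: 'a
  proof (cases "y = 0")
    case False
    have "norm y * norm y \<le> norm (star y) * norm y"
      using norm_mult_ineq[of "star y" y] norm_star_mult_self[of y] by (simp add: power2_eq_square)
    with False show ?thesis by simp
  qed simp
  from *[of x] *[of "star x"] show ?thesis by (simp add: star_star)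
qed

lemma bounded_linear_star: "bounded_linear (star :: 'a::unital_cstar_algebra \<Rightarrow> 'a)"
proof
  show "\<exists>K. \<forall>x::'a. norm (star x) \<le> norm x * K"
    by (rule exI[of _ 1]) (simp add: norm_star)
qed (simp_all add: star_add scaleR_scaleC star_scaleC)

lemma eq_0_on_dense:
  fixes f :: "'a::complex_normed_vector \<Rightarrow> 'b::complex_normed_vector"
  assumes "bounded_linear f" "clinear f" "closure (cspan S) = UNIV" "\<And>x. x \<in> S \<Longrightarrow> f x = 0"
  shows "f x = 0"
proof -
  have "f x = 0" if "x \<in> cspan S" for x
    using that
  proof (induction rule: complex_vector.span_induct)
    case base
    show ?case
      unfolding complex_vector.subspace_def
      using assms(2) by (auto simp: clinear_iff clinear_0)
  qed (use assms(4) in auto)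
  then have "cspan S \<subseteq> f -` {0}" by auto
  moreover have "closed (f -` {0})"
    using assms(1) by (intro closed_vimage bounded_linear.continuous_on[OF _ continuous_on_id]) simp_all
  ultimately have "closure (cspan S) \<subseteq> f -` {0}"
    by (rule closure_minimal)
  with assms(3) show ?thesis by auto
qed

section \<open>Matrix calculus over arbitrary index sets\<close>

definition mprod ::
    "'k set \<Rightarrow> ('i \<Rightarrow> 'k \<Rightarrow> 'a::semiring_0) \<Rightarrow> ('k \<Rightarrow> 'j \<Rightarrow> 'a) \<Rightarrow> 'i \<Rightarrow> 'j \<Rightarrow> 'a"
  where "mprod K A B = (\<lambda>i j. \<Sum>k\<in>K. A i k * B k j)"

definition adj :: "('i \<Rightarrow> 'j \<Rightarrow> 'a::unital_cstar_algebra) \<Rightarrow> 'j \<Rightarrow> 'i \<Rightarrow> 'a"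
  where "adj A = (\<lambda>i j. star (A j i))"

definition one_on :: "'i set \<Rightarrow> 'i \<Rightarrow> 'i \<Rightarrow> 'a::zero_neq_one"
  where "one_on I = (\<lambda>i j. if i = j \<and> i \<in> I then 1 else 0)"

text \<open>Matrices are total functions that vanish outside their index sets, so that matrix
  equality is equality of functions. Index types are arbitrary: a tensor product of representations
  is indexed by a product of sets.\<close>

definition supp :: "'i set \<Rightarrow> 'j set \<Rightarrow> ('i \<Rightarrow> 'j \<Rightarrow> 'a::zero) \<Rightarrow> bool"
  where "supp I J A \<longleftrightarrow> (\<forall>i j. i \<notin> I \<or> j \<notin> J \<longrightarrow> A i j = 0)"

definition scm :: "('i \<Rightarrow> 'j \<Rightarrow> complex) \<Rightarrow> 'i \<Rightarrow> 'j \<Rightarrow> 'a::unital_cstar_algebra"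
  where "scm X = (\<lambda>i j. X i j *\<^sub>C 1)"

text \<open>The summation sets belong to the product and not to the factors, so associativity is an
  interchange of sums and an unconditional rewrite rule; most matrix computations below are
  regroupings by it.\<close>

lemma mprod_assoc: "mprod K (mprod J A B) C = mprod J A (mprod K B C)"
  unfolding mprod_def
  by (intro ext) (simp add: sum_distrib_left sum_distrib_right mult.assoc, rule sum.swap)

lemma mprod_diff_left: "mprod K (A - B) C = mprod K A C - mprod K B C"
  and mprod_diff_right: "mprod K C (A - B) = mprod K C A - mprod K C B"
  for A B C :: "_ \<Rightarrow> _ \<Rightarrow> 'a::ring"
  by (intro ext; simp add: mprod_def algebra_simps sum_subtractf)+

lemma mprod_0 [simp]: "mprod K 0 C = 0" "mprod K C 0 = 0"
  by (intro ext; simp add: mprod_def)+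

lemma adj_mprod: "adj (mprod K A B) = mprod K (adj B) (adj A)"
  by (intro ext) (simp add: mprod_def adj_def star_sum star_mult)

lemma adj_adj [simp]: "adj (adj A) = A"
  by (simp add: adj_def star_star)

lemma adj_diff: "adj (A - B) = adj A - adj B"
  by (intro ext) (simp add: adj_def star_diff)

lemma adj_one_on [simp]: "adj (one_on I) = one_on I"
  by (intro ext) (auto simp: adj_def one_on_def)

text \<open>Each unit law for \<open>one_on\<close> uses one half of \<open>supp\<close>, and the
  halves propagate through products independently, which lets the simplifier discharge them.\<close>

definition row_supp :: "'i set \<Rightarrow> ('i \<Rightarrow> 'j \<Rightarrow> 'a::zero) \<Rightarrow> bool"
  where "row_supp I A \<longleftrightarrow> (\<forall>i j. i \<notin> I \<longrightarrow> A i j = 0)"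

definition col_supp :: "'j set \<Rightarrow> ('i \<Rightarrow> 'j \<Rightarrow> 'a::zero) \<Rightarrow> bool"
  where "col_supp J A \<longleftrightarrow> (\<forall>i j. j \<notin> J \<longrightarrow> A i j = 0)"

lemma supp_iff: "supp I J A \<longleftrightarrow> row_supp I A \<and> col_supp J A"
  by (auto simp: supp_def row_supp_def col_supp_def)

lemma mprod_one_left [simp]:
  fixes A :: "'i \<Rightarrow> 'j \<Rightarrow> 'a::semiring_1"
  assumes "finite I" "row_supp I A" shows "mprod I (one_on I) A = A"
proof (intro ext)
  fix i j
  have "mprod I (one_on I) A i j = (\<Sum>k\<in>I. if i = k then A k j else 0)"
    unfolding mprod_def one_on_def by (intro sum.cong) auto
  also have "\<dots> = A i j" using assms by (auto simp: row_supp_def)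
  finally show "mprod I (one_on I) A i j = A i j" .
qed

lemma mprod_one_right [simp]:
  fixes A :: "'i \<Rightarrow> 'j \<Rightarrow> 'a::semiring_1"
  assumes "finite J" "col_supp J A" shows "mprod J A (one_on J) = A"
proof (intro ext)
  fix i j
  have "mprod J A (one_on J) i j = (\<Sum>k\<in>J. if j = k then A i k else 0)"
    unfolding mprod_def one_on_def by (intro sum.cong) auto
  also have "\<dots> = A i j" using assms by (auto simp: col_supp_def)
  finally show "mprod J A (one_on J) i j = A i j" .
qed

lemma row_supp_mprod [simp]: "row_supp I A \<Longrightarrow> row_supp I (mprod K A B)"
  and col_supp_mprod [simp]: "col_supp J B \<Longrightarrow> col_supp J (mprod K A B)"
  by (auto simp: row_supp_def col_supp_def mprod_def intro!: sum.neutral)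

lemma row_supp_adj [simp]: "row_supp I (adj A) \<longleftrightarrow> col_supp I A"
  and col_supp_adj [simp]: "col_supp J (adj B) \<longleftrightarrow> row_supp J B"
  by (auto simp: row_supp_def col_supp_def adj_def) (metis star_star star_0)+

lemma row_supp_scm [simp]: "row_supp I A \<Longrightarrow> row_supp I (scm A)"
  and col_supp_scm [simp]: "col_supp J B \<Longrightarrow> col_supp J (scm B)"
  by (auto simp: row_supp_def col_supp_def scm_def)

lemma row_supp_one_on [simp]: "row_supp I (one_on I)" and col_supp_one_on [simp]: "col_supp I (one_on I)"
  by (auto simp: row_supp_def col_supp_def one_on_def)

lemma row_supp_diff [simp]: "row_supp I A \<Longrightarrow> row_supp I B \<Longrightarrow> row_supp I (A - B :: _ \<Rightarrow> _ \<Rightarrow> 'a::group_add)"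
  and col_supp_diff [simp]: "col_supp J C \<Longrightarrow> col_supp J D \<Longrightarrow> col_supp J (C - D :: _ \<Rightarrow> _ \<Rightarrow> 'a::group_add)"
  by (auto simp: row_supp_def col_supp_def)

lemma supp_mprod: "supp I K A \<Longrightarrow> supp K J B \<Longrightarrow> supp I J (mprod K' A B)"
  by (simp add: supp_iff)

lemma scm_mprod: "scm (mprod K X Y) = mprod K (scm X) (scm Y)"
  by (intro ext) (simp add: scm_def mprod_def scaleC_sum_left scaleC_mult_left scaleC_mult_right
      scaleC_scaleC mult.commute)

lemma scm_adj: "scm (adj X) = adj (scm X)"
  by (intro ext) (simp add: scm_def adj_def star_scaleC)

lemma scm_one_on [simp]: "scm (one_on I) = one_on I"
  by (intro ext) (auto simp: scm_def one_on_def)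

lemma scm_diff: "scm (X - Y) = scm X - scm Y"
  by (intro ext) (simp add: scm_def complex_vector.scale_left_diff_distrib)

lemma scm_scale: "scm (\<lambda>i j. c * X i j) = (\<lambda>i j. c *\<^sub>C scm X i j)"
  by (simp add: scm_def scaleC_scaleC)

lemma mprod_scale_left: "mprod K (\<lambda>i j. c *\<^sub>C A i j) B = (\<lambda>i j. c *\<^sub>C mprod K A B i j)"
  and mprod_scale_right: "mprod K A (\<lambda>i j. c *\<^sub>C B i j) = (\<lambda>i j. c *\<^sub>C mprod K A B i j)"
  for A B :: "_ \<Rightarrow> _ \<Rightarrow> 'a::unital_cstar_algebra"
  unfolding mprod_def by (simp_all only: scaleC_mult_left scaleC_mult_right scaleC_sum_right)

lemma scm_mprod_apply: "mprod K (scm X) A i j = (\<Sum>k\<in>K. X i k *\<^sub>C A k j)"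
  unfolding mprod_def scm_def by (simp only: scaleC_mult_left mult_1_left)

lemma mprod_scm_apply: "mprod K A (scm X) i j = (\<Sum>k\<in>K. X k j *\<^sub>C A i k)"
  unfolding mprod_def scm_def by (simp only: scaleC_mult_right mult_1_right)

section \<open>Representations and Schur orthogonality\<close>

lemma star_hom_onD:
  assumes "star_hom_on S f"
  shows "x \<in> S \<Longrightarrow> y \<in> S \<Longrightarrow> f (x + y) = f x + f y"
    and "x \<in> S \<Longrightarrow> y \<in> S \<Longrightarrow> f (x * y) = f x * f y"
    and "x \<in> S \<Longrightarrow> f (c *\<^sub>C x) = c *\<^sub>C f x"
    and "x \<in> S \<Longrightarrow> f (star x) = star (f x)"
    and "f 1 = 1"
  using assms by (auto simp: star_hom_on_def)

lemma star_hom_clinear: "star_hom f \<Longrightarrow> clinear f"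
  by (auto simp: star_hom_on_def clinear_iff)

text \<open>The structure behind Schur orthogonality: tensor calculus and left invariance of
  \<open>h\<close>, expressed by the slice map \<open>L\<close>. It is interpreted both for the
  algebra carrying the representations and for C(G), on which automorphisms act.\<close>

locale haar_bialgebra =
  fixes t :: "'a::unital_cstar_algebra \<Rightarrow> 'a \<Rightarrow> 'b::unital_cstar_algebra"
    and \<Delta> :: "'a \<Rightarrow> 'b" and h :: "'a \<Rightarrow> complex" and L :: "'b \<Rightarrow> 'a"
  assumes t_clinear_right: "clinear (\<lambda>b. t a b)" and t_clinear_left: "clinear (\<lambda>a. t a b)"
    and t_mult: "t a b * t a' b' = t (a * a') (b * b')"
    and t_star: "star (t a b) = t (star a) (star b)"
    and star_hom_\<Delta>: "star_hom \<Delta>"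
    and state_h: "state h"
    and L_clinear: "clinear L" and L_bounded: "bounded_linear L"
    and L_t: "L (t a b) = h a *\<^sub>C b" and L_\<Delta>: "L (\<Delta> a) = h a *\<^sub>C 1"
begin

lemma h_clinear: "clinear h" and h_1: "h 1 = 1"
  using state_h by (auto simp: state_def)

lemma h_scaleC: "h (c *\<^sub>C x) = c * h x"
  using clinear_scaleC[OF h_clinear] by simp

lemmas h_add = clinear_add[OF h_clinear] and h_diff = clinear_diff[OF h_clinear]
  and h_sum = clinear_sum[OF h_clinear] and h_0 = clinear_0[OF h_clinear]

lemma h_nonneg: "h (star a * a) \<in> \<real>" "0 \<le> Re (h (star a * a))"
  using state_h by (auto simp: state_def)

lemma h_bounded: "bounded_linear h"
proof
  show "h (x + y) = h x + h y" for x y by (rule h_add)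
  show "h (r *\<^sub>R x) = r *\<^sub>R h x" for r x by (simp add: scaleR_scaleC h_scaleC scaleR_conv_of_real)
  show "\<exists>K. \<forall>x. norm (h x) \<le> norm x * K"
    using state_h by (intro exI[of _ 1]) (auto simp: state_def)
qed

lemmas \<Delta>_clinear = star_hom_clinear[OF star_hom_\<Delta>]
lemma \<Delta>_mult: "\<Delta> (x * y) = \<Delta> x * \<Delta> y" and \<Delta>_star: "\<Delta> (star x) = star (\<Delta> x)" and \<Delta>_1: "\<Delta> 1 = 1"
  using star_hom_\<Delta> by (auto simp: star_hom_on_def)
lemmas \<Delta>_sum = clinear_sum[OF \<Delta>_clinear] and L_sum = clinear_sum[OF L_clinear]
  and \<Delta>_0 = clinear_0[OF \<Delta>_clinear]
lemmas t_sum_right = clinear_sum[OF t_clinear_right] and t_sum_left = clinear_sum[OF t_clinear_left]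
  and t_scaleC_right = clinear_scaleC[OF t_clinear_right] and t_scaleC_left = clinear_scaleC[OF t_clinear_left]
  and t_0_right = clinear_0[OF t_clinear_right] and t_0_left = clinear_0[OF t_clinear_left]

definition urep :: "'i set \<Rightarrow> ('i \<Rightarrow> 'i \<Rightarrow> 'a) \<Rightarrow> bool"
  where "urep I u \<longleftrightarrow> finite I \<and> supp I I u \<and> mprod I u (adj u) = one_on I \<and>
    mprod I (adj u) u = one_on I \<and>
    (\<forall>i\<in>I. \<forall>j\<in>I. \<Delta> (u i j) = (\<Sum>k\<in>I. t (u i k) (u k j)))"

lemma urepD:
  assumes "urep I u"
  shows "finite I" "supp I I u" "mprod I u (adj u) = one_on I" "mprod I (adj u) u = one_on I"
    and "\<Delta> (u i j) = (\<Sum>k\<in>I. t (u i k) (u k j))"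
proof -
  show "finite I" "supp I I u" "mprod I u (adj u) = one_on I" "mprod I (adj u) u = one_on I"
    using assms by (auto simp: urep_def)
  show "\<Delta> (u i j) = (\<Sum>k\<in>I. t (u i k) (u k j))"
  proof (cases "i \<in> I \<and> j \<in> I")
    case False
    then have 0: "u i j = 0" "u i k = 0 \<or> u k j = 0" for k
      using \<open>supp I I u\<close> by (auto simp: supp_def)
    have "t (u i k) (u k j) = 0" for k
      using 0(2)[of k] t_0_left t_0_right by auto
    then show ?thesis
      by (simp add: \<Delta>_0 0(1))
  qed (use assms in \<open>auto simp: urep_def\<close>)
qed

lemma urep_sum_left:
  assumes "urep I u" shows "(\<Sum>k\<in>I. star (u k i) * u k j) = one_on I i j"
  using fun_cong[OF fun_cong[OF urepD(4)[OF assms]], of i j] by (simp add: mprod_def adj_def)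

lemma urep_sum_right:
  assumes "urep I u" shows "(\<Sum>k\<in>I. u i k * star (u j k)) = one_on I i j"
  using fun_cong[OF fun_cong[OF urepD(3)[OF assms]], of i j] by (simp add: mprod_def adj_def)

text \<open>Irreducibility as a scalar commutant. Being a condition on equations in the algebra, it
  is easy to transport along automorphisms and along \<iota>.\<close>

definition schur :: "'i set \<Rightarrow> ('i \<Rightarrow> 'i \<Rightarrow> 'a) \<Rightarrow> bool"
  where "schur I u \<longleftrightarrow>
    (\<forall>X. supp I I X \<and> mprod I (scm X) u = mprod I u (scm X) \<longrightarrow> (\<exists>c. X = (\<lambda>i j. c * one_on I i j)))"

lemma schurD:
  assumes "schur I u" "supp I I X" "mprod I (scm X) u = mprod I u (scm X)"
  obtains c where "X = (\<lambda>i j. c * one_on I i j)"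
  using assms unfolding schur_def by blast

text \<open>The average under \<open>h\<close> of the matrix unit at \<open>(k, l)\<close>, placed
  between the adjoint of \<open>v\<close> and \<open>w\<close>.\<close>

definition hmat :: "('i \<Rightarrow> 'i \<Rightarrow> 'a) \<Rightarrow> ('j \<Rightarrow> 'j \<Rightarrow> 'a) \<Rightarrow> 'i \<Rightarrow> 'j \<Rightarrow> 'i \<Rightarrow> 'j \<Rightarrow> complex"
  where "hmat v w k l = (\<lambda>i j. h (star (v k i) * w l j))"

lemma supp_hmat: "supp I I v \<Longrightarrow> supp J J w \<Longrightarrow> supp I J (hmat v w k l)"
  by (auto simp: supp_def hmat_def h_0)

text \<open>Left invariance at \<open>star (v k i) * w l j\<close> says that the average is
  unchanged when placed between \<open>adj v\<close> and \<open>w\<close>; multiplying by the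
  unitary \<open>v\<close> turns this into an intertwining relation.\<close>

lemma hmat_intertwines:
  assumes v: "urep I v" and w: "urep J w"
  shows "mprod J (scm (hmat v w k l)) w = mprod I v (scm (hmat v w k l))"
proof -
  let ?E = "hmat v w k l"
  have "mprod I (adj v) (mprod J (scm ?E) w) = scm ?E"
  proof (intro ext)
    fix i j
    have "\<Delta> (star (v k i) * w l j) =
        (\<Sum>a\<in>I. \<Sum>b\<in>J. t (star (v k a) * w l b) (star (v a i) * w b j))"
      by (simp add: \<Delta>_mult \<Delta>_star urepD(5)[OF v] urepD(5)[OF w] star_sum t_star sum_product t_mult)
    then have "h (star (v k i) * w l j) *\<^sub>C 1 =
        (\<Sum>a\<in>I. \<Sum>b\<in>J. h (star (v k a) * w l b) *\<^sub>C (star (v a i) * w b j))"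
      using L_\<Delta>[of "star (v k i) * w l j"] by (simp add: L_sum L_t)
    then show "mprod I (adj v) (mprod J (scm ?E) w) i j = scm ?E i j"
      by (simp add: mprod_def scm_def adj_def hmat_def sum_distrib_left scaleC_mult_left scaleC_mult_right)
  qed
  then have "mprod I v (scm ?E) = mprod I (mprod I v (adj v)) (mprod J (scm ?E) w)"
    by (simp add: mprod_assoc)
  also have "\<dots> = mprod J (scm ?E) w"
    using urepD(1-3)[OF v] urepD(1-3)[OF w] supp_hmat[of I v J w k l]
    by (simp add: supp_iff)
  finally show ?thesis ..
qed

lemma schur_hmat:
  assumes w: "urep I w" and s: "schur I w" 
  obtains c where "\<And>i j. hmat w w k l i j = c * one_on I i j"
  using hmat_intertwines[OF w w, of k l] s urepD(2)[OF w]
  unfolding schur_def by (metis (no_types, lifting) supp_hmat)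

text \<open>Adjoints give the relation for \<open>adj w\<close> and \<open>adj v\<close>; unitarity
  of \<open>w\<close> on the left and of \<open>v\<close> on the right restores the representations
  themselves.\<close>

lemma intertwiner_adj:
  assumes v: "urep I v" and w: "urep J w"
    and E: "supp I J E" "mprod J (scm E) w = mprod I v (scm E)"
  shows "mprod I (scm (adj E)) v = mprod J w (scm (adj E))"
proof -
  note fin = urepD(1)[OF v] urepD(1)[OF w]
  note vv = urepD(2-4)[OF v] and ww = urepD(2-4)[OF w]
  have sE: "row_supp I E" "col_supp J E" and rc: "row_supp I v" "col_supp I v" "row_supp J w" "col_supp J w"
    using E(1) vv(1) ww(1) by (simp_all add: supp_iff)
  have "mprod J (adj w) (scm (adj E)) = mprod I (scm (adj E)) (adj v)"
    using arg_cong[OF E(2), of adj] by (simp add: adj_mprod scm_adj)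
  then have *: "mprod J w (mprod I (mprod J (adj w) (scm (adj E))) v)
      = mprod J w (mprod I (mprod I (scm (adj E)) (adj v)) v)"
    by simp
  have "mprod J w (mprod I (mprod J (adj w) (scm (adj E))) v) =
      mprod J (mprod J w (adj w)) (mprod I (scm (adj E)) v)"
    by (simp only: mprod_assoc)
  also have "\<dots> = mprod I (scm (adj E)) v"
    using fin sE rc ww(2) by simp
  finally have l: "mprod J w (mprod I (mprod J (adj w) (scm (adj E))) v) = mprod I (scm (adj E)) v" .
  have "mprod J w (mprod I (mprod I (scm (adj E)) (adj v)) v) =
     mprod J w (mprod I (scm (adj E)) (mprod I (adj v) v))"
    by (simp only: mprod_assoc)
  also have "\<dots> = mprod J w (scm (adj E))"
    using fin sE rc vv(3) by simp
  finally show ?thesis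
    using * l by simp
qed

text \<open>A nonzero intertwiner between representations with scalar commutant is a multiple of a
  unitary: its two products with its adjoint are the same nonzero scalar \<mu>. So \<open>v\<close>
  is \<open>E\<close> times \<open>w\<close> times \<open>adj E\<close>, divided by \<mu>; this
  expresses the coefficients, and taking the trace compares the characters.\<close>

lemma schur_dichotomy_aux:
  assumes v: "urep I v" "schur I v" and w: "urep J w" "schur J w"
    and E: "supp I J E" "mprod J (scm E) w = mprod I v (scm E)" "E i0 j0 \<noteq> 0"
  shows "(\<Sum>i\<in>I. v i i) = (\<Sum>j\<in>J. w j j)" (is ?A)
    and "\<exists>c. v i j = (\<Sum>a\<in>J. \<Sum>b\<in>J. c a b *\<^sub>C w a b)" (is ?B)
proof -
  note fin = urepD(1)[OF v(1)] urepD(1)[OF w(1)]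
  note vv = urepD(2-4)[OF v(1)] and ww = urepD(2-4)[OF w(1)]
  have sE: "row_supp I E" "col_supp J E" and rc: "row_supp I v" "col_supp I v" "row_supp J w" "col_supp J w"
    using E(1) vv(1) ww(1) by (simp_all add: supp_iff)
  have E': "mprod I (scm (adj E)) v = mprod J w (scm (adj E))"
    by (rule intertwiner_adj[OF v(1) w(1) E(1,2)])
  have "mprod J (scm (mprod I (adj E) E)) w = mprod J w (scm (mprod I (adj E) E))"
    by (simp add: scm_mprod mprod_assoc E(2)) (simp only: mprod_assoc[symmetric] E')
  then obtain \<mu> where \<mu>: "mprod I (adj E) E = (\<lambda>i j. \<mu> * one_on J i j)"
    using sE by (elim schurD[OF w(2), rotated]) (simp_all add: supp_iff)
  have "mprod I (scm (mprod J E (adj E))) v = mprod I v (scm (mprod J E (adj E)))"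
    by (simp add: scm_mprod mprod_assoc E') (simp only: mprod_assoc[symmetric] E(2))
  then obtain \<mu>' where \<mu>': "mprod J E (adj E) = (\<lambda>i j. \<mu>' * one_on I i j)"
    using sE by (elim schurD[OF v(2), rotated]) (simp_all add: supp_iff)
  have ij0: "i0 \<in> I" "j0 \<in> J" using E(1,3) by (auto simp: supp_def)
  \<comment> \<open>Both groupings of this triple product, read off at the nonzero entry, identify
    the two scalars.\<close>
  have "mprod I (mprod J E (adj E)) E = mprod J E (mprod I (adj E) E)"
    by (simp add: mprod_assoc)
  then have "mprod I (\<lambda>i j. \<mu>' * one_on I i j) E i0 j0 = mprod J E (\<lambda>i j. \<mu> * one_on J i j) i0 j0"
    unfolding \<mu> \<mu>' by simp
  moreover have "mprod I (\<lambda>i j. \<mu>' * one_on I i j) E i0 j0 = \<mu>' * mprod I (one_on I) E i0 j0"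
    "mprod J E (\<lambda>i j. \<mu> * one_on J i j) i0 j0 = \<mu> * mprod J E (one_on J) i0 j0"
    unfolding mprod_def by (simp_all add: sum_distrib_left mult_ac)
  ultimately have eq: "\<mu>' = \<mu>"
    using fin sE E(3) by simp
  \<comment> \<open>The scalar is the squared norm of column \<open>j0\<close>, which contains the
    nonzero entry.\<close>
  have "\<mu> = (\<Sum>i\<in>I. cnj (E i j0) * E i j0)"
    using fun_cong[OF fun_cong[OF \<mu>], of j0 j0] ij0 by (simp add: mprod_def adj_def one_on_def)
  also have "\<dots> = complex_of_real (\<Sum>i\<in>I. (cmod (E i j0))\<^sup>2)"
    by (simp only: of_real_sum complex_norm_square mult.commute)
  also have "(\<Sum>i\<in>I. (cmod (E i j0))\<^sup>2) > 0"
    using fin(1) ij0(1) E(3) by (intro sum_pos2[of _ i0]) auto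
  then have "complex_of_real (\<Sum>i\<in>I. (cmod (E i j0))\<^sup>2) \<noteq> 0"
    by (metis of_real_eq_0_iff less_irrefl)
  finally have \<mu>0: "\<mu> \<noteq> 0" .
  have "mprod I v (scm (mprod J E (adj E))) = mprod J (scm E) (mprod J w (scm (adj E)))"
    by (simp add: scm_mprod) (simp only: mprod_assoc[symmetric] E(2))
  moreover have "mprod I v (scm (mprod J E (adj E))) = (\<lambda>i j. \<mu> *\<^sub>C v i j)"
    unfolding \<mu>' eq using fin rc by (simp add: scm_scale mprod_scale_right)
  ultimately have veq: "\<mu> *\<^sub>C v i j = (\<Sum>a\<in>J. \<Sum>b\<in>J. (E i a * cnj (E j b)) *\<^sub>C w a b)" for i j
    by (simp add: fun_eq_iff scm_mprod_apply mprod_scm_apply adj_def scaleC_sum_right scaleC_scaleC)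
  have v_eq: "v i j = (\<Sum>a\<in>J. \<Sum>b\<in>J. (inverse \<mu> * (E i a * cnj (E j b))) *\<^sub>C w a b)" for i j
    using arg_cong[OF veq[of i j], of "\<lambda>x. inverse \<mu> *\<^sub>C x"] \<mu>0
    by (simp add: scaleC_scaleC scaleC_sum_right)
  show ?B by (rule exI[of _ "\<lambda>a b. inverse \<mu> * (E i a * cnj (E j b))"]) (rule v_eq)
  have "(\<Sum>i\<in>I. v i i) = (\<Sum>i\<in>I. \<Sum>a\<in>J. \<Sum>b\<in>J. (inverse \<mu> * (E i a * cnj (E i b))) *\<^sub>C w a b)"
    using v_eq by simp
  also have "\<dots> = (\<Sum>a\<in>J. \<Sum>b\<in>J. \<Sum>i\<in>I. (inverse \<mu> * (E i a * cnj (E i b))) *\<^sub>C w a b)"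
    by (subst sum.swap, intro sum.cong refl, subst sum.swap) simp
  also have "\<dots> = (\<Sum>a\<in>J. \<Sum>b\<in>J. (inverse \<mu> * (mprod I (adj E) E b a)) *\<^sub>C w a b)"
    by (simp add: mprod_def adj_def sum_distrib_left scaleC_sum_left mult_ac)
  also have "\<dots> = (\<Sum>a\<in>J. \<Sum>b\<in>J. if b = a then w a b else 0)"
    using \<mu>0 by (intro sum.cong) (auto simp: \<mu> one_on_def)
  also have "\<dots> = (\<Sum>a\<in>J. w a a)"
    using fin by (simp add: sum.delta)
  finally show ?A .
qed

text \<open>Orthogonality makes \<open>h (star (w k i) * w l j)\<close> vanish for different columns
  and independent of the column for equal ones. So all columns may be replaced by one
  \<open>i0\<close>, and the sum becomes \<open>h\<close> of the unitarity relation for that column.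
  Comparing columns only avoids the modular matrices of a non-tracial Haar state.\<close>

lemma h_character_norm:
  assumes w: "urep I w" "schur I w" and "I \<noteq> {}"
  shows "h (star (\<Sum>i\<in>I. w i i) * (\<Sum>i\<in>I. w i i)) = 1"
proof -
  obtain i0 where i0: "i0 \<in> I" using \<open>I \<noteq> {}\<close> by auto
  have *: "h (star (w k i) * w l j) = (if i = j then h (star (w k i0) * w l i0) else 0)"
    if "i \<in> I" "j \<in> I" for i j k l
  proof -
    obtain c where "\<And>i j. hmat w w k l i j = c * one_on I i j"
      using schur_hmat[OF w] by blast
    then show ?thesis using that i0 by (auto simp: hmat_def one_on_def)
  qed
  have "h (star (\<Sum>i\<in>I. w i i) * (\<Sum>i\<in>I. w i i)) = (\<Sum>i\<in>I. \<Sum>j\<in>I. h (star (w i i) * w j j))"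
    by (simp add: star_sum sum_product h_sum)
  also have "\<dots> = (\<Sum>i\<in>I. \<Sum>j\<in>I. if i = j then h (star (w i i0) * w j i0) else 0)"
    by (intro sum.cong refl *)
  also have "\<dots> = h (\<Sum>i\<in>I. star (w i i0) * w i i0)"
    using urepD(1)[OF w(1)] by (simp add: h_sum)
  also have "\<dots> = 1" using urep_sum_left[OF w(1), of i0 i0] i0 by (simp add: one_on_def h_1)
  finally show ?thesis .
qed

lemma schur_dichotomy:
  assumes v: "urep I v" "schur I v" and w: "urep J w" "schur J w"
  shows "((\<Sum>i\<in>I. v i i) = (\<Sum>j\<in>J. w j j) \<and>
      (\<forall>i j. \<exists>c. v i j = (\<Sum>a\<in>J. \<Sum>b\<in>J. c a b *\<^sub>C w a b))) \<or>
    h (star (\<Sum>i\<in>I. v i i) * (\<Sum>j\<in>J. w j j)) = 0"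
proof (cases "\<forall>k l i j. hmat v w k l i j = 0")
  case True
  then have "h (star (\<Sum>i\<in>I. v i i) * (\<Sum>j\<in>J. w j j)) = 0"
    by (simp add: star_sum sum_product h_sum hmat_def)
  then show ?thesis ..
next
  case False
  then obtain k l i0 j0 where "hmat v w k l i0 j0 \<noteq> 0" by blast
  from schur_dichotomy_aux[OF v w supp_hmat[OF urepD(2)[OF v(1)] urepD(2)[OF w(1)]]
      hmat_intertwines[OF v(1) w(1)] this]
  show ?thesis by blast
qed

text \<open>Equal characters rule out the orthogonal alternative, because a character has norm
  one.\<close>

lemma schur_same_character:
  assumes v: "urep I v" "schur I v" and w: "urep J w" "schur J w" and "J \<noteq> {}"
    and eq: "(\<Sum>i\<in>I. v i i) = (\<Sum>j\<in>J. w j j)"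
  obtains c where "v i j = (\<Sum>a\<in>J. \<Sum>b\<in>J. c a b *\<^sub>C w a b)"
  using schur_dichotomy[OF v w] h_character_norm[OF w \<open>J \<noteq> {}\<close>] eq by auto

text \<open>Pythagoras for two orthogonal unit vectors: the value is 1 + 1.\<close>

lemma schur_character_distance:
  assumes v: "urep I v" "schur I v" "I \<noteq> {}" and w: "urep J w" "schur J w" "J \<noteq> {}"
    and neq: "(\<Sum>i\<in>I. v i i) \<noteq> (\<Sum>j\<in>J. w j j)"
  shows "h (star ((\<Sum>i\<in>I. v i i) - (\<Sum>j\<in>J. w j j)) * ((\<Sum>i\<in>I. v i i) - (\<Sum>j\<in>J. w j j))) = 2"
proof -
  have "h (star (\<Sum>i\<in>I. v i i) * (\<Sum>j\<in>J. w j j)) = 0" "h (star (\<Sum>i\<in>J. w i i) * (\<Sum>j\<in>I. v j j)) = 0"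
    using schur_dichotomy[OF v(1,2) w(1,2)] schur_dichotomy[OF w(1,2) v(1,2)] neq by auto
  then show ?thesis
    using h_character_norm[OF v] h_character_norm[OF w] by (simp add: star_diff algebra_simps h_diff h_add)
qed

text \<open>If \<open>X\<close> commutes with the unitary \<open>w\<close>, then \<open>X\<close>
  equals its conjugate by \<open>w\<close>, and applying \<open>h\<close> entrywise to that
  conjugate leaves a scalar matrix. This converse of Schur orthogonality recovers the scalar
  commutant after a map known to preserve the values of the Haar state.\<close>

lemma schurI:
  assumes w: "urep I w"
    and rel: "\<And>k l i j. i \<in> I \<Longrightarrow> j \<in> I \<Longrightarrow> h (star (w k i) * w l j) = c k l * one_on I i j"
  shows "schur I w"
  unfolding schur_def
proof (intro allI impI, elim conjE)
  fix X :: "'c \<Rightarrow> 'c \<Rightarrow> complex"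
  assume X: "supp I I X" and eq: "mprod I (scm X) w = mprod I w (scm X)"
  note fin = urepD(1)[OF w]
  define d where "d = (\<Sum>k\<in>I. \<Sum>l\<in>I. X k l * c k l)"
  have "X i j = d * one_on I i j" if ij: "i \<in> I" "j \<in> I" for i j
  proof -
    have "mprod I (adj w) (mprod I w (scm X)) = mprod I (mprod I (adj w) w) (scm X)"
      by (simp add: mprod_assoc)
    also have "\<dots> = scm X"
      using urepD(1,4)[OF w] X by (simp add: supp_iff)
    finally have "X i j = h (mprod I (adj w) (mprod I w (scm X)) i j)"
      by (simp add: scm_def h_scaleC h_1)
    also have "\<dots> = h (mprod I (adj w) (mprod I (scm X) w) i j)"
      by (simp add: eq)
    also have "\<dots> = (\<Sum>k\<in>I. \<Sum>l\<in>I. X k l * h (star (w k i) * w l j))"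
      by (simp add: mprod_def adj_def scm_def sum_distrib_left scaleC_mult_left scaleC_mult_right h_sum h_scaleC)
    also have "\<dots> = d * one_on I i j"
      using ij by (simp add: rel d_def sum_distrib_right mult.assoc)
    finally show ?thesis .
  qed
  then have "X = (\<lambda>i j. d * one_on I i j)"
    using X by (intro ext) (metis (no_types, lifting) mult_zero_right one_on_def supp_def)
  then show "\<exists>c. X = (\<lambda>i j. c * one_on I i j)" by blast
qed

end

section \<open>Consequences of the density conditions\<close>

lemma sum_rotate:
  "(\<Sum>i\<in>I. \<Sum>j\<in>J. \<Sum>k\<in>K. f i j k) = (\<Sum>j\<in>J. \<Sum>k\<in>K. \<Sum>i\<in>I. f i j k)"
  by (simp only: sum.swap[of _ I])

definition bounded_clinear :: "('a::complex_normed_vector \<Rightarrow> 'b::complex_normed_vector) \<Rightarrow> bool"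
  where "bounded_clinear f \<longleftrightarrow> clinear f \<and> bounded_linear f"

lemma bounded_clinear_compose:
  "bounded_clinear f \<Longrightarrow> bounded_clinear g \<Longrightarrow> bounded_clinear (\<lambda>x. f (g x))"
  by (auto simp: bounded_clinear_def clinear_iff intro: bounded_linear_compose)

lemma bounded_clinear_mult_left:
  "bounded_clinear f \<Longrightarrow> bounded_clinear (\<lambda>x. f x * (a::'a::unital_cstar_algebra))"
  unfolding bounded_clinear_def
  by (auto simp: clinear_iff algebra_simps scaleC_mult_left intro: bounded_linear_compose[OF bounded_linear_mult_left])

lemma bounded_clinear_mult_right:
  "bounded_clinear f \<Longrightarrow> bounded_clinear (\<lambda>x. (a::'a::unital_cstar_algebra) * f x)"
  unfolding bounded_clinear_def
  by (auto simp: clinear_iff algebra_simps scaleC_mult_right intro: bounded_linear_compose[OF bounded_linear_mult_right])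

lemma bounded_clinear_diff:
  "bounded_clinear f \<Longrightarrow> bounded_clinear g \<Longrightarrow> bounded_clinear (\<lambda>x. f x - g x)"
  unfolding bounded_clinear_def
  by (auto simp: clinear_iff complex_vector.scale_right_diff_distrib intro: bounded_linear_sub)

lemma bounded_clinear_ident: "bounded_clinear (\<lambda>x. x)"
  by (auto simp: bounded_clinear_def clinear_iff)

text \<open>Both operations are antilinear, so complex linearity survives. This transfers a density
  statement about products in one order to products in the opposite order.\<close>

lemma bounded_clinear_cnj_star:
  fixes f :: "'a::unital_cstar_algebra \<Rightarrow> complex"
  assumes "bounded_clinear f" shows "bounded_clinear (\<lambda>x. cnj (f (star x)))"
  using assms unfolding bounded_clinear_def
  by (auto simp: clinear_iff star_add star_scaleC
      intro: bounded_linear_compose[OF bounded_linear_cnj] bounded_linear_compose[OF _ bounded_linear_star])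

lemma bounded_clinear_0_on_dense:
  assumes "bounded_clinear f" "closure (cspan S) = UNIV" "\<And>x. x \<in> S \<Longrightarrow> f x = 0"
  shows "f x = 0"
  using assms eq_0_on_dense unfolding bounded_clinear_def by blast

lemma bounded_clinear_eq_on_dense:
  assumes "bounded_clinear f" "bounded_clinear g" "closure (cspan S) = UNIV" "\<And>x. x \<in> S \<Longrightarrow> f x = g x"
  shows "f x = g x"
  using bounded_clinear_0_on_dense[OF bounded_clinear_diff[OF assms(1,2)] assms(3)] assms(4) by auto

context haar_bialgebra
begin

text \<open>Polarisation: \<open>h\<close> is real at the squares of \<open>x + y\<close> and of
  \<open>x + \<i> *\<^sub>C y\<close>, and these two facts fix the imaginary and the real
  part.\<close>

lemma h_star_mult: "h (star x * y) = cnj (h (star y * x))"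
proof -
  let ?z = "h (star x * y)" and ?z' = "h (star y * x)"
  have "star (x + y) * (x + y) = star x * x + star y * y + star x * y + star y * x"
    by (simp add: star_add algebra_simps)
  then have "?z + ?z' = h (star (x + y) * (x + y)) - h (star x * x) - h (star y * y)"
    by (simp add: h_add)
  then have 1: "Im (?z + ?z') = 0"
    using h_nonneg(1)[of x] h_nonneg(1)[of y] h_nonneg(1)[of "x + y"] by (simp add: complex_is_Real_iff)
  have "star (x + \<i> *\<^sub>C y) * (x + \<i> *\<^sub>C y) = star x * x + star y * y + \<i> *\<^sub>C (star x * y) + (- \<i>) *\<^sub>C (star y * x)"
    by (simp add: star_add star_scaleC distrib_left distrib_right left_diff_distrib scaleC_mult_left
        scaleC_mult_right scaleC_scaleC complex_vector.scale_right_diff_distrib)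
  then have "\<i> * ?z - \<i> * ?z' = h (star (x + \<i> *\<^sub>C y) * (x + \<i> *\<^sub>C y)) - h (star x * x) - h (star y * y)"
    by (simp add: h_add h_diff h_scaleC)
  then have "Im (\<i> * ?z - \<i> * ?z') = 0"
    using h_nonneg(1)[of x] h_nonneg(1)[of y] h_nonneg(1)[of "x + \<i> *\<^sub>C y"] by (simp add: complex_is_Real_iff)
  with 1 show ?thesis by (auto simp: complex_eq_iff)
qed

lemma h_star: "h (star x) = cnj (h x)"
  using h_star_mult[of x 1] by simp

text \<open>The degenerate case of Cauchy-Schwarz: for a null \<open>y\<close>, positivity at
  \<open>star a + c *\<^sub>C y\<close> bounds from below an affine function of the real parameter
  \<open>s\<close>, which must therefore be constant.\<close>

lemma h_null:
  assumes "h (star y * y) = 0" shows "h (a * y) = 0"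
proof (rule ccontr)
  define z where "z = h (a * y)"
  define n where "n = Re (h (a * star a))"
  assume "h (a * y) \<noteq> 0"
  then have z: "z * cnj z = complex_of_real ((cmod z)\<^sup>2)" "cmod z > 0"
    by (simp_all add: z_def complex_norm_square flip: complex_norm_square)
  have z': "h (star y * star a) = cnj z"
    using h_star[of "a * y"] by (simp add: star_mult z_def)
  have "0 \<le> n - 2 * s * (cmod z)\<^sup>2" for s
  proof -
    define c where "c = - (complex_of_real s * cnj z)"
    have "star (star a + c *\<^sub>C y) * (star a + c *\<^sub>C y) =
        a * star a + c *\<^sub>C (a * y) + cnj c *\<^sub>C (star y * star a) + (c * cnj c) *\<^sub>C (star y * y)"
      by (simp add: star_add star_scaleC star_star distrib_left distrib_right scaleC_mult_left scaleC_mult_right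
          scaleC_scaleC scaleC_add_right)
    then have "h (star (star a + c *\<^sub>C y) * (star a + c *\<^sub>C y)) = h (a * star a) + (c * z + cnj c * cnj z)"
      by (simp add: h_add h_scaleC assms z' flip: z_def)
    moreover have "c * z + cnj c * cnj z = - (2 * complex_of_real s * (z * cnj z))"
      by (simp add: c_def algebra_simps)
    then have "c * z + cnj c * cnj z = complex_of_real (- (2 * s * (cmod z)\<^sup>2))"
      unfolding z(1) by simp
    ultimately have "Re (h (star (star a + c *\<^sub>C y) * (star a + c *\<^sub>C y))) = n - 2 * s * (cmod z)\<^sup>2"
      by (simp only: n_def plus_complex.sel Re_complex_of_real)
    then show ?thesis using h_nonneg(2)[of "star a + c *\<^sub>C y"] by simp
  qed
  \<comment> \<open>At this \<open>s\<close> the affine function takes the value -1.\<close>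
  from this[of "(n + 1) / (2 * (cmod z)\<^sup>2)"] z(2) show False
    by (simp add: field_simps)
qed

lemma h_bounded_clinear: "bounded_clinear h" and L_bounded_clinear: "bounded_clinear L"
  by (auto simp: bounded_clinear_def h_clinear h_bounded L_clinear L_bounded)

end

section \<open>Strong invariance and nondegeneracy on coefficients\<close>

locale haar_cqg = haar_bialgebra t \<Delta> h L
  for t :: "'a::unital_cstar_algebra \<Rightarrow> 'a \<Rightarrow> 'b::unital_cstar_algebra" and \<Delta> h L +
  fixes R :: "'b \<Rightarrow> 'a"
  assumes R_clinear: "clinear R" and R_bounded: "bounded_linear R"
    and R_t: "R (t a b) = h b *\<^sub>C a" and R_\<Delta>: "R (\<Delta> a) = h a *\<^sub>C 1"
    and dense_t: "closure (cspan {t a b | a b. True}) = UNIV"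
    and dense_right: "closure (cspan {\<Delta> a * t 1 b | a b. True}) = UNIV"
    and dense_left: "closure (cspan {\<Delta> a * t b 1 | a b. True}) = UNIV"
begin

lemma R_bounded_clinear: "bounded_clinear R"
  by (auto simp: bounded_clinear_def R_clinear R_bounded)

lemmas R_sum = clinear_sum[OF R_clinear]

lemma L_mult_right: "L (Z * t 1 c) = L Z * c"
  by (rule bounded_clinear_eq_on_dense[OF _ _ dense_t])
    (auto intro!: bounded_clinear_compose[OF L_bounded_clinear] bounded_clinear_mult_left
      bounded_clinear_ident L_bounded_clinear simp: t_mult L_t scaleC_mult_left)

lemma L_mult_left: "L (t 1 c * Z) = c * L Z"
  by (rule bounded_clinear_eq_on_dense[OF _ _ dense_t])
    (auto intro!: bounded_clinear_compose[OF L_bounded_clinear] bounded_clinear_mult_right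
      bounded_clinear_ident L_bounded_clinear simp: t_mult L_t scaleC_mult_right)

lemma R_mult_left: "R (t c 1 * Z) = c * R Z"
  by (rule bounded_clinear_eq_on_dense[OF _ _ dense_t])
    (auto intro!: bounded_clinear_compose[OF R_bounded_clinear] bounded_clinear_mult_right
      bounded_clinear_ident R_bounded_clinear simp: t_mult R_t scaleC_mult_right)

text \<open>Unitarity writes \<open>t (w i j) 1\<close> as the sum of
  \<open>\<Delta> (w i k) * t 1 (star (w j k))\<close>, after which left invariance applies to
  \<open>a * w i k\<close>. The element \<open>star (w j k)\<close> stands for the antipode of
  \<open>w k j\<close>.\<close>

lemma L_strong_invariance:
  assumes w: "urep I w" and j: "j \<in> I"
  shows "L (\<Delta> a * t (w i j) 1) = (\<Sum>k\<in>I. h (a * w i k) *\<^sub>C star (w j k))"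
proof -
  have "(\<Sum>k\<in>I. \<Delta> (w i k) * t 1 (star (w j k))) = (\<Sum>k\<in>I. \<Sum>l\<in>I. t (w i l) (w l k * star (w j k)))"
    by (simp add: urepD(5)[OF w] sum_distrib_right t_mult)
  also have "\<dots> = (\<Sum>l\<in>I. t (w i l) (one_on I l j))"
    by (subst sum.swap) (simp add: urep_sum_right[OF w] flip: t_sum_right)
  also have "\<dots> = (\<Sum>l\<in>I. if l = j then t (w i j) 1 else 0)"
    by (intro sum.cong) (auto simp: one_on_def t_0_right)
  also have "\<dots> = t (w i j) 1"
    using j urepD(1)[OF w] by simp
  finally have "L (\<Delta> a * t (w i j) 1) = L (\<Delta> a * (\<Sum>k\<in>I. \<Delta> (w i k) * t 1 (star (w j k))))"
    by simp
  also have "\<dots> = (\<Sum>k\<in>I. L (\<Delta> (a * w i k) * t 1 (star (w j k))))"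
    by (simp add: \<Delta>_mult mult.assoc sum_distrib_left L_sum)
  finally have "L (\<Delta> a * t (w i j) 1) = (\<Sum>k\<in>I. L (\<Delta> (a * w i k) * t 1 (star (w j k))))" .
  then show ?thesis
    by (simp add: L_mult_right L_\<Delta> scaleC_mult_left)
qed

text \<open>The mirror image, with \<open>t 1 (w i j)\<close> written as the sum of
  \<open>t (star (w k i)) 1 * \<Delta> (w k j)\<close>.\<close>

lemma R_strong_invariance:
  assumes w: "urep I w" and i: "i \<in> I"
  shows "R (t 1 (w i j) * \<Delta> b) = (\<Sum>k\<in>I. h (w k j * b) *\<^sub>C star (w k i))"
proof -
  have "(\<Sum>k\<in>I. t (star (w k i)) 1 * \<Delta> (w k j)) = (\<Sum>k\<in>I. \<Sum>l\<in>I. t (star (w k i) * w k l) (w l j))"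
    by (simp add: urepD(5)[OF w] sum_distrib_left t_mult)
  also have "\<dots> = (\<Sum>l\<in>I. t (one_on I i l) (w l j))"
    by (subst sum.swap) (simp add: urep_sum_left[OF w] flip: t_sum_left)
  also have "\<dots> = (\<Sum>l\<in>I. if i = l then t 1 (w i j) else 0)"
    by (intro sum.cong) (auto simp: one_on_def t_0_left)
  also have "\<dots> = t 1 (w i j)"
    using i urepD(1)[OF w] by simp
  finally have "R (t 1 (w i j) * \<Delta> b) = R ((\<Sum>k\<in>I. t (star (w k i)) 1 * \<Delta> (w k j)) * \<Delta> b)"
    by simp
  also have "\<dots> = (\<Sum>k\<in>I. R (t (star (w k i)) 1 * \<Delta> (w k j * b)))"
    by (simp add: \<Delta>_mult mult.assoc sum_distrib_right R_sum)
  finally have "R (t 1 (w i j) * \<Delta> b) = (\<Sum>k\<in>I. R (t (star (w k i)) 1 * \<Delta> (w k j * b)))" .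
  then show ?thesis
    by (simp add: R_mult_left R_\<Delta> scaleC_mult_right)
qed

text \<open>
  The matrices \<open>(h (a w\<^sub>i\<^sub>j))\<^sub>i\<^sub>j\<close>, as \<open>a\<close> varies, form a set \<open>K\<close> with \<open>K = K K\<^sup>*\<close> (this is where
  the density conditions enter), so \<open>K\<close> is self-adjoint and a vector killed by \<open>K\<close> on one side is
  killed by it on the other side.
\<close>

lemma null_left:
  assumes w: "urep I w" and null: "\<And>a k. h (a * (\<Sum>j\<in>I. z j *\<^sub>C w j k)) = 0" and "i \<in> I"
  shows "z i = 0"
proof -
  define y where "y i = (\<Sum>j\<in>I. cnj (z j) *\<^sub>C w i j)" for i
  have *: "(\<Sum>j\<in>I. cnj (z j) * h (star (w j k) * b)) = 0" for k b
  proof -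
    have "(\<Sum>j\<in>I. cnj (z j) * h (star (w j k) * b)) = h (star (\<Sum>j\<in>I. z j *\<^sub>C w j k) * b)"
      by (simp add: star_sum star_scaleC sum_distrib_right scaleC_mult_left h_sum h_scaleC)
    also have "\<dots> = cnj (h (star b * (\<Sum>j\<in>I. z j *\<^sub>C w j k)))"
      by (rule h_star_mult)
    finally show ?thesis using null by simp
  qed
  have "h (L (Z * t (y i) 1)) = 0" for Z i
  proof (rule bounded_clinear_0_on_dense[OF _ dense_right, where f = "\<lambda>Z. h (L (Z * t (y i) 1))"])
    show "bounded_clinear (\<lambda>Z. h (L (Z * t (y i) 1)))"
      by (intro bounded_clinear_compose[OF h_bounded_clinear] bounded_clinear_compose[OF L_bounded_clinear]
        bounded_clinear_mult_left bounded_clinear_ident)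
    fix Z assume "Z \<in> {\<Delta> a * t 1 b | a b. True}"
    then obtain a b where Z: "Z = \<Delta> a * t 1 b" by auto
    have "Z * t (y i) 1 = \<Delta> a * t (y i) 1 * t 1 b"
      by (simp add: Z mult.assoc t_mult)
    then have "L (Z * t (y i) 1) = (\<Sum>j\<in>I. cnj (z j) *\<^sub>C L (\<Delta> a * t (w i j) 1)) * b"
      by (simp add: L_mult_right y_def t_sum_left t_scaleC_left sum_distrib_left scaleC_mult_right L_sum
          clinear_scaleC[OF L_clinear])
    also have "\<dots> = (\<Sum>j\<in>I. \<Sum>k\<in>I. (cnj (z j) * h (a * w i k)) *\<^sub>C (star (w j k) * b))"
      by (simp add: L_strong_invariance[OF w] scaleC_sum_right scaleC_scaleC sum_distrib_right scaleC_mult_left)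
    finally have "h (L (Z * t (y i) 1)) = (\<Sum>j\<in>I. \<Sum>k\<in>I. (cnj (z j) * h (a * w i k)) * h (star (w j k) * b))"
      by (simp add: h_sum h_scaleC)
    also have "\<dots> = (\<Sum>k\<in>I. h (a * w i k) * (\<Sum>j\<in>I. cnj (z j) * h (star (w j k) * b)))"
      by (subst sum.swap) (simp add: sum_distrib_left mult_ac)
    finally show "h (L (Z * t (y i) 1)) = 0" by (simp add: *)
  qed
  \<comment> \<open>Density has carried the identity from the products
    \<open>\<Delta> a * t 1 b\<close> to \<open>t c 1\<close>, where it says that \<open>y i\<close>
    is null.\<close>
  from this[of "t c 1" for c] have "h (c * y i) = 0" for c i
    by (simp add: t_mult L_t h_scaleC h_1)
  then have h0: "(\<Sum>i\<in>I. h (star (y i) * y i)) = 0" by simp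
  \<comment> \<open>\<open>y\<close> is the unitary \<open>w\<close> applied to the conjugate of
    \<open>z\<close>, so this sum is the squared norm of \<open>z\<close>.\<close>
  have "(\<Sum>i\<in>I. star (y i) * y i) =
      (\<Sum>i\<in>I. \<Sum>j\<in>I. \<Sum>k\<in>I. (z j * cnj (z k)) *\<^sub>C (star (w i j) * w i k))"
    by (simp add: y_def star_sum star_scaleC sum_product scaleC_mult_left scaleC_mult_right scaleC_scaleC mult.commute)
  also have "\<dots> = (\<Sum>j\<in>I. \<Sum>k\<in>I. (z j * cnj (z k)) *\<^sub>C one_on I j k)"
    by (subst sum_rotate) (simp add: urep_sum_left[OF w] flip: scaleC_sum_right)
  also have "\<dots> = (\<Sum>j\<in>I. \<Sum>k\<in>I. if j = k then (z j * cnj (z j)) *\<^sub>C 1 else 0)"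
    by (intro sum.cong) (auto simp: one_on_def)
  also have "\<dots> = (\<Sum>j\<in>I. z j * cnj (z j)) *\<^sub>C 1"
    using urepD(1)[OF w] by (simp add: scaleC_sum_left)
  finally have "h (\<Sum>i\<in>I. star (y i) * y i) = (\<Sum>j\<in>I. z j * cnj (z j))"
    by (simp add: h_scaleC h_1)
  then have "(\<Sum>j\<in>I. z j * cnj (z j)) = 0"
    using h0 by (simp add: h_sum)
  then have "complex_of_real (\<Sum>j\<in>I. (cmod (z j))\<^sup>2) = 0"
    by (simp only: of_real_sum complex_norm_square)
  then show ?thesis
    using urepD(1)[OF w] \<open>i \<in> I\<close> by (simp add: sum_nonneg_eq_0_iff del: of_real_sum)
qed

lemma null_right:
  assumes w: "urep I w" and null: "\<And>a k. h ((\<Sum>j\<in>I. z j *\<^sub>C w k j) * a) = 0" and "i \<in> I"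
  shows "z i = 0"
proof -
  define y where "y j = (\<Sum>i\<in>I. cnj (z i) *\<^sub>C w i j)" for j
  have *: "(\<Sum>i\<in>I. cnj (z i) * h (a * star (w k i))) = 0" for k a
  proof -
    have "(\<Sum>i\<in>I. cnj (z i) * h (a * star (w k i))) = h (star (star a) * star (\<Sum>i\<in>I. z i *\<^sub>C w k i))"
      by (simp add: star_sum star_scaleC sum_distrib_left scaleC_mult_right h_sum h_scaleC star_star)
    also have "\<dots> = cnj (h ((\<Sum>i\<in>I. z i *\<^sub>C w k i) * star a))"
      by (subst h_star_mult) (simp add: star_star)
    finally show ?thesis using null by simp
  qed
  \<comment> \<open>The density condition concerns \<open>\<Delta> a * t b 1\<close>, strong
    invariance products in the opposite order. \<open>star\<close> exchanges the two, and the outer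
    conjugation keeps the functional complex linear.\<close>
  have f0: "cnj (h (R (t 1 (y j) * star Z))) = 0" for Z j
  proof (rule bounded_clinear_0_on_dense[OF _ dense_left, where f = "\<lambda>Z. cnj (h (R (t 1 (y j) * star Z)))"])
    show "bounded_clinear (\<lambda>Z. cnj (h (R (t 1 (y j) * star Z))))"
      by (intro bounded_clinear_cnj_star[where f = "\<lambda>Z. h (R (t 1 (y j) * Z))"]
        bounded_clinear_compose[OF h_bounded_clinear] bounded_clinear_compose[OF R_bounded_clinear]
        bounded_clinear_mult_right bounded_clinear_ident)
    fix Z assume "Z \<in> {\<Delta> a * t b 1 | a b. True}"
    then obtain a b where "star Z = star (\<Delta> (star b) * t (star a) 1)" by (auto simp: star_star intro: that[of "star _" "star _"])
    then have Z: "star Z = t a 1 * \<Delta> b"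
      by (simp add: star_mult t_star \<Delta>_star star_star)
    have "t 1 (y j) * star Z = t a 1 * (t 1 (y j) * \<Delta> b)"
      by (simp add: Z t_mult flip: mult.assoc)
    then have "R (t 1 (y j) * star Z) = a * (\<Sum>i\<in>I. cnj (z i) *\<^sub>C R (t 1 (w i j) * \<Delta> b))"
      by (simp add: R_mult_left y_def t_sum_right t_scaleC_right sum_distrib_right scaleC_mult_left R_sum
          clinear_scaleC[OF R_clinear])
    also have "\<dots> = (\<Sum>i\<in>I. \<Sum>k\<in>I. (cnj (z i) * h (w k j * b)) *\<^sub>C (a * star (w k i)))"
      by (simp add: R_strong_invariance[OF w] scaleC_sum_right scaleC_scaleC sum_distrib_left scaleC_mult_right)
    finally have "h (R (t 1 (y j) * star Z)) = (\<Sum>i\<in>I. \<Sum>k\<in>I. (cnj (z i) * h (w k j * b)) * h (a * star (w k i)))"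
      by (simp add: h_sum h_scaleC)
    also have "\<dots> = (\<Sum>k\<in>I. h (w k j * b) * (\<Sum>i\<in>I. cnj (z i) * h (a * star (w k i))))"
      by (subst sum.swap) (simp add: sum_distrib_left mult_ac)
    finally show "cnj (h (R (t 1 (y j) * star Z))) = 0" by (simp add: *)
  qed
  have "h (y j * star (y j)) = 0" for j
    using f0[of j "t 1 (y j)"] by (simp add: t_star t_mult R_t h_scaleC h_1)
  then have h0: "(\<Sum>j\<in>I. h (y j * star (y j))) = 0" by simp
  have "(\<Sum>j\<in>I. y j * star (y j)) =
      (\<Sum>j\<in>I. \<Sum>i\<in>I. \<Sum>k\<in>I. (cnj (z i) * z k) *\<^sub>C (w i j * star (w k j)))"
    by (simp add: y_def star_sum star_scaleC sum_product scaleC_mult_left scaleC_mult_right scaleC_scaleC mult.commute)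
  also have "\<dots> = (\<Sum>i\<in>I. \<Sum>k\<in>I. (cnj (z i) * z k) *\<^sub>C one_on I i k)"
    by (subst sum_rotate) (simp add: urep_sum_right[OF w] flip: scaleC_sum_right)
  also have "\<dots> = (\<Sum>i\<in>I. \<Sum>k\<in>I. if i = k then (z i * cnj (z i)) *\<^sub>C 1 else 0)"
    by (intro sum.cong) (auto simp: one_on_def)
  also have "\<dots> = (\<Sum>i\<in>I. z i * cnj (z i)) *\<^sub>C 1"
    using urepD(1)[OF w] by (simp add: scaleC_sum_left)
  finally have "h (\<Sum>j\<in>I. y j * star (y j)) = (\<Sum>j\<in>I. z j * cnj (z j))"
    by (simp add: h_scaleC h_1)
  then have "(\<Sum>j\<in>I. z j * cnj (z j)) = 0"
    using h0 by (simp add: h_sum)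
  then have "complex_of_real (\<Sum>j\<in>I. (cmod (z j))\<^sup>2) = 0"
    by (simp only: of_real_sum complex_norm_square)
  then show ?thesis
    using urepD(1)[OF w] \<open>i \<in> I\<close> by (simp add: sum_nonneg_eq_0_iff del: of_real_sum)
qed

end

section \<open>Complex matrices\<close>

lemma left_eigenvector:
  fixes X :: "nat \<Rightarrow> nat \<Rightarrow> complex"
  assumes "0 < n"
  shows "\<exists>x l. (\<exists>i<n. x i \<noteq> 0) \<and> (\<forall>j<n. (\<Sum>i<n. x i * X i j) = l * x j)"
proof -
  define A where "A = mat n n (\<lambda>(i, j). X j i)"
  have A: "A \<in> carrier_mat n n" by (simp add: A_def)
  have "\<not> constant (poly (char_poly A))"
    using degree_monic_char_poly[OF A] assms by (simp add: constant_degree)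
  then obtain l where "poly (char_poly A) l = 0"
    using fundamental_theorem_of_algebra by blast
  then obtain v where "eigenvector A v l"
    using eigenvalue_root_char_poly[OF A] by (auto simp: eigenvalue_def)
  then have v: "v \<in> carrier_vec n" "v \<noteq> 0\<^sub>v n" "A *\<^sub>v v = l \<cdot>\<^sub>v v"
    using A by (auto simp: eigenvector_def)
  have "\<exists>i<n. v $ i \<noteq> 0"
  proof (rule ccontr)
    assume "\<not> (\<exists>i<n. v $ i \<noteq> 0)"
    then have "v = 0\<^sub>v n" using v(1) by (intro eq_vecI) auto
    with v(2) show False by simp
  qed
  moreover have "(\<Sum>i<n. v $ i * X i j) = l * v $ j" if "j < n" for j
    using arg_cong[OF v(3), of "\<lambda>y. y $ j"] that v(1)
    by (simp add: A_def scalar_prod_def atLeast0LessThan mult.commute)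
  ultimately show ?thesis by (intro exI[of _ "\<lambda>i. v $ i"] exI[of _ l]) simp
qed

text \<open>A left eigenvector of \<open>X\<close> annihilates \<open>X - l\<close>, hence every
  product with it as first factor. Singularity takes the form of a missing right inverse because
  this is what excludes the identity as range projection.\<close>

lemma singular_shift:
  fixes X :: "nat \<Rightarrow> nat \<Rightarrow> complex"
  assumes "0 < n" "supp {..<n} {..<n} X"
  shows "\<exists>l. \<forall>S. mprod {..<n} (X - (\<lambda>i j. l * one_on {..<n} i j)) S \<noteq> one_on {..<n}"
proof -
  obtain x l where x: "\<exists>i<n. x i \<noteq> 0" "\<And>j. j < n \<Longrightarrow> (\<Sum>i<n. x i * X i j) = l * x j"
    using left_eigenvector[OF \<open>0 < n\<close>, of X] by auto
  define Z where "Z = X - (\<lambda>i j. l * one_on {..<n} i j)"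
  have xZ: "(\<Sum>i<n. x i * Z i j) = 0" for j
  proof (cases "j < n")
    case True
    have "x i * Z i j = x i * X i j - (if i = j then l * x j else 0)" if "i < n" for i
      using that by (simp add: Z_def one_on_def algebra_simps)
    then have "(\<Sum>i<n. x i * Z i j) = (\<Sum>i<n. x i * X i j - (if i = j then l * x j else 0))"
      by (intro sum.cong) auto
    also have "\<dots> = (\<Sum>i<n. x i * X i j) - (\<Sum>i<n. if i = j then l * x j else 0)"
      by (rule sum_subtractf)
    finally show ?thesis using x(2)[OF True] True by simp
  qed (use assms(2) in \<open>simp add: Z_def supp_def one_on_def\<close>)
  have "mprod {..<n} Z S \<noteq> one_on {..<n}" for S
  proof
    assume p1: "mprod {..<n} Z S = one_on {..<n}"
    have "x j = 0" if "j < n" for j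
    proof -
      have "(\<Sum>i<n. x i * mprod {..<n} Z S i j) = (\<Sum>i<n. if i = j then x j else 0)"
        using that by (intro sum.cong) (auto simp: p1 one_on_def)
      then have "x j = (\<Sum>i<n. x i * mprod {..<n} Z S i j)"
        using that by simp
      also have "\<dots> = (\<Sum>k<n. (\<Sum>i<n. x i * Z i k) * S k j)"
        unfolding mprod_def by (simp add: sum_distrib_left sum_distrib_right mult.assoc) (rule sum.swap)
      finally show ?thesis by (simp add: xZ)
    qed
    with x(1) show False by blast
  qed
  then show ?thesis unfolding Z_def by blast
qed

section \<open>Orthonormalisation for positive definite forms\<close>

definition posdef :: "nat \<Rightarrow> (nat \<Rightarrow> nat \<Rightarrow> complex) \<Rightarrow> bool"
  where "posdef n F \<longleftrightarrow> supp {..<n} {..<n} F \<and> adj F = F \<and>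
    (\<forall>z. (\<exists>i<n. z i \<noteq> 0) \<longrightarrow> 0 < Re (\<Sum>i<n. \<Sum>j<n. cnj (z i) * F i j * z j))"

text \<open>The vectors \<open>x j\<close> may be dependent: one with vanishing residual is dropped,
  so \<open>k\<close> can be smaller than \<open>m\<close>. Each \<open>e a\<close> is recorded as a
  combination of the \<open>x j\<close>, which later confines an orthonormal basis to the range of a
  matrix.\<close>

lemma gram_schmidt_vectors:
  fixes F :: "nat \<Rightarrow> nat \<Rightarrow> complex" and x :: "nat \<Rightarrow> nat \<Rightarrow> complex"
  assumes F: "posdef n F"
  defines "B \<equiv> \<lambda>x y. \<Sum>i<n. \<Sum>j<n. cnj (x i) * F i j * y j"
  shows "\<exists>(k::nat) e. (\<forall>a<k. \<exists>s. \<forall>i. e a i = (\<Sum>j<m. x j i * s j)) \<and>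
    (\<forall>a<k. \<forall>b<k. B (e a) (e b) = (if a = b then 1 else 0)) \<and>
    (\<forall>j<m. \<forall>i<n. x j i = (\<Sum>a<k. e a i * B (e a) (x j)))"
proof (induction m)
  case 0
  show ?case by (intro exI[of _ "0::nat"]) simp
next
  case (Suc m)
  have herm: "F i j = cnj (F j i)" for i j
  proof -
    have "adj F = F" using F by (simp only: posdef_def)
    then have "adj F i j = F i j" by simp
    then show ?thesis by (simp add: adj_def)
  qed
  have B_comm: "B f g = cnj (B g f)" for f g
  proof -
    have "cnj (B g f) = (\<Sum>i<n. \<Sum>j<n. g i * F j i * cnj (f j))"
      by (simp add: B_def cnj_sum flip: herm)
    also have "\<dots> = B f g"
      unfolding B_def by (subst sum.swap) (simp add: mult_ac)
    finally show ?thesis ..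
  qed
  have B_diff: "B f (\<lambda>i. g i - g' i) = B f g - B f g'" for f g g'
    by (simp add: B_def algebra_simps sum_subtractf)
  have B_scale: "B f (\<lambda>i. g i * c) = B f g * c" for f g c
    by (simp add: B_def sum_distrib_left sum_distrib_right mult_ac)
  have B_sum: "B f (\<lambda>i. \<Sum>a<k. g a i) = (\<Sum>a<k. B f (g a))" for f g and k :: nat
    by (induction k) (simp_all add: B_def algebra_simps sum.distrib)
  have B_cong: "B f g = B f g'" if "\<And>i. i < n \<Longrightarrow> g i = g' i" for f g g'
    unfolding B_def by (intro sum.cong refl) (simp add: that)
  from Suc obtain k :: nat and e where e: "\<And>a. a < k \<Longrightarrow> \<exists>s. \<forall>i. e a i = (\<Sum>j<m. x j i * s j)"
      "\<And>a b. a < k \<Longrightarrow> b < k \<Longrightarrow> B (e a) (e b) = (if a = b then 1 else 0)"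
      "\<And>j i. j < m \<Longrightarrow> i < n \<Longrightarrow> x j i = (\<Sum>a<k. e a i * B (e a) (x j))"
    by blast
  have e1: "\<exists>s. \<forall>i. e a i = (\<Sum>j<Suc m. x j i * s j)" if a: "a < k" for a
  proof -
    from e(1)[OF a] obtain s where "\<forall>i. e a i = (\<Sum>j<m. x j i * s j)" by blast
    then show ?thesis by (intro exI[of _ "s(m := 0)"]) auto
  qed
  define r where "r i = x m i - (\<Sum>a<k. e a i * B (e a) (x m))" for i
  have Br: "B (e a) r = 0" if "a < k" for a
  proof -
    have "B (e a) r = B (e a) (x m) - (\<Sum>b<k. B (e a) (e b) * B (e b) (x m))"
      by (simp add: r_def[abs_def] B_diff B_sum B_scale)
    also have "(\<Sum>b<k. B (e a) (e b) * B (e b) (x m)) = (\<Sum>b<k. if a = b then B (e b) (x m) else 0)"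
      by (intro sum.cong) (auto simp: e(2) that)
    finally show ?thesis using that by simp
  qed
  show ?case
  proof (cases "\<exists>i<n. r i \<noteq> 0")
    case False
    then have "x m i = (\<Sum>a<k. e a i * B (e a) (x m))" if "i < n" for i
      using that by (auto simp: r_def)
    then have "x j i = (\<Sum>a<k. e a i * B (e a) (x j))" if "j < Suc m" "i < n" for i j
      using that e(3) less_Suc_eq by auto
    then show ?thesis using e1 e(2) by blast
  next
    case True
    define N where "N = Re (B r r)"
    have N: "0 < N" using True F by (auto simp: N_def B_def posdef_def)
    have BN: "B r r = complex_of_real N"
      using B_comm[of r r] by (simp add: N_def complex_eq_iff)
    define c where "c = complex_of_real (1 / sqrt N)"
    have cc: "c * (c * complex_of_real N) = 1" "cnj c = c"
      using N by (simp_all add: c_def flip: of_real_mult)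
    define e' where "e' = e(k := (\<lambda>i. r i * c))"
    have e'_k: "e' k = (\<lambda>i. r i * c)" and e'_e: "a < k \<Longrightarrow> e' a = e a" for a
      by (auto simp: e'_def)
    have "\<exists>s. \<forall>i. e' a i = (\<Sum>j<Suc m. x j i * s j)" if "a < Suc k" for a
    proof (cases "a < k")
      case False
      from e(1) have "\<forall>a. \<exists>s. a < k \<longrightarrow> (\<forall>i. e a i = (\<Sum>j<m. x j i * s j))" by blast
      from choice[OF this] obtain S where S: "\<And>a i. a < k \<Longrightarrow> e a i = (\<Sum>j<m. x j i * S a j)"
        by blast
      \<comment> \<open>\<open>D\<close> holds the coordinates, in the old vectors, of the
        projection of \<open>x m\<close> onto the span of the \<open>e a\<close>; the residual is
        \<open>x m\<close> minus that projection.\<close>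
      define D where "D j = (\<Sum>a<k. S a j * B (e a) (x m))" for j
      have "e' a i = (\<Sum>j<Suc m. x j i * (if j = m then c else - D j * c))" for i
      proof -
        have 1: "(\<Sum>a<k. e a i * B (e a) (x m)) = (\<Sum>j<m. x j i * D j)"
          unfolding D_def by (simp add: S sum_distrib_left sum_distrib_right mult.assoc) (rule sum.swap)
        have "a = k" using False that by simp
        then have "e' a i = x m i * c - (\<Sum>j<m. x j i * D j) * c"
          by (simp add: e'_k r_def 1 left_diff_distrib)
        also have "\<dots> = (\<Sum>j<Suc m. x j i * (if j = m then c else - D j * c))"
          by (simp add: sum_distrib_right sum_negf mult.assoc)
        finally show ?thesis .
      qed
      then show ?thesis
        by (intro exI[of _ "\<lambda>j. if j = m then c else - D j * c"] allI)
    qed (use e1 e'_e in auto)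
    moreover have "B (e' a) (e' b) = (if a = b then 1 else 0)" if "a < Suc k" "b < Suc k" for a b
    proof -
      have ek: "B (e' a) (e' k) = 0" if "a < k" for a
        using Br[OF that] by (simp add: e'_e e'_k that B_scale)
      have kk: "B (e' k) (e' k) = 1"
      proof -
        have "B (e' k) (e' k) = B (e' k) r * c" by (simp add: e'_k B_scale)
        also have "B (e' k) r = cnj (B r (e' k))" by (rule B_comm)
        also have "B r (e' k) = B r r * c" by (simp add: e'_k B_scale)
        finally show ?thesis using cc by (simp add: BN mult_ac)
      qed
      show ?thesis
        using that ek kk e(2) B_comm[of "e' k" "e' b"] by (auto simp: less_Suc_eq e'_e)
    qed
    moreover have "x j i = (\<Sum>a<Suc k. e' a i * B (e' a) (x j))" if "j < Suc m" "i < n" for i j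
    proof -
      have By: "B (e' k) g = c * B r g" for g
      proof -
        have "B (e' k) g = cnj (B g (e' k))" by (rule B_comm)
        also have "B g (e' k) = B g r * c" by (simp add: e'_k B_scale)
        also have "cnj (B g r * c) = c * B r g" using cc by (simp add: B_comm[of r g])
        finally show ?thesis .
      qed
      show ?thesis
      proof (cases "j < m")
        case True
        have "B r (x j) = 0"
        proof -
          have "B r (x j) = B r (\<lambda>i. \<Sum>a<k. e a i * B (e a) (x j))"
            by (rule B_cong) (rule e(3)[OF True])
          also have "\<dots> = (\<Sum>a<k. cnj (B (e a) r) * B (e a) (x j))"
            by (simp add: B_sum B_scale B_comm[of r])
          finally show ?thesis by (simp add: Br)
        qed
        then have "(\<Sum>a<Suc k. e' a i * B (e' a) (x j)) = (\<Sum>a<k. e a i * B (e a) (x j))"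
          by (simp add: By e'_e)
        then show ?thesis using e(3)[OF True that(2)] by simp
      next
        case False
        then have j: "j = m" using that by simp
        \<comment> \<open>The sign is moved into the sum so that \<open>B_diff\<close>,
          \<open>B_sum\<close> and \<open>B_scale\<close> apply as they stand.\<close>
        have "x m = (\<lambda>i. r i - (\<Sum>a<k. e a i * - B (e a) (x m)))"
          by (auto simp: r_def sum_negf)
        then have "B r (x m) = B r (\<lambda>i. r i - (\<Sum>a<k. e a i * - B (e a) (x m)))"
          by (rule arg_cong)
        also have "\<dots> = B r r - (\<Sum>a<k. B r (e a) * - B (e a) (x m))"
          by (simp only: B_diff B_sum B_scale)
        also have "\<dots> = complex_of_real N"
          by (simp add: B_comm[of r "e _"] Br BN)
        finally have "e' k i * B (e' k) (x m) = e' k i * (c * complex_of_real N)"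
          by (simp only: By)
        also have "\<dots> = r i * (c * (c * complex_of_real N))"
          by (simp add: e'_k)
        finally have "e' k i * B (e' k) (x m) = r i"
          by (simp only: cc mult_1_right)
        then have "(\<Sum>a<Suc k. e' a i * B (e' a) (x m)) = (\<Sum>a<k. e a i * B (e a) (x m)) + r i"
          by (simp add: e'_e)
        then show ?thesis by (simp add: j r_def)
      qed
    qed
    ultimately show ?thesis by blast
  qed
qed

text \<open>Gram-Schmidt on the columns of \<open>Z\<close>. The last equation says that the
  \<open>F\<close>-orthogonal projection onto the range of \<open>V\<close> fixes \<open>Z\<close>;
  together with \<open>V = mprod {..<m} Z S\<close> this makes the two ranges equal.\<close>

lemma gram_schmidt:
  fixes Z :: "nat \<Rightarrow> nat \<Rightarrow> complex"
  assumes F: "posdef n F" and Z: "supp {..<n} {..<m} Z"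
  obtains k :: nat and V S where "supp {..<n} {..<k} V" "supp {..<m} {..<k} S" "V = mprod {..<m} Z S"
    "mprod {..<n} (adj V) (mprod {..<n} F V) = one_on {..<k}"
    "mprod {..<k} V (mprod {..<n} (adj V) (mprod {..<n} F Z)) = Z"
proof -
  let ?B = "\<lambda>x y. \<Sum>i<n. \<Sum>j<n. cnj (x i) * F i j * y j"
  obtain k :: nat and e where e: "\<And>a. a < k \<Longrightarrow> \<exists>s. \<forall>i. e a i = (\<Sum>j<m. Z i j * s j)"
    "\<And>a b. a < k \<Longrightarrow> b < k \<Longrightarrow> ?B (e a) (e b) = (if a = b then 1 else 0)"
    "\<And>j i. j < m \<Longrightarrow> i < n \<Longrightarrow> Z i j = (\<Sum>a<k. e a i * ?B (e a) (\<lambda>i. Z i j))"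
    using gram_schmidt_vectors[OF F, where m = m and x = "\<lambda>j i. Z i j"] by blast
  then have "\<forall>a. \<exists>s. a < k \<longrightarrow> (\<forall>i. e a i = (\<Sum>j<m. Z i j * s j))" by blast
  from choice[OF this] obtain S where S: "\<And>a i. a < k \<Longrightarrow> e a i = (\<Sum>j<m. Z i j * S a j)"
    by blast
  define T where "T j a = (if j < m \<and> a < k then S a j else 0)" for j a
  define V where "V i a = (if a < k then e a i else 0)" for i a
  have VT: "V = mprod {..<m} Z T"
    by (intro ext) (simp add: V_def mprod_def T_def S)
  have sT: "supp {..<m} {..<k} T" by (auto simp: supp_def T_def)
  have sV: "supp {..<n} {..<k} V"
    unfolding VT using Z sT by (rule supp_mprod)
  have eq: "mprod {..<n} (adj V) (mprod {..<n} F Y) a j = ?B (e a) (\<lambda>i. Y i j)" if "a < k" for Y :: "nat \<Rightarrow> nat \<Rightarrow> complex" and a j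
    using that by (simp add: mprod_def adj_def V_def sum_distrib_left mult.assoc)
  have eq0: "mprod {..<n} (adj V) (mprod {..<n} F Y) a j = 0" if "\<not> a < k" for Y :: "nat \<Rightarrow> nat \<Rightarrow> complex" and a j
    using that by (simp add: mprod_def adj_def V_def)
  have "mprod {..<n} (adj V) (mprod {..<n} F V) a b = one_on {..<k} a b" for a b
  proof (cases "a < k \<and> b < k")
    case True
    then have "mprod {..<n} (adj V) (mprod {..<n} F V) a b = ?B (e a) (\<lambda>i. V i b)"
      by (simp add: eq)
    also have "(\<lambda>i. V i b) = e b" using True by (auto simp: V_def)
    finally show ?thesis using True e(2) by (simp add: one_on_def)
  next
    case False
    then show ?thesis
      by (cases "a < k") (simp_all add: eq0 one_on_def, simp add: mprod_def V_def)
  qed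
  then have 1: "mprod {..<n} (adj V) (mprod {..<n} F V) = one_on {..<k}" by (intro ext)
  have "mprod {..<k} V (mprod {..<n} (adj V) (mprod {..<n} F Z)) i j = Z i j" for i j
  proof (cases "i < n \<and> j < m")
    case True
    have "mprod {..<k} V (mprod {..<n} (adj V) (mprod {..<n} F Z)) i j = (\<Sum>a<k. e a i * ?B (e a) (\<lambda>i. Z i j))"
      unfolding mprod_def[of "{..<k}"] by (intro sum.cong refl) (auto simp: eq V_def)
    with True e(3) show ?thesis by simp
  next
    case False
    have "supp {..<n} {..<m} (mprod {..<k} V (mprod {..<n} (adj V) (mprod {..<n} F Z)))"
      using sV Z by (simp add: supp_iff)
    with False Z show ?thesis by (auto simp: supp_def)
  qed
  then have 2: "mprod {..<k} V (mprod {..<n} (adj V) (mprod {..<n} F Z)) = Z" by (intro ext)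
  show ?thesis by (rule that[OF sV sT VT 1 2])
qed

lemma posdef_one: "posdef n (one_on {..<n})"
proof -
  have "0 < Re (\<Sum>i<n. \<Sum>j<n. cnj (z i) * one_on {..<n} i j * z j)" if "\<exists>i<n. z i \<noteq> 0" for z
  proof -
    from that obtain i0 where i0: "i0 < n" "z i0 \<noteq> 0" by blast
    have "(\<Sum>i<n. \<Sum>j<n. cnj (z i) * one_on {..<n} i j * z j) = (\<Sum>i<n. \<Sum>j<n. if i = j then cnj (z i) * z i else 0)"
      by (intro sum.cong) (auto simp: one_on_def)
    also have "\<dots> = (\<Sum>i<n. cnj (z i) * z i)" by simp
    also have "\<dots> = complex_of_real (\<Sum>i<n. (cmod (z i))\<^sup>2)"
      by (simp only: of_real_sum complex_norm_square mult.commute)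
    finally have "Re (\<Sum>i<n. \<Sum>j<n. cnj (z i) * one_on {..<n} i j * z j) = (\<Sum>i<n. (cmod (z i))\<^sup>2)"
      by (simp only: Re_complex_of_real)
    also have "\<dots> > 0"
      using i0 by (intro sum_pos2[of _ i0]) auto
    finally show ?thesis .
  qed
  then show ?thesis by (simp add: posdef_def supp_iff)
qed

lemma gram_schmidt_standard:
  assumes Z: "supp {..<n} {..<m} (Z :: nat \<Rightarrow> nat \<Rightarrow> complex)"
  obtains k :: nat and V S where "supp {..<n} {..<k} V" "supp {..<m} {..<k} S" "V = mprod {..<m} Z S"
    "mprod {..<n} (adj V) V = one_on {..<k}" "mprod {..<k} V (mprod {..<n} (adj V) Z) = Z"
proof -
  obtain k :: nat and V S where V: "supp {..<n} {..<k} V" "supp {..<m} {..<k} S" "V = mprod {..<m} Z S"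
    "mprod {..<n} (adj V) (mprod {..<n} (one_on {..<n}) V) = one_on {..<k}"
    "mprod {..<k} V (mprod {..<n} (adj V) (mprod {..<n} (one_on {..<n}) Z)) = Z"
    by (rule gram_schmidt[OF posdef_one Z])
  then show ?thesis using Z by (intro that[of k V S]) (simp_all add: supp_iff)
qed

text \<open>\<open>p\<close> is \<open>V\<close> times its adjoint for an orthonormal basis
  \<open>V\<close> of the range of \<open>Z\<close>. Equality of ranges is expressed by the last two
  matrix equations, which combine directly with intertwining relations.\<close>

lemma range_projection:
  assumes Z: "supp {..<n} {..<n} (Z :: nat \<Rightarrow> nat \<Rightarrow> complex)"
  obtains p S where "supp {..<n} {..<n} p" "adj p = p" "mprod {..<n} p p = p"
    "p = mprod {..<n} Z S" "mprod {..<n} p Z = Z"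
proof -
  obtain k :: nat and V S where V: "supp {..<n} {..<k} V" "supp {..<n} {..<k} S" "V = mprod {..<n} Z S"
    "mprod {..<n} (adj V) V = one_on {..<k}" "mprod {..<k} V (mprod {..<n} (adj V) Z) = Z"
    by (rule gram_schmidt_standard[OF Z])
  define p where "p = mprod {..<k} V (adj V)"
  have "supp {..<n} {..<n} p" using V(1) by (simp add: p_def supp_iff)
  moreover have "adj p = p" by (simp add: p_def adj_mprod)
  moreover have "mprod {..<n} p p = p"
  proof -
    have "mprod {..<n} p p = mprod {..<k} V (mprod {..<k} (mprod {..<n} (adj V) V) (adj V))"
      by (simp only: p_def mprod_assoc)
    then show ?thesis using V(1) by (simp add: V(4) p_def supp_iff)
  qed
  moreover have "p = mprod {..<n} Z (mprod {..<k} S (adj V))"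
  proof -
    have "p = mprod {..<k} (mprod {..<n} Z S) (adj V)" unfolding p_def by (simp flip: V(3))
    then show ?thesis by (simp add: mprod_assoc)
  qed
  moreover have "mprod {..<n} p Z = Z" using V(5) by (simp add: p_def mprod_assoc)
  ultimately show ?thesis by (rule that)
qed

lemma trace_mprod_adj:
  fixes A :: "'i \<Rightarrow> 'j \<Rightarrow> complex"
  shows "(\<Sum>i\<in>I. mprod J A (adj A) i i) = complex_of_real (\<Sum>i\<in>I. \<Sum>j\<in>J. (cmod (A i j))\<^sup>2)"
  by (simp only: mprod_def adj_def star_complex_eq of_real_sum complex_norm_square)

text \<open>Gram-Schmidt on the columns of \<open>p\<close> gives the isometry \<open>V\<close>. Its
  width is the trace of \<open>p\<close>, less than \<open>n\<close> because the complementary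
  projection is nonzero; the strict inequality drives the induction on dimension.\<close>

lemma projection_factor:
  assumes p: "supp {..<n} {..<n} (p :: nat \<Rightarrow> nat \<Rightarrow> complex)" "adj p = p" "mprod {..<n} p p = p"
    and "p \<noteq> one_on {..<n}"
  obtains k :: nat and V where "k < n" "supp {..<n} {..<k} V" "mprod {..<n} (adj V) V = one_on {..<k}"
    "mprod {..<k} V (adj V) = p"
proof -
  obtain k :: nat and V S where V: "supp {..<n} {..<k} V" "supp {..<n} {..<k} S" "V = mprod {..<n} p S"
    "mprod {..<n} (adj V) V = one_on {..<k}" "mprod {..<k} V (mprod {..<n} (adj V) p) = p"
    by (rule gram_schmidt_standard[OF p(1)])
  have "mprod {..<n} p V = mprod {..<n} (mprod {..<n} p p) S"
    by (simp only: mprod_assoc flip: V(3))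
  then have pV: "mprod {..<n} p V = V" by (simp add: p(3) flip: V(3))
  \<comment> \<open>Taking adjoints of the reconstruction of \<open>p\<close> leaves the left factor
    \<open>mprod {..<n} p V\<close>, which is \<open>V\<close>.\<close>
  have "p = adj (mprod {..<k} V (mprod {..<n} (adj V) p))" by (simp add: V(5) p(2))
  also have "\<dots> = mprod {..<k} (mprod {..<n} p V) (adj V)"
    by (simp add: adj_mprod p(2) mprod_assoc)
  finally have pVV: "mprod {..<k} V (adj V) = p" by (simp add: pV)
  define q where "q = one_on {..<n} - p"
  have qq: "mprod {..<n} q (adj q) = q"
    using p by (simp add: q_def adj_diff mprod_diff_left mprod_diff_right supp_iff)
  obtain i0 j0 where ij: "q i0 j0 \<noteq> 0"
  proof (rule ccontr)
    assume "\<not> thesis"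
    then have "q i j = 0" for i j using that by blast
    then have "p = one_on {..<n}" by (intro ext) (simp add: q_def)
    with assms(4) show False by simp
  qed
  have sq: "supp {..<n} {..<n} q" using p(1) by (simp add: q_def supp_iff)
  then have ij': "i0 < n" "j0 < n" using ij by (auto simp: supp_def)
  \<comment> \<open>The trace of the projection \<open>q\<close> is its squared Hilbert-Schmidt
    norm, and it is also \<open>n - k\<close>.\<close>
  have "(\<Sum>i<n. q i i) = complex_of_real (\<Sum>i<n. \<Sum>j<n. (cmod (q i j))\<^sup>2)"
    using trace_mprod_adj[of "{..<n}" q "{..<n}"] by (simp add: qq)
  moreover have "(\<Sum>i<n. q i i) = of_nat n - (\<Sum>i<n. p i i)"
    by (simp add: q_def sum_subtractf one_on_def)
  moreover have "(\<Sum>i<n. p i i) = (\<Sum>a<k. mprod {..<n} (adj V) V a a)"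
    unfolding pVV[symmetric] mprod_def adj_def by (subst sum.swap) (simp add: mult.commute)
  moreover have "\<dots> = of_nat k"
    by (simp add: V(4) one_on_def)
  ultimately have "complex_of_real (real n - real k) = complex_of_real (\<Sum>i<n. \<Sum>j<n. (cmod (q i j))\<^sup>2)"
    by simp
  then have "real n - real k = (\<Sum>i<n. \<Sum>j<n. (cmod (q i j))\<^sup>2)"
    by (simp only: of_real_eq_iff)
  moreover have "(\<Sum>i<n. \<Sum>j<n. (cmod (q i j))\<^sup>2) > 0"
    using ij ij' by (intro sum_pos2[of _ i0] sum_pos2[of _ j0] sum_nonneg) auto
  ultimately have "k < n" by simp
  then show ?thesis using V(1,4) pVV by (rule that)
qed

section \<open>Irreducible representations\<close>

lemma sum_complex_nonneg_eq_0:
  assumes "(\<Sum>k\<in>I. z k) = (0::complex)" "finite I"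
    and "\<And>k. k \<in> I \<Longrightarrow> z k \<in> \<real> \<and> 0 \<le> Re (z k)" "k \<in> I"
  shows "z k = 0"
proof -
  have "(\<Sum>k\<in>I. Re (z k)) = 0" using assms(1) by (metis Re_sum zero_complex.sel(1))
  then have "Re (z k) = 0" using assms(2-4) by (simp add: sum_nonneg_eq_0_iff)
  with assms(3,4) show ?thesis by (auto simp: complex_is_Real_iff complex_eq_iff)
qed

text \<open>Zero padding makes \<open>supp\<close> automatic, so that matrix identities translate
  into equalities of functions.\<close>

definition entries :: "nat \<Rightarrow> 'x::zero mat \<Rightarrow> nat \<Rightarrow> nat \<Rightarrow> 'x"
  where "entries n A = (\<lambda>i j. if i < n \<and> j < n then A $$ (i, j) else 0)"

lemma entries_inject: "A \<in> carrier_mat n n \<Longrightarrow> B \<in> carrier_mat n n \<Longrightarrow> entries n A = entries n B \<longleftrightarrow> A = B"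
  by (auto simp: entries_def fun_eq_iff intro!: eq_matI)

lemma supp_entries [simp]: "supp {..<n} {..<n} (entries n A)"
  by (auto simp: supp_def entries_def)

lemma entries_mat [simp]: "supp {..<n} {..<n} X \<Longrightarrow> entries n (mat n n (\<lambda>(i, j). X i j)) = X"
  by (intro ext) (auto simp: entries_def supp_def)

lemma entries_times:
  "A \<in> carrier_mat n n \<Longrightarrow> B \<in> carrier_mat n n \<Longrightarrow> entries n (A * B) = mprod {..<n} (entries n A) (entries n B)"
  by (intro ext) (auto simp: entries_def mprod_def scalar_prod_def atLeast0LessThan intro!: sum.cong)

lemma entries_star_mat: "A \<in> carrier_mat n n \<Longrightarrow> entries n (star_mat A) = adj (entries n A)"
  by (intro ext) (auto simp: entries_def adj_def star_mat_def)

lemma entries_scalar_mat: "A \<in> carrier_mat n n \<Longrightarrow> entries n (scalar_mat A) = scm (entries n A)"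
  by (intro ext) (auto simp: entries_def scm_def scalar_mat_def)

lemma entries_one: "entries n (1\<^sub>m n) = one_on {..<n}"
  and entries_zero: "entries n (0\<^sub>m n n) = 0"
  by (intro ext, auto simp: entries_def one_on_def)+

lemma star_mat_carrier [simp]: "A \<in> carrier_mat n m \<Longrightarrow> star_mat A \<in> carrier_mat m n"
  and scalar_mat_carrier [simp]: "B \<in> carrier_mat n m \<Longrightarrow> scalar_mat B \<in> carrier_mat n m"
  by (auto simp: star_mat_def scalar_mat_def)

context haar_cqg
begin

definition irr :: "'i set \<Rightarrow> ('i \<Rightarrow> 'i \<Rightarrow> 'a) \<Rightarrow> bool"
  where "irr I u \<longleftrightarrow> (\<forall>p. supp I I p \<and> mprod I p p = p \<and> adj p = p \<and>
    mprod I (scm p) (mprod I u (scm p)) = mprod I u (scm p) \<longrightarrow> p = 0 \<or> p = one_on I)"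

text \<open>
  The averaged operator \<open>(id \<otimes> h)(u\<^sup>* (1 - p) u)\<close> lies in the commutant of \<open>u\<close>, so it is scalar, and
  it kills the range of \<open>p\<close>. Hence it vanishes unless \<open>p = 0\<close>, and then \<open>null_left\<close> gives \<open>p = 1\<close>.
\<close>

lemma schur_imp_irr:
  assumes u: "urep I u" "schur I u"
  shows "irr I u"
  unfolding irr_def
proof (intro allI impI, elim conjE)
  fix p :: "'c \<Rightarrow> 'c \<Rightarrow> complex"
  assume p: "supp I I p" "mprod I p p = p" "adj p = p"
    and inv: "mprod I (scm p) (mprod I u (scm p)) = mprod I u (scm p)"
  note fin = urepD(1)[OF u(1)]
  have ru: "row_supp I u" "col_supp I u" and rp: "row_supp I p" "col_supp I p"
    using urepD(2)[OF u(1)] p(1) by (simp_all add: supp_iff)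
  define q where "q = one_on I - p"
  have q: "row_supp I q" "col_supp I q" "adj q = q" "mprod I q q = q"
    using rp fin p(2,3) by (simp_all add: q_def adj_diff mprod_diff_left mprod_diff_right)
  define x where "x = mprod I (scm q) u"
  have x: "x k j = (\<Sum>l\<in>I. q k l *\<^sub>C u l j)" for k j
    by (simp add: x_def scm_mprod_apply)
  have "mprod I x (scm p) = 0"
    using ru fin inv by (simp add: x_def q_def scm_diff mprod_diff_left mprod_assoc)
  have "\<exists>c. \<forall>i j. hmat u u k l i j = c * one_on I i j" for k l
    by (rule schur_hmat[OF u, of k l]) blast
  then obtain c where c: "\<And>k l i j. hmat u u k l i j = c k l * one_on I i j"
    by metis
  \<comment> \<open>\<open>d\<close> is the scalar to which averaging \<open>q\<close> over
    \<open>u\<close> reduces.\<close>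
  define d where "d = (\<Sum>k\<in>I. \<Sum>l\<in>I. q k l * c k l)"
  have "mprod I (adj x) x = mprod I (adj u) (mprod I (scm q) u)"
    using q by (simp add: x_def adj_mprod mprod_assoc scm_adj[symmetric])
      (simp add: scm_mprod[symmetric] mprod_assoc[symmetric])
  then have E: "h (mprod I (adj x) x i j) = d * one_on I i j" for i j
    using c by (simp add: mprod_def adj_def scm_def sum_distrib_left scaleC_mult_left scaleC_mult_right
       h_sum h_scaleC d_def sum_distrib_right mult.assoc hmat_def)
  show "p = 0 \<or> p = one_on I"
  proof (cases "d = 0")
    case False
    have "mprod I (mprod I (adj x) x) (scm p) = 0"
      using \<open>mprod I x (scm p) = 0\<close> by (simp add: mprod_assoc)
    then have "h (mprod I (mprod I (adj x) x) (scm p) i j) = 0" for i j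
      by (simp add: h_0)
    moreover have "h (mprod I (mprod I (adj x) x) (scm p) i j) = d * mprod I (one_on I) p i j" for i j
      by (simp only: mprod_scm_apply h_sum h_scaleC E) (simp add: mprod_def sum_distrib_left mult_ac)
    ultimately have "d * mprod I (one_on I) p i j = 0" for i j by metis
    then have "p i j = 0" for i j using False fin rp by simp
    then show ?thesis by (intro disjI1 ext) simp
  next
    case True
    have hx: "h (star (x k j) * x k j) = 0" if "k \<in> I" for k j
      by (rule sum_complex_nonneg_eq_0[OF _ fin _ that, where z = "\<lambda>k. h (star (x k j) * x k j)"])
        (use E[of j j] True h_nonneg in \<open>auto simp: mprod_def adj_def h_sum\<close>)
    \<comment> \<open>Row \<open>k\<close> of \<open>q\<close> is a coefficient vector whose
      combinations \<open>x k j\<close> of the \<open>u l j\<close> are all null.\<close>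
    have "q k i = 0" if "k \<in> I" "i \<in> I" for k i
      by (rule null_left[OF u(1) _ that(2)]) (use h_null[OF hx[OF that(1)]] in \<open>simp add: x\<close>)
    moreover have "q k i = 0" if "k \<notin> I \<or> i \<notin> I" for k i
      using q(1,2) that by (auto simp: row_supp_def col_supp_def)
    ultimately have "q k i = 0" for k i by blast
    then have "p = one_on I" by (intro ext) (simp add: q_def fun_eq_iff)
    then show ?thesis ..
  qed
qed

text \<open>\<open>A\<close> slides past \<open>Z\<close>, so \<open>A\<close> times
  \<open>p\<close> has \<open>Z\<close> as its left factor, and \<open>p\<close> fixes everything of
  that form.\<close>

lemma range_invariant:
  fixes A :: "'i \<Rightarrow> 'i \<Rightarrow> 'a"
  assumes "mprod I (scm Z) A = mprod I A (scm Z)" "p = mprod I Z S" "mprod I p Z = Z"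
  shows "mprod I (scm p) (mprod I A (scm p)) = mprod I A (scm p)"
proof -
  have "mprod I A (scm p) = mprod I (mprod I A (scm Z)) (scm S)"
    unfolding assms(2) scm_mprod mprod_assoc ..
  also have "\<dots> = mprod I (scm Z) (mprod I A (scm S))"
    unfolding assms(1)[symmetric] mprod_assoc ..
  finally have eq: "mprod I A (scm p) = mprod I (scm Z) (mprod I A (scm S))" .
  have "mprod I (scm p) (mprod I (scm Z) (mprod I A (scm S))) =
      mprod I (scm (mprod I p Z)) (mprod I A (scm S))"
    unfolding scm_mprod mprod_assoc ..
  then show ?thesis unfolding eq assms(3) .
qed

text \<open>The classical Schur argument: subtracting an eigenvalue from a commuting
  \<open>X\<close> leaves a singular \<open>Z\<close> with invariant range. That range is proper,
  hence zero, and \<open>X\<close> is scalar.\<close>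

lemma irr_imp_schur:
  fixes w :: "nat \<Rightarrow> nat \<Rightarrow> 'a"
  assumes w: "urep {..<n} w" "irr {..<n} w" and "0 < n"
  shows "schur {..<n} w"
  unfolding schur_def
proof (intro allI impI, elim conjE)
  let ?I = "{..<n}"
  fix X :: "nat \<Rightarrow> nat \<Rightarrow> complex"
  assume X: "supp ?I ?I X" "mprod ?I (scm X) w = mprod ?I w (scm X)"
  obtain l where l: "\<And>S. mprod ?I (X - (\<lambda>i j. l * one_on ?I i j)) S \<noteq> one_on ?I"
    using singular_shift[OF \<open>0 < n\<close> X(1)] by blast
  define Z where "Z = X - (\<lambda>i j. l * one_on ?I i j)"
  have rw: "row_supp ?I w" "col_supp ?I w" using urepD(2)[OF w(1)] by (simp_all add: supp_iff)
  have sZ: "supp ?I ?I Z"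
    using X(1) by (simp add: Z_def supp_def one_on_def)
  have Zw: "mprod ?I (scm Z) w = mprod ?I w (scm Z)"
    using rw by (simp add: Z_def scm_diff scm_scale mprod_diff_left mprod_diff_right X(2)
       mprod_scale_left mprod_scale_right)
  obtain p S where p: "supp ?I ?I p" "adj p = p" "mprod ?I p p = p" "p = mprod ?I Z S" "mprod ?I p Z = Z"
    by (rule range_projection[OF sZ])
  have "p = 0 \<or> p = one_on ?I"
    using w(2) p(1-3) range_invariant[OF Zw p(4,5)] unfolding irr_def by blast
  moreover have "p \<noteq> one_on ?I" using l[of S] by (simp add: p(4) flip: Z_def)
  ultimately have "p = 0" by simp
  then have "Z = 0" using p(5) by simp
  then have "X = (\<lambda>i j. l * one_on ?I i j)" by (simp add: Z_def fun_eq_iff)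
  then show "\<exists>c. X = (\<lambda>i j. c * one_on ?I i j)" by blast
qed

lemma unitary_rep_iff_urep:
  assumes "u \<in> carrier_mat n n"
  shows "unitary_rep t \<Delta> n u \<longleftrightarrow> urep {..<n} (entries n u)"
proof -
  have "u * star_mat u = 1\<^sub>m n \<longleftrightarrow> entries n (u * star_mat u) = entries n (1\<^sub>m n)"
    "star_mat u * u = 1\<^sub>m n \<longleftrightarrow> entries n (star_mat u * u) = entries n (1\<^sub>m n)"
    using assms by (simp_all add: entries_inject mult_carrier_mat[of _ n n _ n])
  moreover have "(\<forall>i<n. \<forall>j<n. \<Delta> (u $$ (i, j)) = (\<Sum>k<n. t (u $$ (i, k)) (u $$ (k, j)))) \<longleftrightarrow>
      (\<forall>i\<in>{..<n}. \<forall>j\<in>{..<n}. \<Delta> (entries n u i j) = (\<Sum>k<n. t (entries n u i k) (entries n u k j)))"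
    by (simp add: entries_def Ball_def)
  ultimately show ?thesis
    using assms by (simp add: unitary_rep_def urep_def entries_times entries_star_mat entries_one)
qed

lemma irreducible_rep_iff_irr:
  assumes "u \<in> carrier_mat n n"
  shows "irreducible_rep t \<Delta> n u \<longleftrightarrow> urep {..<n} (entries n u) \<and> 0 < n \<and> irr {..<n} (entries n u)"
proof -
  have eq: "(p * p = p \<and> star_mat p = p \<and> scalar_mat p * u * scalar_mat p = u * scalar_mat p \<longrightarrow>
        p = 0\<^sub>m n n \<or> p = 1\<^sub>m n) \<longleftrightarrow>
      (mprod {..<n} (entries n p) (entries n p) = entries n p \<and> adj (entries n p) = entries n p \<and>
      mprod {..<n} (scm (entries n p)) (mprod {..<n} (entries n u) (scm (entries n p))) =
        mprod {..<n} (entries n u) (scm (entries n p)) \<longrightarrow>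
      entries n p = 0 \<or> entries n p = one_on {..<n})"
    if p: "p \<in> carrier_mat n n" for p :: "complex mat"
  proof -
    have "p * p = p \<longleftrightarrow> entries n (p * p) = entries n p" "star_mat p = p \<longleftrightarrow> entries n (star_mat p) = entries n p"
      "scalar_mat p * u * scalar_mat p = u * scalar_mat p \<longleftrightarrow>
        entries n (scalar_mat p * u * scalar_mat p) = entries n (u * scalar_mat p)"
      "p = 0\<^sub>m n n \<longleftrightarrow> entries n p = entries n (0\<^sub>m n n)"
      "p = 1\<^sub>m n \<longleftrightarrow> entries n p = entries n (1\<^sub>m n)"
      using assms p by (simp_all add: entries_inject mult_carrier_mat[of _ n n _ n])
    then show ?thesis
      using assms p
      by (simp add: entries_times[of _ n] entries_star_mat[of _ n] entries_scalar_mat[of _ n] entries_one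
          entries_zero mprod_assoc mult_carrier_mat[of _ n n _ n])
  qed
  have "(\<forall>p\<in>carrier_mat n n. p * p = p \<and> star_mat p = p \<and>
       scalar_mat p * u * scalar_mat p = u * scalar_mat p \<longrightarrow> p = 0\<^sub>m n n \<or> p = 1\<^sub>m n) \<longleftrightarrow> irr {..<n} (entries n u)"
    (is "(\<forall>p\<in>_. ?P p) \<longleftrightarrow> _")
  proof
    assume *: "\<forall>p\<in>carrier_mat n n. ?P p"
    show "irr {..<n} (entries n u)"
      unfolding irr_def
    proof (intro allI impI, elim conjE)
      fix p :: "nat \<Rightarrow> nat \<Rightarrow> complex"
      assume p: "supp {..<n} {..<n} p" "mprod {..<n} p p = p" "adj p = p"
        "mprod {..<n} (scm p) (mprod {..<n} (entries n u) (scm p)) = mprod {..<n} (entries n u) (scm p)"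
      have "mat n n (\<lambda>(i, j). p i j) \<in> carrier_mat n n" by simp
      from eq[OF this] *[rule_format, OF this] p show "p = 0 \<or> p = one_on {..<n}"
        by simp
    qed
  next
    assume "irr {..<n} (entries n u)"
    then show "\<forall>p\<in>carrier_mat n n. ?P p"
      using eq unfolding irr_def by (metis (no_types, lifting) supp_entries)
  qed
  then show ?thesis
    using assms by (simp add: irreducible_rep_def unitary_rep_iff_urep)
qed

lemma irreducible_repD:
  assumes "irreducible_rep t \<Delta> n u"
  shows "u \<in> carrier_mat n n" "0 < n" "urep {..<n} (entries n u)" "schur {..<n} (entries n u)"
proof -
  show u: "u \<in> carrier_mat n n"
    using assms by (simp add: irreducible_rep_def unitary_rep_def)
  show "0 < n" "urep {..<n} (entries n u)" "schur {..<n} (entries n u)"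
    using assms irr_imp_schur by (auto simp: irreducible_rep_iff_irr[OF u])
qed

lemma schur_irreducible_rep:
  assumes "urep {..<n} w" "schur {..<n} w" "0 < n"
  shows "irreducible_rep t \<Delta> n (mat n n (\<lambda>(i, j). w i j))"
  using assms urepD(2)[OF assms(1)] schur_imp_irr[OF assms(1,2)] by (subst irreducible_rep_iff_irr) simp_all

end

section \<open>The CQG algebra\<close>

text \<open>A basis of \<open>D\<close> together with \<open>x\<close> is extended to a Hamel basis.
  The functional may be discontinuous, as it must be when \<open>D\<close> is dense.\<close>

lemma exists_functional:
  fixes D :: "'a::complex_normed_vector set"
  assumes "complex_vector.subspace D" "x \<notin> D"
  obtains f :: "'a \<Rightarrow> complex" where "clinear f" "\<And>y. y \<in> D \<Longrightarrow> f y = 0" "f x = 1"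
proof -
  interpret vp: vector_space_pair "scaleC :: complex \<Rightarrow> 'a \<Rightarrow> 'a" "scaleC :: complex \<Rightarrow> complex \<Rightarrow> complex" ..
  obtain B where B: "B \<subseteq> D" "cindependent B" "D \<subseteq> cspan B"
    using complex_vector.maximal_independent_subset[of D] by metis
  have DB: "D = cspan B"
    using B assms(1) by (metis complex_vector.span_minimal subset_antisym)
  have "cindependent (insert x B)"
    using B(2) assms(2) by (simp add: complex_vector.independent_insert DB)
  from vp.linear_independent_extend[OF this, of "\<lambda>y. if y = x then 1 else 0"]
  obtain g :: "'a \<Rightarrow> complex" where g: "clinear g" "\<And>y. y \<in> insert x B \<Longrightarrow> g y = (if y = x then 1 else 0)"
    unfolding clinear_def by blast
  have "x \<notin> B" using assms(2) B(1) by blast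
  have "g y = 0" if "y \<in> D" for y
    using that unfolding DB
  proof (induction rule: complex_vector.span_induct)
    case base
    then show ?case using g(1) by (auto simp: complex_vector.subspace_def clinear_iff clinear_0)
  next
    case (step y)
    then show ?case using g(2)[of y] \<open>x \<notin> B\<close> by auto
  qed
  moreover have "g x = 1" using g(2)[of x] by simp
  ultimately show ?thesis using that g(1) by blast
qed

section \<open>Operations on representations\<close>

context haar_bialgebra
begin

text \<open>The matrix product with the tensor product in place of multiplication; a representation
  satisfies \<open>\<Delta> (u i j) = tprod I u u i j\<close>.\<close>

definition tprod :: "'k set \<Rightarrow> ('i \<Rightarrow> 'k \<Rightarrow> 'a) \<Rightarrow> ('k \<Rightarrow> 'j \<Rightarrow> 'a) \<Rightarrow> 'i \<Rightarrow> 'j \<Rightarrow> 'b"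
  where "tprod K A B = (\<lambda>i j. \<Sum>k\<in>K. t (A i k) (B k j))"

lemma tprod_scm: "tprod K (mprod J A (scm X)) B = tprod J A (mprod K (scm X) B)"
  unfolding tprod_def
  by (intro ext)
    (simp add: scm_mprod_apply mprod_scm_apply t_sum_left t_sum_right t_scaleC_left t_scaleC_right, rule sum.swap)

text \<open>In \<open>tprod K v v\<close> the scalar matrix \<open>Y\<close> of the first leg moves
  across the tensor sign and meets \<open>X\<close>. Asking \<open>Y\<close> times \<open>X\<close>
  to act as the identity only on \<open>mprod I u (scm Y)\<close> covers both invertible changes of
  basis and compressions to subspaces.\<close>

lemma comult_conjugate:
  assumes rep: "\<And>i j. \<Delta> (u i j) = tprod I u u i j"
    and XY: "mprod I (scm (mprod K Y X)) (mprod I u (scm Y)) = mprod I u (scm Y)"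
  defines "v \<equiv> mprod I (scm X) (mprod I u (scm Y))"
  shows "\<Delta> (v a b) = tprod K v v a b"
proof -
  have "tprod K v v = tprod K (mprod I (mprod I (scm X) u) (scm Y)) v"
    by (simp add: v_def mprod_assoc)
  also have "\<dots> = tprod I (mprod I (scm X) u) (mprod I u (scm Y))"
    using XY by (simp add: tprod_scm) (simp add: v_def scm_mprod mprod_assoc)
  finally have "tprod K v v a b = (\<Sum>k\<in>I. \<Sum>j\<in>I. \<Sum>i\<in>I. (Y j b * X a i) *\<^sub>C t (u i k) (u k j))"
    by (simp add: tprod_def scm_mprod_apply mprod_scm_apply t_sum_left t_sum_right t_scaleC_left t_scaleC_right
        scaleC_scaleC scaleC_sum_right)
  also have "\<dots> = (\<Sum>j\<in>I. \<Sum>i\<in>I. (Y j b * X a i) *\<^sub>C tprod I u u i j)"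
    by (subst sum_rotate) (simp add: tprod_def scaleC_sum_right)
  also have "\<dots> = (\<Sum>i\<in>I. \<Sum>j\<in>I. (X a i * Y j b) *\<^sub>C tprod I u u i j)"
    by (subst sum.swap) (simp add: mult.commute)
  also have "\<dots> = \<Delta> (v a b)"
    by (simp add: v_def scm_mprod_apply mprod_scm_apply \<Delta>_sum clinear_scaleC[OF \<Delta>_clinear] rep
        scaleC_scaleC scaleC_sum_right)
  finally show ?thesis ..
qed

text \<open>Compression by the isometry \<open>V\<close> is multiplicative as soon as the left
  factor commutes with the projection onto the range of \<open>V\<close>; both \<open>u\<close> and
  \<open>adj u\<close> do.\<close>

lemma urep_compress:
  assumes u: "urep I u" and V: "supp I K V" "mprod I (adj V) V = one_on K" and "finite K"
    and comm: "mprod I (scm (mprod K V (adj V))) u = mprod I u (scm (mprod K V (adj V)))"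
  shows "urep K (mprod I (scm (adj V)) (mprod I u (scm V)))" (is "urep K ?v")
proof -
  note fin = urepD(1)[OF u]
  have ru: "row_supp I u" "col_supp I u" and rV: "row_supp I V" "col_supp K V"
    using urepD(2)[OF u] V(1) by (simp_all add: supp_iff)
  let ?p = "mprod K V (adj V)"
  have pV: "mprod I ?p V = V" using rV \<open>finite K\<close> by (simp add: mprod_assoc V(2))
  have Vp: "mprod I (adj V) ?p = adj V"
    using rV \<open>finite K\<close> by (simp add: V(2) flip: mprod_assoc)
  have adj: "adj ?v = mprod I (scm (adj V)) (mprod I (adj u) (scm V))"
    by (simp add: adj_mprod mprod_assoc scm_adj[symmetric])
  have comm': "mprod I (scm ?p) (adj u) = mprod I (adj u) (scm ?p)"
    using arg_cong[OF comm, of adj] by (simp add: adj_mprod scm_adj[symmetric])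
  have *: "mprod K (mprod I (scm (adj V)) (mprod I A (scm V))) (mprod I (scm (adj V)) (mprod I B (scm V))) =
      mprod I (scm (adj V)) (mprod I (mprod I A B) (scm V))"
    if "mprod I (scm ?p) A = mprod I A (scm ?p)" for A B
  proof -
    have "mprod K (mprod I (scm (adj V)) (mprod I A (scm V))) (mprod I (scm (adj V)) (mprod I B (scm V))) =
      mprod I (scm (adj V)) (mprod I (mprod I A (scm ?p)) (mprod I B (scm V)))"
      by (simp only: mprod_assoc scm_mprod)
    also have "\<dots> = mprod I (mprod I (scm (adj V)) (scm ?p)) (mprod I A (mprod I B (scm V)))"
      unfolding that[symmetric] by (simp only: mprod_assoc)
    also have "\<dots> = mprod I (scm (adj V)) (mprod I (mprod I A B) (scm V))"
      unfolding scm_mprod[symmetric] Vp by (simp only: mprod_assoc)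
    finally show ?thesis .
  qed
  have one: "mprod I (scm (adj V)) (mprod I (one_on I) (scm V)) = one_on K"
    using rV fin by (simp add: V(2) flip: scm_mprod)
  have "mprod K ?v (adj ?v) = one_on K" "mprod K (adj ?v) ?v = one_on K"
    unfolding adj *[OF comm] *[OF comm'] urepD(3,4)[OF u] by (rule one)+
  moreover have "supp K K ?v" using rV by (simp add: supp_iff)
  moreover have "\<Delta> (?v a b) = tprod K ?v ?v a b" for a b
  proof (rule comult_conjugate)
    show "\<Delta> (u i j) = tprod I u u i j" for i j by (simp add: tprod_def urepD(5)[OF u])
    have "mprod I (scm ?p) (mprod I u (scm V)) = mprod I u (mprod I (scm ?p) (scm V))"
      by (simp add: comm flip: mprod_assoc)
    then show "mprod I (scm ?p) (mprod I u (scm V)) = mprod I u (scm V)"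
      by (simp add: pV flip: scm_mprod)
  qed
  ultimately show ?thesis
    using \<open>finite K\<close> by (simp add: urep_def tprod_def)
qed

lemma urep_reindex:
  assumes u: "urep I u" and f: "bij_betw f K I"
  shows "urep K (\<lambda>i j. if i \<in> K \<and> j \<in> K then u (f i) (f j) else 0)" (is "urep K ?v")
proof -
  have sum_f: "(\<Sum>k\<in>K. g (f k)) = (\<Sum>k\<in>I. g k)" for g :: "_ \<Rightarrow> 'z::comm_monoid_add"
    by (rule sum.reindex_bij_betw[OF f])
  have inj: "f i = f j \<longleftrightarrow> i = j" if "i \<in> K" "j \<in> K" for i j
    using f that by (auto simp: bij_betw_def inj_on_def)
  have fK: "f i \<in> I" if "i \<in> K" for i using f that by (auto simp: bij_betw_def)
  have "mprod K ?v (adj ?v) i j = one_on K i j" for i j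
  proof (cases "i \<in> K \<and> j \<in> K")
    case True
    then have "mprod K ?v (adj ?v) i j = (\<Sum>k\<in>K. u (f i) (f k) * star (u (f j) (f k)))"
      by (auto simp: mprod_def adj_def intro!: sum.cong)
    also have "\<dots> = one_on I (f i) (f j)"
      by (simp add: sum_f[of "\<lambda>k. u (f i) k * star (u (f j) k)"] urep_sum_right[OF u])
    finally show ?thesis using True by (simp add: one_on_def inj fK)
  qed (auto simp: mprod_def adj_def one_on_def)
  moreover have "mprod K (adj ?v) ?v i j = one_on K i j" for i j
  proof (cases "i \<in> K \<and> j \<in> K")
    case True
    then have "mprod K (adj ?v) ?v i j = (\<Sum>k\<in>K. star (u (f k) (f i)) * u (f k) (f j))"
      by (auto simp: mprod_def adj_def intro!: sum.cong)
    also have "\<dots> = one_on I (f i) (f j)"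
      by (simp add: sum_f[of "\<lambda>k. star (u k (f i)) * u k (f j)"] urep_sum_left[OF u])
    finally show ?thesis using True by (simp add: one_on_def inj fK)
  qed (auto simp: mprod_def adj_def one_on_def)
  moreover have "\<Delta> (?v i j) = (\<Sum>k\<in>K. t (?v i k) (?v k j))" if "i \<in> K" "j \<in> K" for i j
    using that by (simp add: urepD(5)[OF u] sum_f[of "\<lambda>k. t (u (f i) k) (u k (f j))"])
  moreover have "finite K" using urepD(1)[OF u] f by (simp add: bij_betw_finite)
  ultimately show ?thesis
    by (simp add: urep_def supp_def fun_eq_iff)
qed

text \<open>The two factors collapse one after the other by unitarity. As entries need not commute,
  the inner factor goes first: that of \<open>v\<close> for rows, that of \<open>u\<close> for
  columns.\<close>

lemma urep_tensor:
  assumes u: "urep I u" and v: "urep J v"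
  shows "urep (I \<times> J) (\<lambda>(i, k) (j, l). u i j * v k l)" (is "urep _ ?w")
proof -
  note fin = urepD(1)[OF u] urepD(1)[OF v]
  have "mprod (I \<times> J) ?w (adj ?w) x y = one_on (I \<times> J) x y" for x y
  proof -
    obtain i k i' k' where xy: "x = (i, k)" "y = (i', k')" by (cases x, cases y)
    have "mprod (I \<times> J) ?w (adj ?w) x y = (\<Sum>j\<in>I. u i j * (\<Sum>l\<in>J. v k l * star (v k' l)) * star (u i' j))"
      by (simp add: xy mprod_def adj_def sum.cartesian_product case_prod_beta star_mult
          sum_distrib_left sum_distrib_right mult.assoc)
    also have "\<dots> = (\<Sum>j\<in>I. u i j * star (u i' j)) * one_on J k k'"
      by (simp add: urep_sum_right[OF v] one_on_def)
    finally show ?thesis by (auto simp: urep_sum_right[OF u] one_on_def xy)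
  qed
  moreover have "mprod (I \<times> J) (adj ?w) ?w x y = one_on (I \<times> J) x y" for x y
  proof -
    obtain i k i' k' where xy: "x = (i, k)" "y = (i', k')" by (cases x, cases y)
    have "mprod (I \<times> J) (adj ?w) ?w x y = (\<Sum>j\<in>I. \<Sum>l\<in>J. star (v l k) * (star (u j i) * u j i') * v l k')"
      by (simp add: xy mprod_def adj_def sum.cartesian_product case_prod_beta star_mult mult.assoc)
    also have "\<dots> = (\<Sum>l\<in>J. star (v l k) * (\<Sum>j\<in>I. star (u j i) * u j i') * v l k')"
      by (subst sum.swap) (simp add: sum_distrib_left sum_distrib_right)
    also have "\<dots> = (\<Sum>l\<in>J. star (v l k) * v l k') * one_on I i i'"
      by (simp add: urep_sum_left[OF u] one_on_def)
    finally show ?thesis by (auto simp: urep_sum_left[OF v] one_on_def xy)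
  qed
  moreover have "\<Delta> (?w x y) = (\<Sum>z\<in>I\<times>J. t (?w x z) (?w z y))" for x y
    by (cases x, cases y) (simp add: \<Delta>_mult urepD(5)[OF u] urepD(5)[OF v] sum_product t_mult
        sum.cartesian_product case_prod_beta)
  moreover have "supp (I \<times> J) (I \<times> J) ?w"
    using urepD(2)[OF u] urepD(2)[OF v] unfolding supp_def
    by clarsimp (metis mult_zero_left mult_zero_right)
  ultimately show ?thesis using fin by (simp add: urep_def fun_eq_iff)
qed

end

section \<open>The CQG algebra as a unital star-algebra\<close>

context haar_cqg
begin

lemmas cqg_algebra_add = complex_vector.span_add[of _ "\<Union>{coefficients n u | n u. irreducible_rep t \<Delta> n u}", folded cqg_algebra_def]
  and cqg_algebra_scale = complex_vector.span_scale[of _ "\<Union>{coefficients n u | n u. irreducible_rep t \<Delta> n u}", folded cqg_algebra_def]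
  and cqg_algebra_sum = complex_vector.span_sum[of _ _ "\<Union>{coefficients n u | n u. irreducible_rep t \<Delta> n u}", folded cqg_algebra_def]
  and cqg_algebra_base = complex_vector.span_base[of _ "\<Union>{coefficients n u | n u. irreducible_rep t \<Delta> n u}", folded cqg_algebra_def]

lemma cqg_algebra_0: "0 \<in> cqg_algebra t \<Delta>"
  unfolding cqg_algebra_def by (rule complex_vector.span_zero)

lemma irreducible_rep_in_cqg_algebra: "irreducible_rep t \<Delta> n u \<Longrightarrow> i < n \<Longrightarrow> j < n \<Longrightarrow> u $$ (i, j) \<in> cqg_algebra t \<Delta>"
  by (rule cqg_algebra_base) (auto simp: coefficients_def)

lemma conjugate_in_cqg_algebra:
  assumes "\<And>a b. v a b \<in> cqg_algebra t \<Delta>"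
  shows "mprod K (scm X) (mprod K' v (scm Y)) i j \<in> cqg_algebra t \<Delta>"
  unfolding scm_mprod_apply mprod_scm_apply by (intro cqg_algebra_sum cqg_algebra_scale assms)

text \<open>
  A representation whose commutant contains a nonscalar \<open>X\<close> is split by the range projection of
  \<open>Z Z\<^sup>*\<close>, where \<open>Z = X - l\<close> is singular and nonzero; this reduces to representations with scalar
  commutant.
\<close>

lemma urep_nat_in_cqg_algebra:
  fixes u :: "nat \<Rightarrow> nat \<Rightarrow> 'a"
  assumes "urep {..<n} u" shows "u i j \<in> cqg_algebra t \<Delta>"
  using assms
proof (induction n arbitrary: u i j rule: less_induct)
  case (less n)
  let ?I = "{..<n}"
  note u = less.prems
  have ru: "row_supp ?I u" "col_supp ?I u" using urepD(2)[OF u] by (simp_all add: supp_iff)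
  show ?case
  proof (cases "i < n \<and> j < n")
    case False
    then have "u i j = 0" using urepD(2)[OF u] by (auto simp: supp_def)
    then show ?thesis by (simp add: cqg_algebra_0)
  next
    case ij: True
    then have "0 < n" by auto
    show ?thesis
    proof (cases "schur ?I u")
      case True
      from irreducible_rep_in_cqg_algebra[OF schur_irreducible_rep[OF u True \<open>0 < n\<close>], of i j] ij show ?thesis by simp
    next
      case False
      then obtain X where X: "supp ?I ?I X" "mprod ?I (scm X) u = mprod ?I u (scm X)"
        and nX: "\<And>c. X \<noteq> (\<lambda>i j. c * one_on ?I i j)"
        unfolding schur_def by blast
      obtain l where l: "\<And>S. mprod ?I (X - (\<lambda>i j. l * one_on ?I i j)) S \<noteq> one_on ?I"
        using singular_shift[OF \<open>0 < n\<close> X(1)] by blast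
      define Z where "Z = X - (\<lambda>i j. l * one_on ?I i j)"
      have sZ: "supp ?I ?I Z"
        using X(1) by (simp add: Z_def supp_def one_on_def)
      have Zu: "mprod ?I (scm Z) u = mprod ?I u (scm Z)"
        using ru by (simp add: Z_def scm_diff scm_scale mprod_diff_left mprod_diff_right X(2)
           mprod_scale_left mprod_scale_right)
      have Zu': "mprod ?I (scm (adj Z)) u = mprod ?I u (scm (adj Z))"
        by (rule intertwiner_adj[OF u u sZ Zu])
      obtain i0 j0 where "Z i0 j0 \<noteq> 0"
        using nX[of l] by (auto simp: Z_def fun_eq_iff)
      with sZ have i0: "i0 < n" "j0 < n" "Z i0 j0 \<noteq> 0" by (auto simp: supp_def)
      \<comment> \<open>Being self-adjoint, \<open>Y\<close> commutes with \<open>adj u\<close> as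
        well as with \<open>u\<close>. Invariance of its range under both makes the range projection
        commute with \<open>u\<close>.\<close>
      define Y where "Y = mprod ?I Z (adj Z)"
      have sY: "supp ?I ?I Y" using sZ by (simp add: Y_def supp_iff)
      have Yu: "mprod ?I (scm Y) u = mprod ?I u (scm Y)"
        by (simp add: Y_def scm_mprod mprod_assoc Zu') (simp only: Zu flip: mprod_assoc)
      have "adj Y = Y" by (simp add: Y_def adj_mprod)
      then have Yu': "mprod ?I (scm Y) (adj u) = mprod ?I (adj u) (scm Y)"
        using arg_cong[OF Yu, of adj] by (simp add: adj_mprod scm_adj[symmetric])
      obtain p S where p: "supp ?I ?I p" "adj p = p" "mprod ?I p p = p" "p = mprod ?I Y S" "mprod ?I p Y = Y"
        by (rule range_projection[OF sY])
      have pu: "mprod ?I (scm p) u = mprod ?I u (scm p)"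
      proof -
        have "mprod ?I (scm p) u = adj (mprod ?I (adj u) (scm p))"
          by (simp add: adj_mprod scm_adj[symmetric] p(2))
        also have "\<dots> = adj (mprod ?I (scm p) (mprod ?I (adj u) (scm p)))"
          by (simp add: range_invariant[OF Yu' p(4,5)])
        also have "\<dots> = mprod ?I (scm p) (mprod ?I u (scm p))"
          by (simp add: adj_mprod scm_adj[symmetric] p(2) mprod_assoc)
        also have "\<dots> = mprod ?I u (scm p)"
          by (rule range_invariant[OF Yu p(4,5)])
        finally show ?thesis .
      qed
      define q where "q = one_on ?I - p"
      have rp: "row_supp ?I p" "col_supp ?I p" using p(1) by (simp_all add: supp_iff)
      have q: "supp ?I ?I q" "adj q = q" "mprod ?I q q = q"
        using rp p(2,3) by (simp_all add: q_def adj_diff mprod_diff_left mprod_diff_right supp_iff)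
      have qu: "mprod ?I (scm q) u = mprod ?I u (scm q)"
        using ru by (simp add: q_def scm_diff mprod_diff_left mprod_diff_right pu)
      \<comment> \<open>Otherwise \<open>mprod ?I (adj Z) S\<close> would be a right inverse of
        \<open>Z\<close>.\<close>
      have "p \<noteq> one_on ?I"
        using l[of "mprod ?I (adj Z) S"] by (simp add: p(4) Y_def mprod_assoc flip: Z_def)
      moreover have "q \<noteq> one_on ?I"
      proof
        assume "q = one_on ?I"
        then have "p = 0" by (simp add: q_def fun_eq_iff)
        then have "Y = 0" using p(5) by simp
        then have "complex_of_real (\<Sum>i<n. \<Sum>j<n. (cmod (Z i j))\<^sup>2) = 0"
          using trace_mprod_adj[of ?I Z ?I] by (simp add: Y_def)
        then have "(\<Sum>i<n. \<Sum>j<n. (cmod (Z i j))\<^sup>2) = 0"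
          by (simp only: of_real_eq_0_iff)
        moreover have "(\<Sum>i<n. \<Sum>j<n. (cmod (Z i j))\<^sup>2) > 0"
          using i0 by (intro sum_pos2[of _ i0] sum_pos2[of _ j0] sum_nonneg) auto
        ultimately show False by simp
      qed
      \<comment> \<open>Applied to both \<open>p\<close> and \<open>q\<close>: an isometry with
        fewer than \<open>n\<close> columns compresses \<open>u\<close> to a representation covered
        by the induction hypothesis.\<close>
      moreover have "mprod ?I u (scm r) a b \<in> cqg_algebra t \<Delta>"
        if r: "supp ?I ?I r" "adj r = r" "mprod ?I r r = r" "r \<noteq> one_on ?I"
          and comm: "mprod ?I (scm r) u = mprod ?I u (scm r)" for r a b
      proof -
        obtain k :: nat and V where V: "k < n" "supp ?I {..<k} V" "mprod ?I (adj V) V = one_on {..<k}"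
          "mprod {..<k} V (adj V) = r"
          by (rule projection_factor[OF r])
        have comm': "mprod ?I (scm (mprod {..<k} V (adj V))) u = mprod ?I u (scm (mprod {..<k} V (adj V)))"
          using comm by (simp only: V(4))
        have v: "mprod ?I (scm (adj V)) (mprod ?I u (scm V)) a b \<in> cqg_algebra t \<Delta>" for a b
          by (rule less.IH[OF V(1) urep_compress[OF u V(2,3) _ comm']]) simp
        have "mprod ?I u (scm r) = mprod ?I (scm r) (mprod ?I u (scm r))"
          unfolding comm[symmetric] by (simp add: r(3) flip: mprod_assoc scm_mprod)
        also have "\<dots> = mprod {..<k} (scm V) (mprod {..<k} (mprod ?I (scm (adj V)) (mprod ?I u (scm V))) (scm (adj V)))"
          unfolding V(4)[symmetric] scm_mprod by (simp only: mprod_assoc)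
        finally show ?thesis by (simp only:) (rule conjugate_in_cqg_algebra[OF v])
      qed
      ultimately have "mprod ?I u (scm p) i j \<in> cqg_algebra t \<Delta>" "mprod ?I u (scm q) i j \<in> cqg_algebra t \<Delta>"
        using p(1-3) pu q qu by blast+
      from cqg_algebra_add[OF this] show ?thesis
        using ru by (simp add: q_def scm_diff mprod_diff_right)
    qed
  qed
qed

lemma urep_in_cqg_algebra:
  assumes u: "urep I u" shows "u i j \<in> cqg_algebra t \<Delta>"
proof (cases "i \<in> I \<and> j \<in> I")
  case False
  then have "u i j = 0" using urepD(2)[OF u] by (auto simp: supp_def)
  then show ?thesis by (simp add: cqg_algebra_0)
next
  case True
  obtain f where f: "bij_betw f {..<card I} I"
    using urepD(1)[OF u] by (metis lessThan_atLeast0 ex_bij_betw_nat_finite)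
  then obtain a b where ab: "a < card I" "b < card I" "i = f a" "j = f b"
    using True unfolding bij_betw_def by (metis imageE lessThan_iff)
  show ?thesis
    using urep_nat_in_cqg_algebra[OF urep_reindex[OF u f], of a b] ab by simp
qed

lemma coefficients_entries: "x \<in> coefficients n u \<Longrightarrow> \<exists>i j. x = entries n u i j"
  by (force simp: coefficients_def entries_def)

lemma cqg_algebra_induct [consumes 1, case_names zero add coeff]:
  assumes "x \<in> cqg_algebra t \<Delta>"
    and "Q 0" "\<And>c x y. Q x \<Longrightarrow> Q y \<Longrightarrow> Q (c *\<^sub>C x + y)"
    and "\<And>n w i j. urep {..<n::nat} w \<Longrightarrow> Q (w i j)"
  shows "Q x"
  using assms(1) unfolding cqg_algebra_def
proof (induction rule: complex_vector.span_induct_alt)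
  case base
  show ?case by (rule assms(2))
next
  case (step c x y)
  then obtain n u where u: "irreducible_rep t \<Delta> n u" "x \<in> coefficients n u" by blast
  then obtain i j where "x = entries n u i j" using coefficients_entries by blast
  with assms(3,4) step irreducible_repD(3)[OF u(1)] show ?case by blast
qed

lemma cqg_algebra_mult: "x \<in> cqg_algebra t \<Delta> \<Longrightarrow> y \<in> cqg_algebra t \<Delta> \<Longrightarrow> x * y \<in> cqg_algebra t \<Delta>"
proof (induction x rule: cqg_algebra_induct)
  case (add c x x')
  then show ?case by (simp add: distrib_right scaleC_mult_left cqg_algebra_add cqg_algebra_scale)
next
  case (coeff n w i j)
  note w = coeff(1)
  from coeff(2) show ?case
  proof (induction y rule: cqg_algebra_induct)
    case (add c x y)
    then show ?case by (simp add: distrib_left scaleC_mult_right cqg_algebra_add cqg_algebra_scale)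
  next
    case (coeff m v k l)
    from urep_in_cqg_algebra[OF urep_tensor[OF w coeff(1)], of "(i, k)" "(j, l)"] show ?case by simp
  qed (simp add: cqg_algebra_0)
qed (simp add: cqg_algebra_0)

text \<open>\<open>t 1 1\<close> is a left unit on elementary tensors, hence on the closure of their
  span.\<close>

lemma t_1: "t 1 1 = 1"
proof -
  have "t 1 1 * x - x = 0" for x
    by (rule bounded_clinear_0_on_dense[OF _ dense_t])
      (auto intro!: bounded_clinear_diff bounded_clinear_mult_right bounded_clinear_ident simp: t_mult)
  from this[of 1] show ?thesis by simp
qed

lemma cqg_algebra_1: "1 \<in> cqg_algebra t \<Delta>"
proof -
  have "urep {()} (\<lambda>_ _. 1)"
    by (simp add: urep_def supp_def mprod_def adj_def one_on_def \<Delta>_1 t_1)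
  from urep_in_cqg_algebra[OF this] show ?thesis .
qed


section \<open>Conjugate representations\<close>

lemma posdefI:
  assumes "supp {..<n} {..<n} F" "adj F = F"
    and form: "\<And>z. (\<Sum>i<n. \<Sum>j<n. cnj (z i) * F i j * z j) = (\<Sum>k<n. h (star (y z k) * y z k))"
    and null: "\<And>z i. (\<And>k. k < n \<Longrightarrow> h (star (y z k) * y z k) = 0) \<Longrightarrow> i < n \<Longrightarrow> z i = 0"
  shows "posdef n F"
proof -
  have "0 < Re (\<Sum>i<n. \<Sum>j<n. cnj (z i) * F i j * z j)" if z: "\<exists>i<n. z i \<noteq> 0" for z
  proof -
    obtain k where k: "k < n" "h (star (y z k) * y z k) \<noteq> 0" using null[of z] z by blast
    have "0 < Re (h (star (y z k) * y z k))"
      using h_nonneg[of "y z k"] k(2) by (auto simp: complex_is_Real_iff complex_eq_iff)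
    then have "0 < (\<Sum>k<n. Re (h (star (y z k) * y z k)))"
      using k(1) h_nonneg(2) by (intro sum_pos2[of _ k]) auto
    then show ?thesis by (simp only: form Re_sum)
  qed
  with assms(1,2) show ?thesis by (simp add: posdef_def)
qed

text \<open>Each form is a sum of values \<open>h (star y * y)\<close> at combinations of
  coefficients or their adjoints. Although \<open>h\<close> may have null vectors in the algebra,
  \<open>null_right\<close> for the first form and \<open>null_left\<close> for the second show that
  these combinations are not all null unless \<open>z\<close> vanishes.\<close>

lemma posdef_conjugate:
  fixes w :: "nat \<Rightarrow> nat \<Rightarrow> 'a"
  assumes w: "urep {..<n} w"
  shows "posdef n (\<lambda>i j. h (\<Sum>k<n. w k i * star (w k j)))" (is "posdef n ?G")
    and "posdef n (\<lambda>i j. h (\<Sum>k<n. star (w i k) * w j k))" (is "posdef n ?H")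
proof -
  have w0: "w i j = 0" if "\<not> i < n \<or> \<not> j < n" for i j
    using urepD(2)[OF w] that by (auto simp: supp_def)
  show "posdef n ?G"
  proof (rule posdefI)
    show "supp {..<n} {..<n} ?G" by (auto simp: supp_def w0 h_0)
    show "adj ?G = ?G" by (simp add: adj_def star_sum star_mult star_star flip: h_star)
  next
    fix z :: "nat \<Rightarrow> complex"
    let ?y = "\<lambda>k. star (\<Sum>i<n. cnj (z i) *\<^sub>C w k i)"
    have "(\<Sum>k<n. star (?y k) * ?y k) = (\<Sum>k<n. \<Sum>i<n. \<Sum>j<n. (cnj (z i) * z j) *\<^sub>C (w k i * star (w k j)))"
      by (simp add: star_star star_sum star_scaleC sum_product scaleC_mult_left scaleC_mult_right
          scaleC_scaleC mult.commute)
    also have "\<dots> = (\<Sum>i<n. \<Sum>j<n. (cnj (z i) * z j) *\<^sub>C (\<Sum>k<n. w k i * star (w k j)))"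
      by (subst sum_rotate) (simp add: scaleC_sum_right)
    finally have "h (\<Sum>k<n. star (?y k) * ?y k) =
        h (\<Sum>i<n. \<Sum>j<n. (cnj (z i) * z j) *\<^sub>C (\<Sum>k<n. w k i * star (w k j)))"
      by (rule arg_cong)
    then show "(\<Sum>i<n. \<Sum>j<n. cnj (z i) * ?G i j * z j) = (\<Sum>k<n. h (star (?y k) * ?y k))"
      by (simp only: h_sum h_scaleC mult_ac)
    fix i
    assume null: "\<And>k. k < n \<Longrightarrow> h (star (?y k) * ?y k) = 0" and i: "i < n"
    have "h (star (?y k) * ?y k) = 0" for k
    proof (cases "k < n")
      case False
      then have "?y k = 0" by (simp add: w0)
      then show ?thesis by (simp only: mult_zero_right h_0)
    qed (rule null)
    then have "h (star a * ?y k) = 0" for a k by (rule h_null)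
    then have "h (star (?y k) * a) = 0" for a k using h_star_mult[of "?y k" a] by simp
    then have "cnj (z i) = 0"
      using i by (intro null_right[OF w, where z = "\<lambda>i. cnj (z i)"]) (simp_all add: star_star)
    then show "z i = 0" by simp
  qed
  show "posdef n ?H"
  proof (rule posdefI)
    show "supp {..<n} {..<n} ?H" by (auto simp: supp_def w0 h_0)
    show "adj ?H = ?H" by (simp add: adj_def star_sum star_mult star_star flip: h_star)
  next
    fix z :: "nat \<Rightarrow> complex"
    let ?y = "\<lambda>k. \<Sum>i<n. z i *\<^sub>C w i k"
    have "(\<Sum>k<n. star (?y k) * ?y k) = (\<Sum>k<n. \<Sum>i<n. \<Sum>j<n. (cnj (z i) * z j) *\<^sub>C (star (w i k) * w j k))"
      by (simp add: star_star star_sum star_scaleC sum_product scaleC_mult_left scaleC_mult_right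
          scaleC_scaleC mult.commute)
    also have "\<dots> = (\<Sum>i<n. \<Sum>j<n. (cnj (z i) * z j) *\<^sub>C (\<Sum>k<n. star (w i k) * w j k))"
      by (subst sum_rotate) (simp add: scaleC_sum_right)
    finally have "h (\<Sum>k<n. star (?y k) * ?y k) =
        h (\<Sum>i<n. \<Sum>j<n. (cnj (z i) * z j) *\<^sub>C (\<Sum>k<n. star (w i k) * w j k))"
      by (rule arg_cong)
    then show "(\<Sum>i<n. \<Sum>j<n. cnj (z i) * ?H i j * z j) = (\<Sum>k<n. h (star (?y k) * ?y k))"
      by (simp only: h_sum h_scaleC mult_ac)
    fix i
    assume null: "\<And>k. k < n \<Longrightarrow> h (star (?y k) * ?y k) = 0" and i: "i < n"
    have "h (star (?y k) * ?y k) = 0" for k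
    proof (cases "k < n")
      case False
      then have "?y k = 0" by (simp add: w0)
      then show ?thesis by (simp only: mult_zero_right h_0)
    qed (rule null)
    then have "h (a * ?y k) = 0" for a k by (rule h_null)
    from null_left[OF w this, of i] i show "z i = 0" by simp
  qed
qed

text \<open>
  The conjugate \<open>c = (w\<^sub>i\<^sub>j\<^sup>*)\<close> of a unitary representation preserves the positive definite form
  \<open>G = (h (\<Sum>\<^sub>k w\<^sub>k\<^sub>i w\<^sub>k\<^sub>j\<^sup>*))\<close>, so it becomes unitary in an orthonormal basis for \<open>G\<close>.
\<close>

lemma star_urep_in_cqg_algebra:
  fixes w :: "nat \<Rightarrow> nat \<Rightarrow> 'a"
  assumes w: "urep {..<n} w"
  shows "star (w i j) \<in> cqg_algebra t \<Delta>"
proof -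
  let ?I = "{..<n}"
  define c where "c = (\<lambda>i j. star (w i j))"
  define G where "G = (\<lambda>i j. h (\<Sum>k<n. w k i * star (w k j)))"
  define H where "H = (\<lambda>i j. h (\<Sum>k<n. star (w i k) * w j k))"
  have pG: "posdef n G" and pH: "posdef n H"
    unfolding G_def H_def by (rule posdef_conjugate[OF w])+
  have rc: "row_supp ?I c" "col_supp ?I c"
    using urepD(2)[OF w] by (simp_all add: c_def supp_def row_supp_def col_supp_def)
  have rG: "row_supp ?I G" "col_supp ?I G" "adj G = G" and rH: "row_supp ?I H" "col_supp ?I H" "adj H = H"
    using pG pH by (simp_all add: posdef_def supp_iff)
  \<comment> \<open>Left invariance makes \<open>G\<close> an invariant form for \<open>c\<close>;
    right invariance gives the dual identity for \<open>H\<close> below.\<close>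
  have cGc: "mprod ?I (adj c) (mprod ?I (scm G) c) = scm G"
  proof (intro ext)
    fix i j
    have "\<Delta> (\<Sum>k<n. w k i * star (w k j)) = (\<Sum>k<n. \<Sum>a<n. \<Sum>b<n. t (w k a * star (w k b)) (w a i * star (w b j)))"
      by (simp add: \<Delta>_sum \<Delta>_mult \<Delta>_star urepD(5)[OF w] star_sum t_star sum_product t_mult)
    also have "\<dots> = (\<Sum>a<n. \<Sum>b<n. t (\<Sum>k<n. w k a * star (w k b)) (w a i * star (w b j)))"
      by (subst sum_rotate) (simp add: t_sum_left)
    finally have "G i j *\<^sub>C 1 = (\<Sum>a<n. \<Sum>b<n. G a b *\<^sub>C (w a i * star (w b j)))"
      using L_\<Delta>[of "\<Sum>k<n. w k i * star (w k j)"] by (simp add: G_def L_sum L_t)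
    then show "mprod ?I (adj c) (mprod ?I (scm G) c) i j = scm G i j"
      by (simp add: mprod_def scm_def adj_def c_def star_star sum_distrib_left scaleC_mult_left scaleC_mult_right)
  qed
  have cHc: "mprod ?I c (mprod ?I (scm H) (adj c)) = scm H"
  proof (intro ext)
    fix i j
    have "\<Delta> (\<Sum>k<n. star (w i k) * w j k) = (\<Sum>k<n. \<Sum>a<n. \<Sum>b<n. t (star (w i a) * w j b) (star (w a k) * w b k))"
      by (simp add: \<Delta>_sum \<Delta>_mult \<Delta>_star urepD(5)[OF w] star_sum t_star sum_product t_mult)
    also have "\<dots> = (\<Sum>a<n. \<Sum>b<n. t (star (w i a) * w j b) (\<Sum>k<n. star (w a k) * w b k))"
      by (subst sum_rotate) (simp add: t_sum_right)
    finally have "H i j *\<^sub>C 1 = (\<Sum>a<n. \<Sum>b<n. H a b *\<^sub>C (star (w i a) * w j b))"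
      using R_\<Delta>[of "\<Sum>k<n. star (w i k) * w j k"] by (simp add: H_def R_sum R_t)
    then show "mprod ?I c (mprod ?I (scm H) (adj c)) i j = scm H i j"
      by (simp add: mprod_def scm_def adj_def c_def star_star sum_distrib_left scaleC_mult_left scaleC_mult_right)
  qed
  have one: "supp ?I ?I (one_on ?I :: nat \<Rightarrow> nat \<Rightarrow> complex)" by (simp add: supp_iff)
  obtain m :: nat and V S where V: "supp ?I {..<m} V" "supp ?I {..<m} S" "V = mprod ?I (one_on ?I) S"
    "mprod ?I (adj V) (mprod ?I G V) = one_on {..<m}"
    "mprod {..<m} V (mprod ?I (adj V) (mprod ?I G (one_on ?I))) = one_on ?I"
    by (rule gram_schmidt[OF pG one])
  obtain m' :: nat and V' S' where V': "supp ?I {..<m'} V'" "supp ?I {..<m'} S'" "V' = mprod ?I (one_on ?I) S'"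
    "mprod ?I (adj V') (mprod ?I H V') = one_on {..<m'}"
    "mprod {..<m'} V' (mprod ?I (adj V') (mprod ?I H (one_on ?I))) = one_on ?I"
    by (rule gram_schmidt[OF pH one])
  let ?K = "{..<m}"
  have rV: "row_supp ?I V" "col_supp ?K V"
    using V(1) by (simp_all add: supp_iff)
  define X where "X = mprod ?I (adj V) G"
  have rX: "row_supp ?K X" "col_supp ?I X" using rV rG by (simp_all add: X_def)
  have XV: "mprod ?I X V = one_on ?K" using V(4) by (simp add: X_def mprod_assoc)
  have VX: "mprod ?K V X = one_on ?I" using V(5) rG by (simp add: X_def)
  have adjX: "adj X = mprod ?I G V" by (simp add: X_def adj_mprod rG)
  \<comment> \<open>\<open>V'\<close> times its adjoint inverts \<open>H\<close>, so the dual
    identity makes \<open>r\<close> a right inverse of \<open>c\<close>.\<close>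
  define r where "r = mprod ?I (scm H) (mprod ?I (adj c) (mprod {..<m'} (scm V') (scm (adj V'))))"
  have "mprod ?I H (mprod {..<m'} V' (adj V')) = one_on ?I"
  proof -
    have "adj (mprod {..<m'} V' (mprod ?I (adj V') H)) = one_on ?I" using V'(5) rH by simp
    then show ?thesis by (simp add: adj_mprod rH mprod_assoc)
  qed
  then have HVV: "mprod ?I (scm H) (mprod {..<m'} (scm V') (scm (adj V'))) = one_on ?I"
    by (simp flip: scm_mprod)
  have cr: "mprod ?I c r = one_on ?I"
  proof -
    have "mprod ?I c r = mprod ?I (mprod ?I c (mprod ?I (scm H) (adj c))) (mprod {..<m'} (scm V') (scm (adj V')))"
      by (simp only: r_def mprod_assoc)
    then show ?thesis by (simp only: cHc HVV)
  qed
  \<comment> \<open>\<open>X\<close> is the inverse of \<open>V\<close>. In the basis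
    \<open>V\<close>, orthonormal for \<open>G\<close>, the invariant form becomes the identity and
    \<open>v\<close> an isometry.\<close>
  define v where "v = mprod ?I (scm X) (mprod ?I c (scm V))"
  define \<rho> where "\<rho> = mprod ?I (scm X) (mprod ?I r (scm V))"
  have VX': "mprod ?K (scm V) (scm X) = one_on ?I" and XV': "mprod ?I (scm X) (scm V) = one_on ?K"
    by (simp_all add: VX XV flip: scm_mprod)
  have v\<rho>: "mprod ?K v \<rho> = one_on ?K"
  proof -
    have "mprod ?K v \<rho> = mprod ?I (scm X) (mprod ?I c (mprod ?I (mprod ?K (scm V) (scm X)) (mprod ?I r (scm V))))"
      by (simp only: v_def \<rho>_def mprod_assoc)
    also have "\<dots> = mprod ?I (scm X) (mprod ?I c (mprod ?I r (scm V)))"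
      using rH by (simp add: VX' r_def)
    also have "\<dots> = mprod ?I (scm X) (mprod ?I (mprod ?I c r) (scm V))"
      by (simp only: mprod_assoc)
    finally show ?thesis using rV by (simp add: cr XV')
  qed
  have adjv: "adj v = mprod ?I (scm (adj V)) (mprod ?I (adj c) (scm (mprod ?I G V)))"
    by (simp add: v_def adj_mprod mprod_assoc adjX scm_adj[symmetric])
  have GVX: "mprod ?K (scm (mprod ?I G V)) (scm X) = scm G"
    using rG by (simp add: mprod_assoc VX flip: scm_mprod)
  have vv: "mprod ?K (adj v) v = one_on ?K"
  proof -
    have "mprod ?K (adj v) v = mprod ?I (scm (adj V)) (mprod ?I (mprod ?I (adj c)
        (mprod ?I (mprod ?K (scm (mprod ?I G V)) (scm X)) c)) (scm V))"
      unfolding adjv unfolding v_def by (simp only: mprod_assoc)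
    also have "\<dots> = scm (mprod ?I (adj V) (mprod ?I G V))"
      by (simp only: GVX cGc) (simp only: scm_mprod)
    finally show ?thesis by (simp add: V(4))
  qed
  have rv: "row_supp ?K v" "col_supp ?K v" using rX rV by (simp_all add: v_def)
  have r\<rho>: "row_supp ?K \<rho>" using rX by (simp add: \<rho>_def)
  \<comment> \<open>An isometric matrix over a noncommutative algebra need not be unitary; having
    the left inverse \<open>adj v\<close> and the right inverse \<rho> forces the two to
    agree.\<close>
  have "\<rho> = mprod ?K (mprod ?K (adj v) v) \<rho>" using r\<rho> by (simp add: vv)
  also have "\<dots> = mprod ?K (adj v) (mprod ?K v \<rho>)" by (simp only: mprod_assoc)
  also have "\<dots> = adj v" using rv by (simp add: v\<rho>)
  finally have "mprod ?K v (adj v) = one_on ?K" using v\<rho> by simp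
  moreover have "\<Delta> (v a b) = tprod ?K v v a b" for a b
    unfolding v_def
  proof (rule comult_conjugate)
    show "\<Delta> (c i j) = tprod ?I c c i j" for i j
      by (simp add: c_def tprod_def \<Delta>_star urepD(5)[OF w] star_sum t_star)
    show "mprod ?I (scm (mprod ?K V X)) (mprod ?I c (scm V)) = mprod ?I c (scm V)"
      using rc by (simp add: VX)
  qed
  ultimately have "urep ?K v"
    using vv rv by (simp add: urep_def supp_iff tprod_def)
  then have "v a b \<in> cqg_algebra t \<Delta>" for a b by (rule urep_in_cqg_algebra)
  then have "mprod ?K (scm V) (mprod ?K v (scm X)) i j \<in> cqg_algebra t \<Delta>"
    by (rule conjugate_in_cqg_algebra)
  moreover have "mprod ?K (scm V) (mprod ?K v (scm X)) = mprod ?I (mprod ?K (scm V) (scm X))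
      (mprod ?I c (mprod ?K (scm V) (scm X)))"
    by (simp only: v_def mprod_assoc)
  then have "mprod ?K (scm V) (mprod ?K v (scm X)) = c"
    using rc by (simp add: VX')
  ultimately show ?thesis by (simp add: c_def)
qed

lemma cqg_algebra_star: "x \<in> cqg_algebra t \<Delta> \<Longrightarrow> star x \<in> cqg_algebra t \<Delta>"
proof (induction x rule: cqg_algebra_induct)
  case (add c x y)
  then show ?case by (simp add: star_add star_scaleC cqg_algebra_add cqg_algebra_scale)
next
  case (coeff n w i j)
  then show ?case by (rule star_urep_in_cqg_algebra)
qed (simp add: cqg_algebra_0)

text \<open>
  The elements \<open>y\<^sub>k\<^sub>i = \<Sum>\<^sub>l h (w\<^sub>k\<^sub>l\<^sup>* y) w\<^sub>i\<^sub>l\<close> lie in \<open>D\<close> for \<open>y \<in> D\<close>. Hence a (possibly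
  discontinuous) functional vanishing on \<open>D\<close> gives a relation that is continuous in \<open>y\<close>, so it
  extends from the dense subspace \<open>D\<close> to \<open>y = w\<^sub>k\<^sub>j\<close>.
\<close>

lemma dense_subcoalgebra:
  assumes D: "complex_vector.subspace D" "closure D = UNIV"
    and coalg: "\<And>y. y \<in> D \<Longrightarrow> \<Delta> y \<in> cspan {t a b | a b. a \<in> D \<and> b \<in> D}"
    and w: "urep I w" "schur I w"
  shows "w i j \<in> D"
proof (rule ccontr)
  assume wD: "w i j \<notin> D"
  have ij: "i \<in> I" "j \<in> I"
  proof -
    have "w i j \<noteq> 0" using wD complex_vector.subspace_0[OF D(1)] by metis
    then show "i \<in> I" "j \<in> I" using urepD(2)[OF w(1)] by (auto simp: supp_def)
  qed
  obtain \<psi> :: "'a \<Rightarrow> complex" where \<psi>: "clinear \<psi>" "\<And>y. y \<in> D \<Longrightarrow> \<psi> y = 0" "\<psi> (w i j) = 1"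
    by (rule exists_functional[OF D(1) wD]) blast
  have slice: "L (t c 1 * Z) \<in> D" if "Z \<in> cspan {t a b | a b. a \<in> D \<and> b \<in> D}" for Z c
    using that
  proof (induction rule: complex_vector.span_induct_alt)
    case base
    then show ?case using complex_vector.subspace_0[OF D(1)] by (simp add: clinear_0[OF L_clinear])
  next
    case (step a x y)
    then show ?case
      using D(1) by (auto simp: distrib_left scaleC_mult_right clinear_add[OF L_clinear] clinear_scaleC[OF L_clinear]
          t_mult L_t intro!: complex_vector.subspace_add complex_vector.subspace_scale)
  qed
  \<comment> \<open>Unitarity rewrites \<open>t (star (w k i)) 1\<close> as the sum of
    \<open>t 1 (w i l) * \<Delta> (star (w k l))\<close>, and left invariance then evaluates the
    slice.\<close>
  have key: "L (t (star (w k i)) 1 * \<Delta> y) = (\<Sum>l\<in>I. h (star (w k l) * y) *\<^sub>C w i l)" for k y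
  proof -
    have "(\<Sum>l\<in>I. t 1 (w i l) * \<Delta> (star (w k l))) = (\<Sum>l\<in>I. \<Sum>a\<in>I. t (star (w k a)) (w i l * star (w a l)))"
      by (simp add: \<Delta>_star urepD(5)[OF w(1)] star_sum t_star sum_distrib_left t_mult)
    also have "\<dots> = (\<Sum>a\<in>I. t (star (w k a)) (one_on I i a))"
      by (subst sum.swap) (simp add: urep_sum_right[OF w(1)] flip: t_sum_right)
    also have "\<dots> = (\<Sum>a\<in>I. if i = a then t (star (w k i)) 1 else 0)"
      by (intro sum.cong) (auto simp: one_on_def t_0_right)
    also have "\<dots> = t (star (w k i)) 1"
      using ij urepD(1)[OF w(1)] by simp
    finally have "L (t (star (w k i)) 1 * \<Delta> y) = L ((\<Sum>l\<in>I. t 1 (w i l) * \<Delta> (star (w k l))) * \<Delta> y)"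
      by simp
    also have "\<dots> = (\<Sum>l\<in>I. L (t 1 (w i l) * \<Delta> (star (w k l) * y)))"
      by (simp add: \<Delta>_mult mult.assoc sum_distrib_right L_sum)
    finally show ?thesis by (simp add: L_mult_left L_\<Delta> scaleC_mult_right)
  qed
  have zero: "(\<Sum>l\<in>I. \<psi> (w i l) * h (star (w k l) * y)) = 0" for k y
  proof (rule bounded_clinear_0_on_dense[where f = "\<lambda>y. \<Sum>l\<in>I. \<psi> (w i l) * h (star (w k l) * y)"])
    have eq: "(\<Sum>l\<in>I. \<psi> (w i l) * h (star (w k l) * y)) = h ((\<Sum>l\<in>I. \<psi> (w i l) *\<^sub>C star (w k l)) * y)" for y
      by (simp add: sum_distrib_right scaleC_mult_left h_sum h_scaleC)
    show "bounded_clinear (\<lambda>y. \<Sum>l\<in>I. \<psi> (w i l) * h (star (w k l) * y))"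
      unfolding eq by (intro bounded_clinear_compose[OF h_bounded_clinear] bounded_clinear_mult_right bounded_clinear_ident)
    show "closure (cspan D) = UNIV"
      using D closure_mono[OF complex_vector.span_superset[of D]] by auto
    fix y assume "y \<in> D"
    then have "\<psi> (\<Sum>l\<in>I. h (star (w k l) * y) *\<^sub>C w i l) = 0"
      using \<psi>(2) slice[OF coalg] by (simp flip: key)
    then show "(\<Sum>l\<in>I. \<psi> (w i l) * h (star (w k l) * y)) = 0"
      by (simp add: clinear_sum[OF \<psi>(1)] clinear_scaleC[OF \<psi>(1)] mult.commute)
  qed
  \<comment> \<open>By orthogonality only the term \<open>l = j\<close> survives in the relation at
    \<open>y = w k j\<close>, and \<psi> is 1 at \<open>w i j\<close>, so the scalar
    \<open>c\<close> vanishes. For all \<open>k\<close> together this contradicts unitarity of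
    column \<open>j\<close>.\<close>
  have "h (star (w k j) * w k j) = 0" for k
  proof -
    have "\<exists>c. \<forall>l m. hmat w w k k l m = c * one_on I l m"
      by (rule schur_hmat[OF w, of k k]) blast
    then obtain c where c: "\<And>l m. hmat w w k k l m = c * one_on I l m" by blast
    have "(\<Sum>l\<in>I. \<psi> (w i l) * h (star (w k l) * w k j)) = (\<Sum>l\<in>I. if l = j then c * \<psi> (w i j) else 0)"
      using c by (intro sum.cong) (auto simp: hmat_def one_on_def)
    then have "c = 0" using zero[of k "w k j"] ij urepD(1)[OF w(1)] \<psi>(3) by simp
    then show ?thesis using c[of j j] by (simp add: hmat_def)
  qed
  then have "h (\<Sum>k\<in>I. star (w k j) * w k j) = 0" by (simp add: h_sum)
  then show False using urep_sum_left[OF w(1), of j j] ij by (simp add: one_on_def h_1)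
qed

end

section \<open>Hilbert's basis theorem for subrings\<close>

definition is_subring :: "'r::comm_ring_1 set \<Rightarrow> bool"
  where "is_subring R \<longleftrightarrow> 1 \<in> R \<and> (\<forall>x\<in>R. \<forall>y\<in>R. x + y \<in> R \<and> x * y \<in> R) \<and> (\<forall>x\<in>R. - x \<in> R)"

inductive_set ideal_gen :: "'r::comm_ring_1 set \<Rightarrow> 'r set \<Rightarrow> 'r set" for R S where
  zero: "0 \<in> ideal_gen R S"
| step: "r \<in> R \<Longrightarrow> s \<in> S \<Longrightarrow> x \<in> ideal_gen R S \<Longrightarrow> r * s + x \<in> ideal_gen R S"

text \<open>The finite set is drawn from \<open>S\<close> itself, so that it is a finite subsystem
  of the given equations.\<close>

definition noeth_ring :: "'r::comm_ring_1 set \<Rightarrow> bool"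
  where "noeth_ring R \<longleftrightarrow> is_subring R \<and>
    (\<forall>S. S \<subseteq> R \<longrightarrow> (\<exists>F. finite F \<and> F \<subseteq> S \<and> S \<subseteq> ideal_gen R F))"

text \<open>The image of the polynomial ring under evaluation at \<open>x\<close>, where
  \<open>x\<close> may satisfy relations over \<open>R\<close>. Iterating it builds rings of
  functions without polynomials in several variables.\<close>

definition adjoin :: "'r::comm_ring_1 set \<Rightarrow> 'r \<Rightarrow> 'r set"
  where "adjoin R x = {poly f x | f. \<forall>i. coeff f i \<in> R}"

lemma is_subringD:
  assumes "is_subring R"
  shows "1 \<in> R" "0 \<in> R" "x \<in> R \<Longrightarrow> y \<in> R \<Longrightarrow> x + y \<in> R" "x \<in> R \<Longrightarrow> y \<in> R \<Longrightarrow> x * y \<in> R"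
    "x \<in> R \<Longrightarrow> - x \<in> R" "x \<in> R \<Longrightarrow> y \<in> R \<Longrightarrow> x - y \<in> R"
proof -
  show 1: "1 \<in> R" and *: "x \<in> R \<Longrightarrow> y \<in> R \<Longrightarrow> x + y \<in> R" "x \<in> R \<Longrightarrow> y \<in> R \<Longrightarrow> x * y \<in> R" "x \<in> R \<Longrightarrow> - x \<in> R" for x y
    using assms by (auto simp: is_subring_def)
  show "0 \<in> R" using *(1)[OF 1 *(3)[OF 1]] by simp
  show "x \<in> R \<Longrightarrow> y \<in> R \<Longrightarrow> x - y \<in> R" using *(1)[of x "- y"] *(3)[of y] by simp
qed

lemma is_subring_sum: "is_subring R \<Longrightarrow> (\<And>i. i \<in> I \<Longrightarrow> f i \<in> R) \<Longrightarrow> sum f I \<in> R"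
  by (induction I rule: infinite_finite_induct) (auto intro: is_subringD)

lemma ideal_gen_base: "is_subring R \<Longrightarrow> s \<in> S \<Longrightarrow> s \<in> ideal_gen R S"
  using ideal_gen.step[of 1 R s S 0] by (simp add: is_subringD ideal_gen.zero)

lemma ideal_gen_add: "x \<in> ideal_gen R S \<Longrightarrow> y \<in> ideal_gen R S \<Longrightarrow> x + y \<in> ideal_gen R S"
  by (induction rule: ideal_gen.induct) (auto simp: add.assoc intro: ideal_gen.step)

lemma ideal_gen_mult:
  assumes R: "is_subring R" "r \<in> R" and "x \<in> ideal_gen R S"
  shows "r * x \<in> ideal_gen R S"
  using assms(3)
proof induction
  case (step r' s x)
  then show ?case
    using ideal_gen.step[of "r * r'" R s S "r * x"] is_subringD(4)[OF R(1) R(2) step(1)]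
    by (simp add: distrib_left mult.assoc)
qed (simp add: ideal_gen.zero)

lemma ideal_gen_diff: "is_subring R \<Longrightarrow> x \<in> ideal_gen R S \<Longrightarrow> y \<in> ideal_gen R S \<Longrightarrow> x - y \<in> ideal_gen R S"
  using ideal_gen_add[of x R S "- 1 * y"] ideal_gen_mult[of R "- 1" y S] by (simp add: is_subringD)

lemma ideal_gen_subset:
  assumes R: "is_subring R" and S: "S \<subseteq> ideal_gen R F" shows "ideal_gen R S \<subseteq> ideal_gen R F"
proof
  show "x \<in> ideal_gen R F" if "x \<in> ideal_gen R S" for x
    using that by induction (use S in \<open>auto intro: ideal_gen.zero ideal_gen_add ideal_gen_mult[OF R]\<close>)
qed

lemma ideal_gen_finite:
  assumes R: "is_subring R" and "x \<in> ideal_gen R S"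
  shows "\<exists>F. finite F \<and> F \<subseteq> S \<and> x \<in> ideal_gen R F"
  using assms(2)
proof induction
  case zero
  show ?case by (rule exI[of _ "{}"]) (simp add: ideal_gen.zero)
next
  case (step r s x)
  then obtain F where F: "finite F" "F \<subseteq> S" "x \<in> ideal_gen R F" by blast
  have "ideal_gen R F \<subseteq> ideal_gen R (insert s F)"
    by (rule ideal_gen_subset[OF R]) (auto intro: ideal_gen_base[OF R])
  with F step show ?case
    by (intro exI[of _ "insert s F"]) (auto intro: ideal_gen.step)
qed

lemma coeff_mult_in: "is_subring R \<Longrightarrow> (\<And>i. coeff f i \<in> R) \<Longrightarrow> (\<And>i. coeff g i \<in> R) \<Longrightarrow> coeff (f * g) i \<in> R"
  unfolding coeff_mult by (intro is_subring_sum) (auto intro: is_subringD)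

lemma coeff_pCons_in: "a \<in> R \<Longrightarrow> (\<And>i. coeff f i \<in> R) \<Longrightarrow> coeff (pCons a f) i \<in> R"
  by (cases i) auto

lemma is_subring_adjoin:
  assumes R: "is_subring R" shows "is_subring (adjoin R x)" and "R \<subseteq> adjoin R x" and "x \<in> adjoin R x"
proof -
  have const: "coeff [:r:] i \<in> R" if "r \<in> R" for r i
    using that R by (intro coeff_pCons_in) (auto intro: is_subringD)
  show sub: "R \<subseteq> adjoin R x"
  proof
    fix r assume "r \<in> R"
    then show "r \<in> adjoin R x"
      unfolding adjoin_def using const by (intro CollectI exI[of _ "[:r:]"]) auto
  qed
  have "coeff [:0, 1:] i \<in> R" for i
    using R by (intro coeff_pCons_in) (auto intro: is_subringD)
  then show "x \<in> adjoin R x"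
    unfolding adjoin_def by (intro CollectI exI[of _ "[:0, 1:]"]) auto
  have "y + z \<in> adjoin R x \<and> y * z \<in> adjoin R x" "- y \<in> adjoin R x" if yz: "y \<in> adjoin R x" "z \<in> adjoin R x" for y z
  proof -
    obtain f g where f: "y = poly f x" "\<And>i. coeff f i \<in> R" and g: "z = poly g x" "\<And>i. coeff g i \<in> R"
      using yz by (auto simp: adjoin_def)
    have "y + z = poly (f + g) x" "\<And>i. coeff (f + g) i \<in> R" "y * z = poly (f * g) x"
      "\<And>i. coeff (f * g) i \<in> R" "- y = poly (- f) x" "\<And>i. coeff (- f) i \<in> R"
      using f g coeff_mult_in[OF R] by (auto intro: is_subringD[OF R])
    then show "y + z \<in> adjoin R x \<and> y * z \<in> adjoin R x" "- y \<in> adjoin R x"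
      unfolding adjoin_def by blast+
  qed
  moreover have "1 \<in> adjoin R x" using sub is_subringD(1)[OF R] by blast
  ultimately show "is_subring (adjoin R x)" by (auto simp: is_subring_def)
qed

text \<open>Multiplying each polynomial by the monomial that moves its coefficient from position
  \<open>e\<close> to position \<open>d\<close> realises a combination of coefficients by the
  corresponding combination of polynomials.\<close>

lemma leading_combination:
  assumes R: "is_subring R" and "c \<in> ideal_gen R F"
    and F: "\<And>a. a \<in> F \<Longrightarrow> \<exists>f e. (\<forall>i. coeff f i \<in> R) \<and> e \<le> d \<and> degree f \<le> e \<and> coeff f e = a \<and> poly f x \<in> G"
  shows "\<exists>g. (\<forall>i. coeff g i \<in> R) \<and> degree g \<le> d \<and> coeff g d = c \<and> poly g x \<in> ideal_gen (adjoin R x) G"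
  using assms(2)
proof induction
  case zero
  show ?case by (rule exI[of _ 0]) (simp add: is_subringD[OF R] ideal_gen.zero)
next
  case (step r a c)
  then obtain g where g: "\<And>i. coeff g i \<in> R" "degree g \<le> d" "coeff g d = c" "poly g x \<in> ideal_gen (adjoin R x) G"
    by blast
  obtain f e where f: "\<And>i. coeff f i \<in> R" "e \<le> d" "degree f \<le> e" "coeff f e = a" "poly f x \<in> G"
    using F[OF step(2)] by blast
  let ?m = "monom r (d - e)"
  have mR: "coeff ?m i \<in> R" for i using step(1) by (simp add: is_subringD[OF R])
  have "degree (?m * f) \<le> d"
    using degree_mult_le[of ?m f] degree_monom_le[of r "d - e"] f(2,3) by linarith
  moreover have "coeff (?m * f) d = r * a" using f(2,4) by (simp add: coeff_monom_mult)
  moreover have "poly ?m x \<in> adjoin R x" using mR by (auto simp: adjoin_def)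
  then have "poly (?m * f + g) x \<in> ideal_gen (adjoin R x) G"
    unfolding poly_add poly_mult using f(5) g(4) by (rule ideal_gen.step)
  moreover have "coeff (?m * f + g) i \<in> R" for i
    using coeff_mult_in[OF R mR f(1)] g(1) by (simp add: is_subringD[OF R])
  ultimately show ?case
    using g(2,3) by (intro exI[of _ "?m * f + g"]) (auto intro: degree_add_le)
qed

theorem noeth_ring_adjoin:
  assumes R: "noeth_ring R" shows "noeth_ring (adjoin R x)"
  unfolding noeth_ring_def
proof (intro conjI allI impI)
  have sR: "is_subring R" and fg: "\<And>S. S \<subseteq> R \<Longrightarrow> \<exists>F. finite F \<and> F \<subseteq> S \<and> S \<subseteq> ideal_gen R F"
    using R by (auto simp: noeth_ring_def)
  let ?T = "adjoin R x"
  show sT: "is_subring ?T" by (rule is_subring_adjoin(1)[OF sR])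
  fix S assume S: "S \<subseteq> ?T"
  \<comment> \<open>Degrees belong to polynomials and not to their values, so the ideal is pulled
    back along evaluation at \<open>x\<close>.\<close>
  define A where "A = {f. (\<forall>i. coeff f i \<in> R) \<and> poly f x \<in> ideal_gen ?T S}"
  \<comment> \<open>The coefficient in position \<open>d\<close> may be zero; polynomials of lower
    degree are thus included.\<close>
  define Lead where "Lead d = {coeff f d | f. f \<in> A \<and> degree f \<le> d}" for d
  have LR: "Lead d \<subseteq> R" for d by (auto simp: Lead_def A_def)
  have "\<forall>d. \<exists>F. finite F \<and> F \<subseteq> Lead d \<and> Lead d \<subseteq> ideal_gen R F"
    using fg[OF LR] by blast
  then obtain F where F: "\<And>d. finite (F d)" "\<And>d. F d \<subseteq> Lead d" "\<And>d. Lead d \<subseteq> ideal_gen R (F d)"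
    by metis
  obtain F' where F': "finite F'" "F' \<subseteq> (\<Union>d. Lead d)" "(\<Union>d. Lead d) \<subseteq> ideal_gen R F'"
    using fg[of "\<Union>d. Lead d"] LR by blast
  have "\<forall>a\<in>F'. \<exists>e. a \<in> Lead e" using F'(2) by blast
  then obtain e where e: "\<And>a. a \<in> F' \<Longrightarrow> a \<in> Lead (e a)" by metis
  \<comment> \<open>From degree \<open>N\<close> on, the finite set \<open>F'\<close> supplies all
    leading coefficients; each of the finitely many smaller degrees has its own generators. The
    inserted 0 covers an empty \<open>F'\<close>.\<close>
  define N where "N = Max (insert 0 (e ` F'))"
  have eN: "e a \<le> N" if "a \<in> F'" for a
    using that F'(1) by (simp add: N_def)
  have "\<forall>d a. \<exists>f. a \<in> Lead d \<longrightarrow> f \<in> A \<and> degree f \<le> d \<and> coeff f d = a"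
    by (auto simp: Lead_def)
  then obtain p where p: "\<And>d a. a \<in> Lead d \<Longrightarrow> p d a \<in> A \<and> degree (p d a) \<le> d \<and> coeff (p d a) d = a"
    by metis
  define G where "G = (\<lambda>a. poly (p (e a) a) x) ` F' \<union> (\<Union>d<N. (\<lambda>a. poly (p d a) x) ` F d)"
  have finG: "finite G" using F(1) F'(1) by (auto simp: G_def)
  have pI: "poly (p d a) x \<in> ideal_gen ?T S" if "a \<in> Lead d" for d a
    using p[OF that] by (auto simp: A_def)
  have GI: "G \<subseteq> ideal_gen ?T S"
    by (auto simp: G_def intro!: pI intro: e subsetD[OF F(2)])
  have lead: "\<exists>g. (\<forall>i. coeff g i \<in> R) \<and> degree g \<le> d \<and> coeff g d = c \<and> poly g x \<in> ideal_gen ?T G"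
    if c: "c \<in> Lead d" for c d
  proof (cases "d < N")
    case True
    show ?thesis
    proof (rule leading_combination[OF sR, of c "F d"])
      show "c \<in> ideal_gen R (F d)" using F(3) c by blast
      fix a assume a: "a \<in> F d"
      then have "a \<in> Lead d" using F(2) by blast
      from p[OF this] a True
      show "\<exists>f e. (\<forall>i. coeff f i \<in> R) \<and> e \<le> d \<and> degree f \<le> e \<and> coeff f e = a \<and> poly f x \<in> G"
        by (intro exI[of _ "p d a"] exI[of _ d]) (auto simp: A_def G_def)
    qed
  next
    case False
    show ?thesis
    proof (rule leading_combination[OF sR, of c F'])
      show "c \<in> ideal_gen R F'" using F'(3) c by blast
      fix a assume a: "a \<in> F'"
      from p[OF e[OF a]] a False eN[OF a]
      show "\<exists>f e. (\<forall>i. coeff f i \<in> R) \<and> e \<le> d \<and> degree f \<le> e \<and> coeff f e = a \<and> poly f x \<in> G"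
        by (intro exI[of _ "p (e a) a"] exI[of _ "e a"]) (auto simp: A_def G_def)
    qed
  qed
  have main: "poly f x \<in> ideal_gen ?T G" if "f \<in> A" "degree f \<le> d" for f d
    using that
  proof (induction d arbitrary: f)
    case 0
    then obtain g where g: "degree g \<le> 0" "coeff g 0 = coeff f 0" "poly g x \<in> ideal_gen ?T G"
      using lead[of "coeff f 0" 0] by (auto simp: Lead_def)
    have "f = g" using 0 g by (intro poly_eqI) (metis coeff_eq_0 le_zero_eq neq0_conv)
    with g show ?case by simp
  next
    case (Suc d)
    then obtain g where g: "\<And>i. coeff g i \<in> R" "degree g \<le> Suc d" "coeff g (Suc d) = coeff f (Suc d)"
      "poly g x \<in> ideal_gen ?T G"
      using lead[of "coeff f (Suc d)" "Suc d"] by (auto simp: Lead_def)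
    have "poly g x \<in> ideal_gen ?T S" using g(4) ideal_gen_subset[OF sT GI] by blast
    then have "f - g \<in> A"
      using Suc.prems(1) g(1) by (auto simp: A_def is_subringD[OF sR] ideal_gen_diff[OF sT])
    moreover have "degree (f - g) \<le> d"
    proof (rule degree_le, intro allI impI)
      fix i assume "d < i"
      then show "coeff (f - g) i = 0"
        using g(2,3) Suc.prems(2) by (cases "i = Suc d") (auto simp: coeff_eq_0)
    qed
    ultimately have "poly (f - g) x \<in> ideal_gen ?T G" by (rule Suc.IH)
    from ideal_gen_add[OF g(4) this] show ?case by simp
  qed
  have "S \<subseteq> ideal_gen ?T G"
  proof
    fix y assume y: "y \<in> S"
    then obtain f where "y = poly f x" "\<forall>i. coeff f i \<in> R" using S by (auto simp: adjoin_def)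
    with y main[of f "degree f"] show "y \<in> ideal_gen ?T G"
      by (auto simp: A_def ideal_gen_base[OF sT])
  qed
  \<comment> \<open>\<open>G\<close> consists of elements of the ideal of \<open>S\<close>, not
    necessarily of \<open>S\<close>; each of these finitely many elements involves only finitely
    many members of \<open>S\<close>.\<close>
  have "\<exists>E. finite E \<and> E \<subseteq> S \<and> y \<in> ideal_gen ?T E" if "y \<in> G" for y
    using that GI by (intro ideal_gen_finite[OF sT]) auto
  then have "\<forall>y\<in>G. \<exists>E. finite E \<and> E \<subseteq> S \<and> y \<in> ideal_gen ?T E" ..
  from bchoice[OF this] obtain E
    where E': "\<forall>y\<in>G. finite (E y) \<and> E y \<subseteq> S \<and> y \<in> ideal_gen ?T (E y)" ..
  note E = E'[rule_format]
  have "G \<subseteq> ideal_gen ?T (\<Union>y\<in>G. E y)"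
  proof
    fix y assume y: "y \<in> G"
    have "ideal_gen ?T (E y) \<subseteq> ideal_gen ?T (\<Union>y\<in>G. E y)"
      using y by (intro ideal_gen_subset[OF sT]) (auto intro: ideal_gen_base[OF sT])
    with E[OF y] show "y \<in> ideal_gen ?T (\<Union>y\<in>G. E y)" by blast
  qed
  with \<open>S \<subseteq> ideal_gen ?T G\<close> ideal_gen_subset[OF sT]
  have "S \<subseteq> ideal_gen ?T (\<Union>y\<in>G. E y)" by blast
  with E finG show "\<exists>F. finite F \<and> F \<subseteq> S \<and> S \<subseteq> ideal_gen ?T F"
    by (intro exI[of _ "\<Union>y\<in>G. E y"]) auto
qed

section \<open>Polynomial functions and their common zeros\<close>

inductive_set polyfuns :: "('g \<Rightarrow> complex) set \<Rightarrow> ('g \<Rightarrow> complex) set" for C where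
  const: "(\<lambda>_. c) \<in> polyfuns C"
| gen: "f \<in> C \<Longrightarrow> f \<in> polyfuns C"
| add: "f \<in> polyfuns C \<Longrightarrow> g \<in> polyfuns C \<Longrightarrow> (\<lambda>x. f x + g x) \<in> polyfuns C"
| mult: "f \<in> polyfuns C \<Longrightarrow> g \<in> polyfuns C \<Longrightarrow> (\<lambda>x. f x * g x) \<in> polyfuns C"

lemma noeth_ring_constants: "noeth_ring (range (\<lambda>c _. c) :: ('g \<Rightarrow> complex) set)" (is "noeth_ring ?R")
proof -
  have R: "is_subring ?R"
    unfolding is_subring_def
    by (auto simp: one_fun_def plus_fun_def times_fun_def fun_Compl_def)
  have "\<exists>F. finite F \<and> F \<subseteq> S \<and> S \<subseteq> ideal_gen ?R F" if S: "S \<subseteq> ?R" for S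
  proof (cases "\<exists>c. c \<noteq> 0 \<and> (\<lambda>_. c) \<in> S")
    case True
    then obtain c where c: "c \<noteq> 0" "(\<lambda>_. c) \<in> S" by blast
    have "S \<subseteq> ideal_gen ?R {\<lambda>_. c}"
    proof
      fix s assume "s \<in> S"
      then obtain d where d: "s = (\<lambda>_. d)" using S by blast
      have "(\<lambda>_. d / c) * (\<lambda>_. c) + 0 \<in> ideal_gen ?R {\<lambda>_. c}"
        by (intro ideal_gen.intros) auto
      moreover have "(\<lambda>_. d / c) * (\<lambda>_. c) + 0 = s"
        using c(1) by (simp add: d fun_eq_iff)
      ultimately show "s \<in> ideal_gen ?R {\<lambda>_. c}" by simp
    qed
    with c show ?thesis by (intro exI[of _ "{\<lambda>_. c}"]) auto
  next
    case False
    have "S \<subseteq> ideal_gen ?R {}"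
    proof
      fix s assume s: "s \<in> S"
      then obtain d where d: "s = (\<lambda>_. d)" using S by blast
      with False s have "s = 0" by (auto simp: fun_eq_iff)
      then show "s \<in> ideal_gen ?R {}" by (simp add: ideal_gen.zero)
    qed
    then show ?thesis by (intro exI[of _ "{}"]) auto
  qed
  with R show ?thesis by (simp add: noeth_ring_def)
qed

lemma polyfuns_in_noeth_ring:
  assumes "finite C"
  shows "\<exists>T. noeth_ring T \<and> range (\<lambda>c _. c) \<subseteq> T \<and> C \<subseteq> (T :: ('g \<Rightarrow> complex) set)"
  using assms
proof induction
  case empty
  then show ?case using noeth_ring_constants by blast
next
  case (insert f C)
  then obtain T where T: "noeth_ring T" "range (\<lambda>c _. c) \<subseteq> T" "C \<subseteq> T" by blast
  then have "is_subring T" by (simp add: noeth_ring_def)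
  from is_subring_adjoin[OF this, of f] noeth_ring_adjoin[OF T(1), of f] T show ?case by blast
qed

text \<open>\<open>polyfuns C\<close> lies in the Noetherian ring obtained by adjoining the members
  of \<open>C\<close> to the constants. Members of \<open>S\<close> are combinations of those of the
  finite \<open>F\<close>, so they vanish wherever \<open>F\<close> does.\<close>

lemma polyfuns_common_zeros:
  assumes C: "finite C" and S: "S \<subseteq> polyfuns C"
  shows "\<exists>F. finite F \<and> F \<subseteq> S \<and> (\<forall>x. (\<forall>f\<in>F. f x = 0) \<longrightarrow> (\<forall>f\<in>S. f x = 0))"
proof -
  obtain T where T: "noeth_ring T" "range (\<lambda>c _. c) \<subseteq> T" "C \<subseteq> T"
    using polyfuns_in_noeth_ring[OF C] by blast
  have sT: "is_subring T" using T(1) by (simp add: noeth_ring_def)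
  have "f \<in> T" if "f \<in> polyfuns C" for f
    using that
  proof induction
    case (add f g)
    then show ?case using is_subringD(3)[OF sT, of f g] by (simp add: plus_fun_def)
  next
    case (mult f g)
    then show ?case using is_subringD(4)[OF sT, of f g] by (simp add: times_fun_def)
  qed (use T in auto)
  with S have "S \<subseteq> T" by blast
  then have "\<exists>F. finite F \<and> F \<subseteq> S \<and> S \<subseteq> ideal_gen T F"
    using T(1) unfolding noeth_ring_def by meson
  then obtain F where F: "finite F" "F \<subseteq> S" "S \<subseteq> ideal_gen T F" by (elim exE conjE)
  have "f x = 0" if zero: "\<forall>f\<in>F. f x = 0" and f: "f \<in> S" for f x
  proof -
    have "f \<in> ideal_gen T F" using f F(3) by blast
    then show "f x = 0" by induction (use zero in auto)
  qed
  with F(1,2) show ?thesis by (intro exI[of _ F]) simp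
qed

lemma polyfuns_cnj:
  assumes C: "\<And>f. f \<in> C \<Longrightarrow> (\<lambda>x. cnj (f x)) \<in> C" and "f \<in> polyfuns C"
  shows "(\<lambda>x. cnj (f x)) \<in> polyfuns C"
  using assms(2)
proof induction
  case (const c)
  show ?case by (rule polyfuns.const)
next
  case (gen f)
  then show ?case by (intro polyfuns.gen C)
next
  case (add f g)
  then show ?case unfolding complex_cnj_add by (intro polyfuns.add)
next
  case (mult f g)
  then show ?case unfolding complex_cnj_mult by (intro polyfuns.mult)
qed

section \<open>Finitely many characters\<close>

text \<open>A limit point would have two different members of \<open>S\<close> within 1/2 of it,
  hence less than 1 apart.\<close>

lemma finite_separated_subset_compact:
  fixes K :: "'x::metric_space set"
  assumes "compact K" "S \<subseteq> K" and sep: "\<And>x y. x \<in> S \<Longrightarrow> y \<in> S \<Longrightarrow> x \<noteq> y \<Longrightarrow> 1 \<le> dist x y"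
  shows "finite S"
proof (rule ccontr)
  assume "infinite S"
  then obtain x where "x islimpt S"
    using Heine_Borel_imp_Bolzano_Weierstrass[OF assms(1) _ assms(2)] by blast
  then have lim: "\<exists>y\<in>S. y \<noteq> x \<and> dist y x < e" if "0 < e" for e
    using that by (auto simp: islimpt_approachable)
  obtain y where y: "y \<in> S" "y \<noteq> x" "dist y x < 1/2" using lim[of "1/2"] by auto
  obtain z where z: "z \<in> S" "z \<noteq> x" "dist z x < dist y x" using lim[of "dist y x"] y(2) by auto
  have "dist y z < 1" using dist_triangle2[of y z x] y(3) z(3) by linarith
  then show False using sep[OF y(1) z(1)] z(3) by auto
qed

lemma finite_image_factor:
  assumes "finite (g ` A)" "\<And>a b. a \<in> A \<Longrightarrow> b \<in> A \<Longrightarrow> g a = g b \<Longrightarrow> f a = f b"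
  shows "finite (f ` A)"
proof (rule finite_surj[OF assms(1)])
  show "f ` A \<subseteq> (\<lambda>y. f (SOME a. a \<in> A \<and> g a = y)) ` g ` A"
  proof clarify
    fix a assume a: "a \<in> A"
    have "(SOME b. b \<in> A \<and> g b = g a) \<in> A \<and> g (SOME b. b \<in> A \<and> g b = g a) = g a"
      by (rule someI[of _ a]) (simp add: a)
    then have "f a = f (SOME b. b \<in> A \<and> g b = g a)"
      using assms(2)[OF a, of "SOME b. b \<in> A \<and> g b = g a"] by simp
    then show "f a \<in> (\<lambda>y. f (SOME a. a \<in> A \<and> g a = y)) ` g ` A" using a by blast
  qed
qed

lemma (in group) finite_index_stabilizer:
  assumes mult: "\<And>g g'. g \<in> carrier G \<Longrightarrow> g' \<in> carrier G \<Longrightarrow> a (g \<otimes> g') = a g \<circ> a g'"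
    and one: "a \<one> = id"
    and X: "finite X" and orbits: "\<And>x. x \<in> X \<Longrightarrow> finite {a g x | g. g \<in> carrier G}"
    and S: "subgroup S G" and stab: "\<And>g. g \<in> carrier G \<Longrightarrow> (\<And>x. x \<in> X \<Longrightarrow> a g x = x) \<Longrightarrow> g \<in> S"
  shows "finite (rcosets S)"
proof -
  \<comment> \<open>Inverses occur because the right cosets of \<open>g\<close> and
    \<open>g'\<close> agree when \<open>g \<otimes> inv g'\<close> lies in \<open>S\<close>, and
    this element fixes \<open>x\<close> when \<open>inv g\<close> and \<open>inv g'\<close> act
    alike on \<open>x\<close>.\<close>
  let ?\<Phi> = "\<lambda>g. restrict (\<lambda>x. a (inv g) x) X"
  have "?\<Phi> ` carrier G \<subseteq> (\<Pi>\<^sub>E x\<in>X. {a g x | g. g \<in> carrier G})"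
    by (auto intro!: PiE_I)
  moreover have "finite (\<Pi>\<^sub>E x\<in>X. {a g x | g. g \<in> carrier G})"
    using X orbits by (rule finite_PiE)
  ultimately have fin: "finite (?\<Phi> ` carrier G)" by (rule finite_subset)
  have "finite ((\<lambda>g. S #> g) ` carrier G)"
  proof (rule finite_image_factor[OF fin])
    fix g g' assume g: "g \<in> carrier G" "g' \<in> carrier G" and eq: "?\<Phi> g = ?\<Phi> g'"
    have "g \<otimes> inv g' \<in> S"
    proof (rule stab)
      fix x assume x: "x \<in> X"
      have "a (g \<otimes> inv g') x = a g (a (inv g') x)" using g by (simp add: mult)
      also have "a (inv g') x = a (inv g) x" using fun_cong[OF eq, of x] x by simp
      also have "a g (a (inv g) x) = x"
        using fun_cong[OF mult[OF g(1) inv_closed[OF g(1)]], of x] g(1) by (simp add: one)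
      finally show "a (g \<otimes> inv g') x = x" .
    qed (use g in simp)
    moreover have "g = (g \<otimes> inv g') \<otimes> g'" using g by (simp add: m_assoc)
    ultimately have "g \<in> S #> g'" unfolding r_coset_def by blast
    from repr_independence[OF this g(2) S] show "S #> g = S #> g'" by simp
  qed
  moreover have "rcosets S = (\<lambda>g. S #> g) ` carrier G" unfolding RCOSETS_def by auto
  ultimately show ?thesis by simp
qed

lemma finite_subset_cspan:
  assumes "finite X" "X \<subseteq> cspan B"
  obtains B0 where "finite B0" "B0 \<subseteq> B" "X \<subseteq> cspan B0"
proof -
  have "\<exists>B0. finite B0 \<and> B0 \<subseteq> B \<and> X \<subseteq> cspan B0"
    using assms
  proof induction
    case empty
    then show ?case by blast
  next
    case (insert x X)
    then obtain B0 where B0: "finite B0" "B0 \<subseteq> B" "X \<subseteq> cspan B0" by blast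
    from insert.prems obtain T r where T: "finite T" "T \<subseteq> B" "x = (\<Sum>a\<in>T. r a *\<^sub>C a)"
      unfolding complex_vector.span_explicit by blast
    have "x \<in> cspan T" unfolding complex_vector.span_explicit using T by blast
    then have "insert x X \<subseteq> cspan (B0 \<union> T)"
      using B0(3) complex_vector.span_mono[of B0 "B0 \<union> T"] complex_vector.span_mono[of T "B0 \<union> T"] by blast
    with B0 T show ?case by (intro exI[of _ "B0 \<union> T"]) auto
  qed
  then show ?thesis using that by blast
qed

text \<open>The star-algebra before closure: the polynomial argument requires characters to be
  finite expressions in \<open>C\<close>.\<close>

inductive_set star_gen :: "'a::unital_cstar_algebra set \<Rightarrow> 'a set" for C where
  one: "1 \<in> star_gen C"
| gen: "x \<in> C \<Longrightarrow> x \<in> star_gen C"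
| add: "x \<in> star_gen C \<Longrightarrow> y \<in> star_gen C \<Longrightarrow> x + y \<in> star_gen C"
| mult: "x \<in> star_gen C \<Longrightarrow> y \<in> star_gen C \<Longrightarrow> x * y \<in> star_gen C"
| scale: "x \<in> star_gen C \<Longrightarrow> c *\<^sub>C x \<in> star_gen C"
| star: "x \<in> star_gen C \<Longrightarrow> star x \<in> star_gen C"

lemma subspace_star_gen: "complex_vector.subspace (star_gen C)"
proof -
  have "0 \<in> star_gen C" using star_gen.scale[OF star_gen.one, of 0 C] by simp
  then show ?thesis by (simp add: complex_vector.subspace_def star_gen.add star_gen.scale)
qed

lemma closure_star_gen: "unital_cstar_subalgebra (closure (star_gen C))"
proof -
  have map: "f x \<in> closure (star_gen C)"
    if "bounded_linear f" "\<And>y. y \<in> star_gen C \<Longrightarrow> f y \<in> closure (star_gen C)" "x \<in> closure (star_gen C)" for f x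
  proof -
    have "continuous_on (closure (star_gen C)) f"
      by (rule bounded_linear.continuous_on[OF that(1) continuous_on_id])
    then have "f ` closure (star_gen C) \<subseteq> closure (star_gen C)"
      by (rule image_closure_subset) (use that(2) in auto)
    with that(3) show ?thesis by blast
  qed
  have base: "x \<in> star_gen C \<Longrightarrow> x \<in> closure (star_gen C)" for x
    using closure_subset by blast
  have star: "star x \<in> closure (star_gen C)" if "x \<in> closure (star_gen C)" for x
    using map[OF bounded_linear_star _ that] star_gen.star base by blast
  have scale: "c *\<^sub>C x \<in> closure (star_gen C)" if "x \<in> closure (star_gen C)" for x c
    using map[OF bounded_linear_scaleC _ that] star_gen.scale base by blast
  have mult1: "x * y \<in> closure (star_gen C)" if "x \<in> closure (star_gen C)" "y \<in> star_gen C" for x y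
    using map[OF bounded_linear_mult_left _ that(1)] star_gen.mult[OF _ that(2)] base by blast
  have mult: "x * y \<in> closure (star_gen C)" if "x \<in> closure (star_gen C)" "y \<in> closure (star_gen C)" for x y
    using map[OF bounded_linear_mult_right _ that(2)] mult1[OF that(1)] by blast
  have add: "x + y \<in> closure (star_gen C)" if x: "x \<in> closure (star_gen C)" and y: "y \<in> closure (star_gen C)" for x y
  proof -
    obtain f g where fg: "\<And>n. f n \<in> star_gen C" "f \<longlonglongrightarrow> x" "\<And>n. g n \<in> star_gen C" "g \<longlonglongrightarrow> y"
      using x y unfolding closure_sequential by blast
    then have "(\<lambda>n. f n + g n) \<longlonglongrightarrow> x + y" "\<And>n. f n + g n \<in> star_gen C"
      by (auto intro: tendsto_add star_gen.add)
    then show ?thesis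
      unfolding closure_sequential by (intro exI[of _ "\<lambda>n. f n + g n"]) simp
  qed
  show ?thesis
    unfolding unital_cstar_subalgebra_def
    using star scale mult add base[OF star_gen.one] by auto
qed

text \<open>Finite sums of polynomial functions times fixed algebra elements: the tensor product of
  \<open>polyfuns C\<close> with the algebra, viewed as functions of the group element.\<close>

inductive_set polyfam :: "('g \<Rightarrow> complex) set \<Rightarrow> ('g \<Rightarrow> 'u::unital_cstar_algebra) set" for C where
  zero: "(\<lambda>_. 0) \<in> polyfam C"
| step: "f \<in> polyfuns C \<Longrightarrow> F \<in> polyfam C \<Longrightarrow> (\<lambda>x. f x *\<^sub>C z + F x) \<in> polyfam C"

lemma polyfam_term: "f \<in> polyfuns C \<Longrightarrow> (\<lambda>x. f x *\<^sub>C z) \<in> polyfam C"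
  using polyfam.step[OF _ polyfam.zero, of f C z] by simp

lemma polyfam_add: "F \<in> polyfam C \<Longrightarrow> G \<in> polyfam C \<Longrightarrow> (\<lambda>x. F x + G x) \<in> polyfam C"
proof (induction rule: polyfam.induct)
  case (step f F z)
  then show ?case using polyfam.step[of f C "\<lambda>x. F x + G x" z] by (simp add: add.assoc)
qed simp

lemma polyfam_sum: "(\<And>i. i \<in> I \<Longrightarrow> F i \<in> polyfam C) \<Longrightarrow> (\<lambda>x. \<Sum>i\<in>I. F i x) \<in> polyfam C"
  by (induction I rule: infinite_finite_induct) (auto intro: polyfam.zero polyfam_add)

lemma polyfam_scale: "F \<in> polyfam C \<Longrightarrow> f \<in> polyfuns C \<Longrightarrow> (\<lambda>x. f x *\<^sub>C F x) \<in> polyfam C"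
proof (induction rule: polyfam.induct)
  case zero
  then show ?case by (simp add: polyfam.zero)
next
  case (step g F z)
  then show ?case using polyfam.step[OF polyfuns.mult[of f C g], of "\<lambda>x. f x *\<^sub>C F x" z]
    by (simp add: scaleC_add_right scaleC_scaleC)
qed

lemma polyfam_mult: "F \<in> polyfam C \<Longrightarrow> G \<in> polyfam C \<Longrightarrow> (\<lambda>x. F x * G x) \<in> polyfam C"
proof (induction rule: polyfam.induct)
  case zero
  then show ?case by (simp add: polyfam.zero)
next
  case (step f F z)
  have "(\<lambda>x. z * G x) \<in> polyfam C" using step(4)
  proof (induction rule: polyfam.induct)
    case (step g G w)
    then show ?case using polyfam.step[of g C "\<lambda>x. z * G x" "z * w"]
      by (simp add: distrib_left scaleC_mult_right)
  qed (simp add: polyfam.zero)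
  from polyfam_add[OF polyfam_scale[OF this step(1)] step(3)[OF step(4)]] show ?case
    by (simp add: distrib_right scaleC_mult_left)
qed

lemma polyfam_star:
  assumes C: "\<And>f. f \<in> C \<Longrightarrow> (\<lambda>x. cnj (f x)) \<in> C" and "F \<in> polyfam C"
  shows "(\<lambda>x. star (F x)) \<in> polyfam C"
  using assms(2)
proof induction
  case zero
  then show ?case by (simp add: polyfam.zero)
next
  case (step f F z)
  then show ?case using polyfam.step[OF polyfuns_cnj[OF C step(1)] step(3), of "star z"]
    by (simp add: star_add star_scaleC)
qed

lemma polyfam_functional:
  assumes "clinear \<psi>" "F \<in> polyfam C" shows "(\<lambda>x. \<psi> (F x)) \<in> polyfuns C"
  using assms(2)
proof induction
  case zero
  show ?case by (simp add: clinear_0[OF assms(1)] polyfuns.const)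
next
  case (step f F z)
  then show ?case
    using polyfuns.add[OF polyfuns.mult[OF step(1) polyfuns.const[of "\<psi> z"]] step(3)]
    by (simp add: clinear_add[OF assms(1)] clinear_scaleC[OF assms(1)])
qed

text \<open>Representations live on the side of \<open>t\<close>, automorphisms act on the side of
  \<open>tU\<close>. Compatibility of the two Haar states through \<iota> carries the orthogonality
  relations across.\<close>

locale cqg_completion =
  A: haar_cqg t \<Delta> h L R + U: haar_bialgebra tU \<Delta>U hU LU
  for t :: "'a::unital_cstar_algebra \<Rightarrow> 'a \<Rightarrow> 'b::unital_cstar_algebra" and \<Delta> h L R
    and tU :: "'u::unital_cstar_algebra \<Rightarrow> 'u \<Rightarrow> 'v::unital_cstar_algebra" and \<Delta>U hU LU +
  fixes \<iota> :: "'a \<Rightarrow> 'u"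
  assumes star_hom_\<iota>: "star_hom_on (cqg_algebra t \<Delta>) \<iota>"
    and \<Delta>_\<iota>: "a \<in> cqg_algebra t \<Delta> \<Longrightarrow>
       (\<And>k. k < n \<Longrightarrow> f k \<in> cqg_algebra t \<Delta> \<and> g k \<in> cqg_algebra t \<Delta>) \<Longrightarrow>
       \<Delta> a = (\<Sum>k<(n::nat). t (f k) (g k)) \<Longrightarrow> \<Delta>U (\<iota> a) = (\<Sum>k<n. tU (\<iota> (f k)) (\<iota> (g k)))"
    and h_\<iota>: "a \<in> cqg_algebra t \<Delta> \<Longrightarrow> hU (\<iota> a) = h a"
begin

lemmas \<iota>_hom = star_hom_onD[OF star_hom_\<iota>]

lemma \<iota>_0: "\<iota> 0 = 0"
  using \<iota>_hom(3)[OF A.cqg_algebra_0, of 0] by simp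

lemma \<iota>_sum: "(\<And>i. i \<in> I \<Longrightarrow> f i \<in> cqg_algebra t \<Delta>) \<Longrightarrow> \<iota> (sum f I) = (\<Sum>i\<in>I. \<iota> (f i))"
  by (induction I rule: infinite_finite_induct) (auto simp: \<iota>_0 \<iota>_hom(1) A.cqg_algebra_sum)

definition \<iota>_rep :: "nat \<Rightarrow> 'a mat \<Rightarrow> nat \<Rightarrow> nat \<Rightarrow> 'u"
  where "\<iota>_rep n u = (\<lambda>i j. \<iota> (entries n u i j))"

text \<open>All expressions involved stay in the CQG algebra, where \<iota> is a star homomorphism,
  so the equations of a representation carry over. The scalar commutant is recovered by
  \<open>schurI\<close> from orthogonality relations, whose values \<open>h_\<iota>\<close>
  preserves.\<close>

lemma \<iota>_rep:
  assumes "irreducible_rep t \<Delta> n u"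
  shows "U.urep {..<n} (\<iota>_rep n u)" "U.schur {..<n} (\<iota>_rep n u)"
proof -
  note w = A.irreducible_repD(3,4)[OF assms]
  let ?w = "entries n u"
  have P: "?w i j \<in> cqg_algebra t \<Delta>" for i j by (rule A.urep_in_cqg_algebra[OF w(1)])
  have one: "\<iota> (one_on {..<n} i j) = one_on {..<n} i j" for i j :: nat
    by (simp add: one_on_def \<iota>_0 \<iota>_hom(5))
  have "(\<Sum>k<n. \<iota> (?w i k) * star (\<iota> (?w j k))) = \<iota> (\<Sum>k<n. ?w i k * star (?w j k))" for i j
    by (simp add: \<iota>_sum P A.cqg_algebra_mult A.cqg_algebra_star \<iota>_hom)
  moreover have "(\<Sum>k<n. star (\<iota> (?w k i)) * \<iota> (?w k j)) = \<iota> (\<Sum>k<n. star (?w k i) * ?w k j)" for i j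
    by (simp add: \<iota>_sum P A.cqg_algebra_mult A.cqg_algebra_star \<iota>_hom)
  moreover have "\<Delta>U (\<iota> (?w i j)) = (\<Sum>k<n. tU (\<iota> (?w i k)) (\<iota> (?w k j)))" for i j
    by (rule \<Delta>_\<iota>) (simp_all add: P A.urepD(5)[OF w(1)])
  ultimately show u: "U.urep {..<n} (\<iota>_rep n u)"
    by (simp add: U.urep_def \<iota>_rep_def mprod_def adj_def fun_eq_iff A.urep_sum_left[OF w(1)]
        A.urep_sum_right[OF w(1)] one supp_def) (simp add: entries_def \<iota>_0)
  have "\<exists>c. \<forall>i j. hmat_A k l i j = c * one_on {..<n} i j"
    if "hmat_A = (\<lambda>k l i j. h (star (?w k i) * ?w l j))" for hmat_A k l
    by (rule A.schur_hmat[OF w, of k l]) (auto simp: that A.hmat_def)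
  then have "\<forall>k l. \<exists>c. \<forall>i j. h (star (?w k i) * ?w l j) = c * one_on {..<n} i j" by blast
  then obtain c where c: "\<And>k l i j. h (star (?w k i) * ?w l j) = c k l * one_on {..<n} i j" by metis
  show "U.schur {..<n} (\<iota>_rep n u)"
  proof (rule U.schurI[OF u])
    fix k l i j
    have "star (\<iota> (?w k i)) * \<iota> (?w l j) = \<iota> (star (?w k i) * ?w l j)"
      by (simp add: P A.cqg_algebra_star \<iota>_hom)
    then show "hU (star (\<iota>_rep n u k i) * \<iota>_rep n u l j) = c k l * one_on {..<n} i j"
      by (simp add: \<iota>_rep_def h_\<iota> P A.cqg_algebra_mult A.cqg_algebra_star c)
  qed
qed

lemma \<iota>_character:
  assumes "irreducible_rep t \<Delta> n u"
  shows "\<iota> (rep_character n u) = (\<Sum>i<n. \<iota>_rep n u i i)"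
proof -
  have "rep_character n u = (\<Sum>i<n. entries n u i i)"
    by (simp add: rep_character_def entries_def)
  then show ?thesis
    using A.urep_in_cqg_algebra[OF A.irreducible_repD(3)[OF assms]] by (simp add: \<iota>_sum \<iota>_rep_def)
qed

end

section \<open>Automorphisms acting on representations\<close>

context haar_bialgebra
begin

lemma cqg_aut_rep:
  assumes \<alpha>: "\<alpha> \<in> cqg_aut t \<Delta>" and u: "urep I u"
  shows "urep I (\<lambda>i j. \<alpha> (u i j))"
proof -
  from \<alpha> obtain F where F: "star_hom \<alpha>" "star_hom F" "\<And>a b. F (t a b) = t (\<alpha> a) (\<alpha> b)" "\<And>a. F (\<Delta> a) = \<Delta> (\<alpha> a)"
    by (auto simp: cqg_aut_def tensor_hom_def)
  note cl = star_hom_clinear[OF F(1)] star_hom_clinear[OF F(2)]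
  have hom: "\<alpha> (x * y) = \<alpha> x * \<alpha> y" "\<alpha> (star x) = star (\<alpha> x)" "\<alpha> 1 = 1" for x y
    using F(1) by (auto simp: star_hom_on_def)
  have one: "\<alpha> (one_on I i j) = one_on I i j" for i j
    by (simp add: one_on_def hom clinear_0[OF cl(1)])
  have "\<Delta> (\<alpha> (u i j)) = (\<Sum>k\<in>I. t (\<alpha> (u i k)) (\<alpha> (u k j)))" for i j
    by (simp add: urepD(5)[OF u] clinear_sum[OF cl(2)] F(3) flip: F(4))
  moreover have "(\<Sum>k\<in>I. \<alpha> (u i k) * star (\<alpha> (u j k))) = \<alpha> (\<Sum>k\<in>I. u i k * star (u j k))"
    "(\<Sum>k\<in>I. star (\<alpha> (u k i)) * \<alpha> (u k j)) = \<alpha> (\<Sum>k\<in>I. star (u k i) * u k j)" for i j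
    by (simp_all add: clinear_sum[OF cl(1)] hom)
  ultimately show ?thesis
    using urepD(1,2)[OF u]
    by (simp add: urep_def mprod_def adj_def fun_eq_iff urep_sum_left[OF u] urep_sum_right[OF u] one supp_def
        clinear_0[OF cl(1)])
qed

text \<open>\<alpha> fixes scalars and is injective, so a commutation relation for the images pulls
  back to \<open>u\<close>.\<close>

lemma cqg_aut_schur:
  assumes \<alpha>: "\<alpha> \<in> cqg_aut t \<Delta>" and s: "schur I u"
  shows "schur I (\<lambda>i j. \<alpha> (u i j))"
  unfolding schur_def
proof (intro allI impI, elim conjE)
  fix X :: "'c \<Rightarrow> 'c \<Rightarrow> complex"
  assume X: "supp I I X" and eq: "mprod I (scm X) (\<lambda>i j. \<alpha> (u i j)) = mprod I (\<lambda>i j. \<alpha> (u i j)) (scm X)"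
  have cl: "clinear \<alpha>" and inj: "inj \<alpha>"
    using \<alpha> by (auto simp: cqg_aut_def bij_def intro: star_hom_clinear)
  have "\<alpha> (mprod I (scm X) u i j) = \<alpha> (mprod I u (scm X) i j)" for i j
    using fun_cong[OF fun_cong[OF eq, of i], of j]
    by (simp add: scm_mprod_apply mprod_scm_apply clinear_sum[OF cl] clinear_scaleC[OF cl])
  then have "mprod I (scm X) u = mprod I u (scm X)"
    using inj by (intro ext) (auto dest: injD)
  with X s show "\<exists>c. X = (\<lambda>i j. c * one_on I i j)" unfolding schur_def by blast
qed

lemma gns_norm:
  assumes "gns_triple h \<pi> \<Omega>"
  shows "complex_of_real ((norm (\<pi> a \<Omega> - \<pi> b \<Omega>))\<^sup>2) = h (star (a - b) * (a - b))"
proof -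
  have add: "\<pi> (a + b) x = \<pi> a x + \<pi> b x" and mult: "\<pi> (a * b) x = \<pi> a (\<pi> b x)"
    and adj: "cinner (\<pi> a x) y = cinner x (\<pi> (star a) y)" and hpi: "h a = cinner \<Omega> (\<pi> a \<Omega>)" for a b x y
    using assms unfolding gns_triple_def by blast+
  have "\<pi> (a - b) \<Omega> + \<pi> b \<Omega> = \<pi> a \<Omega>" using add[of "a - b" b \<Omega>] by simp
  then have "\<pi> a \<Omega> - \<pi> b \<Omega> = \<pi> (a - b) \<Omega>" by (metis add_diff_cancel_right')
  then show ?thesis unfolding cinner_self[symmetric] by (simp only: adj mult hpi)
qed

end

section \<open>Generation by finitely many irreducible representations\<close>

context haar_cqg
begin

text \<open>The span on the right is closed under products and \<open>star\<close>, so the property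
  spreads from the generators.\<close>

lemma comult_star_gen:
  assumes C: "\<And>x. x \<in> C \<Longrightarrow> \<Delta> x \<in> cspan {t a b | a b. a \<in> star_gen C \<and> b \<in> star_gen C}"
    and y: "y \<in> star_gen C"
  shows "\<Delta> y \<in> cspan {t a b | a b. a \<in> star_gen C \<and> b \<in> star_gen C}" (is "_ \<in> cspan ?T")
proof -
  have mult: "x * y \<in> cspan ?T" if "x \<in> cspan ?T" "y \<in> cspan ?T" for x y
    using that(1)
  proof (induction rule: complex_vector.span_induct_alt)
    case base
    show ?case by (simp add: complex_vector.span_zero)
  next
    case (step c x1 x2)
    then obtain a b where x1: "x1 = t a b" "a \<in> star_gen C" "b \<in> star_gen C" by blast
    have "t a b * y \<in> cspan ?T" using that(2)
    proof (induction rule: complex_vector.span_induct_alt)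
      case base
      show ?case by (simp add: complex_vector.span_zero)
    next
      case (step c y1 y2)
      then obtain a' b' where y1: "y1 = t a' b'" "a' \<in> star_gen C" "b' \<in> star_gen C" by blast
      have "t (a * a') (b * b') \<in> cspan ?T"
        using x1 y1 by (intro complex_vector.span_base) (auto intro: star_gen.mult)
      with step show ?case
        by (simp add: distrib_left scaleC_mult_right y1 t_mult complex_vector.span_add complex_vector.span_scale)
    qed
    with step show ?case
      by (simp add: distrib_right scaleC_mult_left x1 complex_vector.span_add complex_vector.span_scale)
  qed
  have star: "star x \<in> cspan ?T" if "x \<in> cspan ?T" for x
    using that
  proof (induction rule: complex_vector.span_induct_alt)
    case base
    show ?case by (simp add: complex_vector.span_zero)
  next
    case (step c x1 x2)
    then obtain a b where x1: "x1 = t a b" "a \<in> star_gen C" "b \<in> star_gen C" by blast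
    have "t (star a) (star b) \<in> cspan ?T"
      using x1 by (intro complex_vector.span_base) (auto intro: star_gen.star)
    with step show ?case
      by (simp add: star_add star_scaleC x1 t_star complex_vector.span_add complex_vector.span_scale)
  qed
  from y show ?thesis
  proof induction
    case one
    have "t 1 1 \<in> cspan ?T" by (intro complex_vector.span_base) (auto intro: star_gen.one)
    then show ?case by (simp add: \<Delta>_1 t_1)
  qed (auto simp: \<Delta>_mult \<Delta>_star clinear_add[OF \<Delta>_clinear] clinear_scaleC[OF \<Delta>_clinear] C
      intro: mult star complex_vector.span_add complex_vector.span_scale)
qed

text \<open>The decomposition is used at the level of coefficients: each coefficient of
  \<open>u0\<close> is a finite combination of coefficients of irreducibles, and \<open>W\<close>
  collects the irreducibles that occur.\<close>

lemma exists_generating_irreducibles: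
  assumes u0: "unitary_rep t \<Delta> n0 u0"
    and gen: "\<And>B. unital_cstar_subalgebra B \<Longrightarrow> coefficients n0 u0 \<subseteq> B \<Longrightarrow> B = UNIV"
  obtains W where "finite W" "\<And>n u. (n, u) \<in> W \<Longrightarrow> irreducible_rep t \<Delta> n u"
    "closure (star_gen (\<Union>(n, u)\<in>W. coefficients n u)) = UNIV"
proof -
  have car: "u0 \<in> carrier_mat n0 n0" using u0 by (simp add: unitary_rep_def)
  then have u: "urep {..<n0} (entries n0 u0)" using u0 by (simp add: unitary_rep_iff_urep)
  let ?B = "\<Union>{coefficients n u | n u. irreducible_rep t \<Delta> n u}"
  have "coefficients n0 u0 = (\<lambda>(i, j). u0 $$ (i, j)) ` ({..<n0} \<times> {..<n0})"
    by (auto simp: coefficients_def)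
  then have "finite (coefficients n0 u0)" by simp
  moreover have "coefficients n0 u0 \<subseteq> cspan ?B"
  proof
    fix x assume "x \<in> coefficients n0 u0"
    then obtain i j where "x = entries n0 u0 i j" using coefficients_entries by blast
    then show "x \<in> cspan ?B" using urep_in_cqg_algebra[OF u] by (simp add: cqg_algebra_def)
  qed
  ultimately obtain B0 where B0: "finite B0" "B0 \<subseteq> ?B" "coefficients n0 u0 \<subseteq> cspan B0"
    by (rule finite_subset_cspan)
  have "\<forall>b\<in>B0. \<exists>nu. irreducible_rep t \<Delta> (fst nu) (snd nu) \<and> b \<in> coefficients (fst nu) (snd nu)"
  proof
    fix b assume "b \<in> B0"
    then obtain n u where "irreducible_rep t \<Delta> n u" "b \<in> coefficients n u" using B0(2) by blast
    then show "\<exists>nu. irreducible_rep t \<Delta> (fst nu) (snd nu) \<and> b \<in> coefficients (fst nu) (snd nu)"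
      by (intro exI[of _ "(n, u)"]) simp
  qed
  from bchoice[OF this] obtain f
    where f: "\<forall>b\<in>B0. irreducible_rep t \<Delta> (fst (f b)) (snd (f b)) \<and> b \<in> coefficients (fst (f b)) (snd (f b))" ..
  let ?C = "\<Union>(n, u)\<in>f ` B0. coefficients n u"
  have "B0 \<subseteq> star_gen ?C"
    using f by (force intro: star_gen.gen simp: case_prod_beta)
  then have "cspan B0 \<subseteq> star_gen ?C"
    by (rule complex_vector.span_minimal[OF _ subspace_star_gen])
  then have "coefficients n0 u0 \<subseteq> closure (star_gen ?C)"
    using B0(3) closure_subset by blast
  then have "closure (star_gen ?C) = UNIV"
    by (rule gen[OF closure_star_gen])
  moreover have "irreducible_rep t \<Delta> n u" if "(n, u) \<in> f ` B0" for n u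
    using that f by (metis fst_conv snd_conv imageE)
  ultimately show ?thesis using B0(1) by (intro that[of "f ` B0"]) auto
qed

text \<open>Norm density is upgraded to algebraic membership: the generated star-algebra is a
  subcoalgebra, so \<open>dense_subcoalgebra\<close> applies.\<close>

lemma irreducible_in_star_gen:
  assumes W: "\<And>n u. (n, u) \<in> W \<Longrightarrow> irreducible_rep t \<Delta> n u"
    and dense: "closure (star_gen (\<Union>(n, u)\<in>W. coefficients n u)) = UNIV"
    and v: "irreducible_rep t \<Delta> m v"
  shows "entries m v i j \<in> star_gen (\<Union>(n, u)\<in>W. coefficients n u)"
proof (rule dense_subcoalgebra[OF subspace_star_gen dense, where I = "{..<m}" and w = "entries m v"])
  let ?C = "\<Union>(n, u)\<in>W. coefficients n u"
  fix y assume y: "y \<in> star_gen ?C"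
  show "\<Delta> y \<in> cspan {t a b | a b. a \<in> star_gen ?C \<and> b \<in> star_gen ?C}"
  proof (rule comult_star_gen[OF _ y])
    fix x assume "x \<in> ?C"
    then obtain n u where nu: "(n, u) \<in> W" "x \<in> coefficients n u" by blast
    then obtain i j where x: "x = u $$ (i, j)" "i < n" "j < n" by (auto simp: coefficients_def)
    have "\<Delta> x = (\<Sum>k<n. t (u $$ (i, k)) (u $$ (k, j)))"
      using W[OF nu(1)] x by (simp add: irreducible_rep_def unitary_rep_def)
    moreover have "u $$ (k, l) \<in> star_gen ?C" if "k < n" "l < n" for k l
      using that nu(1) by (intro star_gen.gen) (auto simp: coefficients_def)
    then have "(\<Sum>k<n. t (u $$ (i, k)) (u $$ (k, j))) \<in> cspan {t a b | a b. a \<in> star_gen ?C \<and> b \<in> star_gen ?C}"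
      using x by (intro complex_vector.span_sum complex_vector.span_base) auto
    ultimately show "\<Delta> x \<in> cspan {t a b | a b. a \<in> star_gen ?C \<and> b \<in> star_gen ?C}" by simp
  qed
qed (rule irreducible_repD[OF v])+

end

section \<open>Equations for characters and orbits of characters\<close>

context cqg_completion
begin

lemma star_gen_in_cqg_algebra: "C \<subseteq> cqg_algebra t \<Delta> \<Longrightarrow> x \<in> star_gen C \<Longrightarrow> x \<in> cqg_algebra t \<Delta>"
  by (rotate_tac 1, induction rule: star_gen.induct)
    (auto intro: A.cqg_algebra_1 A.cqg_algebra_add A.cqg_algebra_mult A.cqg_algebra_scale A.cqg_algebra_star)

text \<open>The image of the representation under \<alpha> again has a scalar commutant and has the
  character of the original, so \<open>schur_same_character\<close> applies.\<close>

lemma aut_on_coefficients: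
  assumes \<alpha>: "\<alpha> \<in> cqg_aut tU \<Delta>U" and u: "irreducible_rep t \<Delta> n u"
    and fixed: "\<alpha> (\<iota> (rep_character n u)) = \<iota> (rep_character n u)"
  shows "\<exists>c. \<alpha> (\<iota>_rep n u i j) = (\<Sum>a<n. \<Sum>b<n. c a b *\<^sub>C \<iota>_rep n u a b)"
proof -
  note w = \<iota>_rep[OF u]
  have cl: "clinear \<alpha>" using \<alpha> by (auto simp: cqg_aut_def intro: star_hom_clinear)
  have "(\<Sum>i<n. \<alpha> (\<iota>_rep n u i i)) = (\<Sum>i<n. \<iota>_rep n u i i)"
    using fixed by (simp add: \<iota>_character[OF u] clinear_sum[OF cl])
  from U.schur_same_character[OF U.cqg_aut_rep[OF \<alpha> w(1)] U.cqg_aut_schur[OF \<alpha> w(2)] w _ this, of i j]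
  show ?thesis using A.irreducible_repD(2)[OF u] by fastforce
qed

lemma finitely_many_characters_suffice:
  fixes \<alpha> :: "'g \<Rightarrow> 'u \<Rightarrow> 'u"
  assumes W: "finite W" "\<And>n u. (n, u) \<in> W \<Longrightarrow> irreducible_rep t \<Delta> n u"
      "closure (star_gen (\<Union>(n, u)\<in>W. coefficients n u)) = UNIV"
    and \<alpha>: "\<And>g. g \<in> S \<Longrightarrow> \<alpha> g \<in> cqg_aut tU \<Delta>U"
  shows "\<exists>E. finite E \<and> (\<forall>(n, u)\<in>E. irreducible_rep t \<Delta> n u) \<and>
    (\<forall>g\<in>S. (\<forall>(n, u)\<in>E. \<alpha> g (\<iota> (rep_character n u)) = \<iota> (rep_character n u)) \<longrightarrow>
      (\<forall>n u. irreducible_rep t \<Delta> n u \<longrightarrow> \<alpha> g (\<iota> (rep_character n u)) = \<iota> (rep_character n u)))"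
proof -
  let ?C = "\<Union>(n, u)\<in>W. coefficients n u"
  define S0 where "S0 = {g \<in> S. \<forall>(n, u)\<in>W. \<alpha> g (\<iota> (rep_character n u)) = \<iota> (rep_character n u)}"
  have cl: "clinear (\<alpha> g)" and hom: "\<alpha> g (x * y) = \<alpha> g x * \<alpha> g y" "\<alpha> g (star x) = star (\<alpha> g x)" "\<alpha> g 1 = 1"
    if "g \<in> S" for g x y
    using \<alpha>[OF that] star_hom_clinear by (auto simp: cqg_aut_def star_hom_on_def)
  \<comment> \<open>Any choice of coefficients serves. Outside \<open>S0\<close> the values are
    arbitrary, and the equations below are evaluated only at members of \<open>S0\<close>.\<close>
  define \<kappa> where "\<kappa> g n u i j = (SOME c. \<alpha> g (\<iota>_rep n u i j) = (\<Sum>a<n. \<Sum>b<n. c a b *\<^sub>C \<iota>_rep n u a b))"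
    for g n u i j
  have \<kappa>_ex: "\<exists>c. \<alpha> g (\<iota>_rep n u i j) = (\<Sum>a<n. \<Sum>b<n. c a b *\<^sub>C \<iota>_rep n u a b)"
    if "g \<in> S0" "(n, u) \<in> W" for g n u i j
    using aut_on_coefficients[OF \<alpha> W(2)[OF that(2)]] that by (auto simp: S0_def)
  have \<kappa>: "\<alpha> g (\<iota>_rep n u i j) = (\<Sum>a<n. \<Sum>b<n. \<kappa> g n u i j a b *\<^sub>C \<iota>_rep n u a b)"
    if "g \<in> S0" "(n, u) \<in> W" for g n u i j
    unfolding \<kappa>_def by (rule someI_ex[OF \<kappa>_ex[OF that]])
  \<comment> \<open>Conjugates are included because \<open>star\<close> occurs in the generated
    algebra and is antilinear.\<close>
  define K where "K = (\<Union>(n, u)\<in>W. \<Union>i<n. \<Union>j<n. \<Union>a<n. \<Union>b<n.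
      {\<lambda>g. \<kappa> g n u i j a b, \<lambda>g. cnj (\<kappa> g n u i j a b)})"
  have finK: "finite K" using W(1) by (auto simp: K_def)
  have cnjK: "(\<lambda>g. cnj (f g)) \<in> K" if "f \<in> K" for f
    using that unfolding K_def by fastforce
  have CP: "?C \<subseteq> cqg_algebra t \<Delta>"
  proof
    fix x assume "x \<in> ?C"
    then obtain n u where nu: "(n, u) \<in> W" "x \<in> coefficients n u" by blast
    then show "x \<in> cqg_algebra t \<Delta>"
      using A.irreducible_rep_in_cqg_algebra[OF W(2)[OF nu(1)]] by (auto simp: coefficients_def)
  qed
  have fam: "\<exists>F\<in>polyfam K. \<forall>g\<in>S0. \<alpha> g (\<iota> y) = F g" if "y \<in> star_gen ?C" for y
    using that
  proof induction
    case one
    have "(\<lambda>g. 1 *\<^sub>C \<iota> 1) \<in> polyfam K" by (intro polyfam_term polyfuns.const)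
    then show ?case
      by (rule bexI[rotated]) (simp add: \<iota>_hom(5) hom S0_def)
  next
    case (gen x)
    then obtain n u where nu: "(n, u) \<in> W" "x \<in> coefficients n u" by blast
    then obtain i j where x: "x = u $$ (i, j)" "i < n" "j < n" by (auto simp: coefficients_def)
    then have \<iota>x: "\<iota> x = \<iota>_rep n u i j" by (simp add: \<iota>_rep_def entries_def)
    have "(\<lambda>g. \<Sum>a<n. \<Sum>b<n. \<kappa> g n u i j a b *\<^sub>C \<iota>_rep n u a b) \<in> polyfam K"
    proof (intro polyfam_sum polyfam_term polyfuns.gen)
      fix a b assume "a \<in> {..<n}" "b \<in> {..<n}"
      then show "(\<lambda>g. \<kappa> g n u i j a b) \<in> K"
        using nu(1) x(2,3) unfolding K_def by fastforce
    qed
    then show ?case by (rule bexI[rotated]) (simp add: \<iota>x \<kappa>[OF _ nu(1)])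
  next
    case (add x y)
    then obtain F G where FG: "F \<in> polyfam K" "\<forall>g\<in>S0. \<alpha> g (\<iota> x) = F g" "G \<in> polyfam K" "\<forall>g\<in>S0. \<alpha> g (\<iota> y) = G g"
      by blast
    show ?case
      by (rule bexI[OF _ polyfam_add[OF FG(1,3)]])
        (use FG(2,4) add(1,2) star_gen_in_cqg_algebra[OF CP] in \<open>auto simp: \<iota>_hom(1) S0_def clinear_add[OF cl]\<close>)
  next
    case (mult x y)
    then obtain F G where FG: "F \<in> polyfam K" "\<forall>g\<in>S0. \<alpha> g (\<iota> x) = F g" "G \<in> polyfam K" "\<forall>g\<in>S0. \<alpha> g (\<iota> y) = G g"
      by blast
    show ?case
      by (rule bexI[OF _ polyfam_mult[OF FG(1,3)]])
        (use FG(2,4) mult(1,2) star_gen_in_cqg_algebra[OF CP] in \<open>auto simp: \<iota>_hom(2) S0_def hom\<close>)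
  next
    case (scale x c)
    then obtain F where F: "F \<in> polyfam K" "\<forall>g\<in>S0. \<alpha> g (\<iota> x) = F g" by blast
    show ?case
      by (rule bexI[OF _ polyfam_scale[OF F(1) polyfuns.const[of c]]])
        (use F(2) scale(1) star_gen_in_cqg_algebra[OF CP] in \<open>auto simp: \<iota>_hom(3) S0_def clinear_scaleC[OF cl]\<close>)
  next
    case (star x)
    then obtain F where F: "F \<in> polyfam K" "\<forall>g\<in>S0. \<alpha> g (\<iota> x) = F g" by blast
    show ?case
      by (rule bexI[OF _ polyfam_star[OF cnjK F(1)]])
        (use F(2) star(1) star_gen_in_cqg_algebra[OF CP] in \<open>auto simp: \<iota>_hom(4) S0_def hom\<close>)
  qed
  have char: "rep_character n u \<in> star_gen ?C" if "irreducible_rep t \<Delta> n u" for n u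
  proof -
    have "rep_character n u = (\<Sum>i<n. entries n u i i)"
      by (simp add: rep_character_def entries_def)
    then show ?thesis
      using A.irreducible_in_star_gen[OF W(2,3) that]
      by (auto intro: complex_vector.subspace_sum[OF subspace_star_gen])
  qed
  define Irr where "Irr = {(n, u). irreducible_rep t \<Delta> n u}"
  define \<chi> where "\<chi> = (\<lambda>(n, u). \<iota> (rep_character n u))"
  have "\<forall>w\<in>Irr. \<exists>F. F \<in> polyfam K \<and> (\<forall>g\<in>S0. \<alpha> g (\<chi> w) = F g)"
    using fam char by (fastforce simp: Irr_def \<chi>_def)
  from bchoice[OF this] obtain F where F: "\<forall>w\<in>Irr. F w \<in> polyfam K \<and> (\<forall>g\<in>S0. \<alpha> g (\<chi> w) = F w g)" ..
  \<comment> \<open>One scalar equation for each irreducible and each linear functional; functionals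
    separate points, so together they say that all characters are fixed. The difference is written
    with the scalar -1 to match the form of \<open>polyfam\<close>.\<close>
  define Eq where "Eq = {\<lambda>g. \<psi> (F w g + (- 1) *\<^sub>C \<chi> w) | (\<psi> :: 'u \<Rightarrow> complex) w. clinear \<psi> \<and> w \<in> Irr}"
  have "Eq \<subseteq> polyfuns K"
  proof
    fix f assume "f \<in> Eq"
    then obtain \<psi> :: "'u \<Rightarrow> complex" and w where f: "f = (\<lambda>g. \<psi> (F w g + (- 1) *\<^sub>C \<chi> w))" "clinear \<psi>" "w \<in> Irr"
      unfolding Eq_def by blast
    show "f \<in> polyfuns K"
      unfolding f(1) using F f(3) by (intro polyfam_functional[OF f(2)] polyfam_add polyfam_term polyfuns.const) auto
  qed
  from polyfuns_common_zeros[OF finK this] obtain E0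
    where E0: "finite E0" "E0 \<subseteq> Eq" "\<And>g f. \<forall>f\<in>E0. f g = 0 \<Longrightarrow> f \<in> Eq \<Longrightarrow> f g = 0"
    by blast
  have "\<forall>f\<in>E0. \<exists>w. w \<in> Irr \<and> (\<exists>\<psi> :: 'u \<Rightarrow> complex. clinear \<psi> \<and> f = (\<lambda>g. \<psi> (F w g + (- 1) *\<^sub>C \<chi> w)))"
    using E0(2) unfolding Eq_def by blast
  from bchoice[OF this] obtain v
    where v: "\<forall>f\<in>E0. v f \<in> Irr \<and> (\<exists>\<psi> :: 'u \<Rightarrow> complex. clinear \<psi> \<and> f = (\<lambda>g. \<psi> (F (v f) g + (- 1) *\<^sub>C \<chi> (v f))))" ..
  show ?thesis
  \<comment> \<open>Fixing the characters of \<open>W\<close> puts \<open>g\<close> into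
    \<open>S0\<close>; fixing those of the \<open>v f\<close> makes the selected equations
    \<open>E0\<close> hold.\<close>
  proof (intro exI[of _ "W \<union> v ` E0"] conjI ballI impI allI)
    show "finite (W \<union> v ` E0)" using W(1) E0(1) by simp
  next
    fix w assume "w \<in> W \<union> v ` E0"
    then have "w \<in> Irr" using W(2) v by (auto simp: Irr_def)
    then show "case w of (n, u) \<Rightarrow> irreducible_rep t \<Delta> n u" by (auto simp: Irr_def)
  next
    fix g n u
    assume g: "g \<in> S" and fx: "\<forall>(n, u)\<in>W \<union> v ` E0. \<alpha> g (\<iota> (rep_character n u)) = \<iota> (rep_character n u)"
      and u: "irreducible_rep t \<Delta> n u"
    have g0: "g \<in> S0" using g fx by (auto simp: S0_def)
    have "f g = 0" if f: "f \<in> E0" for f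
    proof -
      note vf = bspec[OF v f]
      from conjunct2[OF vf] obtain \<psi> :: "'u \<Rightarrow> complex"
        where \<psi>: "clinear \<psi> \<and> f = (\<lambda>g. \<psi> (F (v f) g + (- 1) *\<^sub>C \<chi> (v f)))" ..
      note \<psi> = conjunct1[OF \<psi>] conjunct2[OF \<psi>] conjunct1[OF vf]
      have "case v f of (n, u) \<Rightarrow> \<alpha> g (\<iota> (rep_character n u)) = \<iota> (rep_character n u)"
        by (rule bspec[OF fx UnI2[OF imageI[OF f]]])
      then have "\<alpha> g (\<chi> (v f)) = \<chi> (v f)" by (cases "v f") (simp add: \<chi>_def)
      moreover have "\<alpha> g (\<chi> (v f)) = F (v f) g" using F \<psi>(3) g0 by blast
      ultimately have "\<psi> (F (v f) g + (- 1) *\<^sub>C \<chi> (v f)) = 0" by (simp add: clinear_0[OF \<psi>(1)])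
      then show ?thesis using fun_cong[OF \<psi>(2), of g] by argo
    qed
    then have zero: "f g = 0" if "f \<in> Eq" for f using E0(3) that by blast
    let ?w = "(n, u)"
    have w: "?w \<in> Irr" using u by (simp add: Irr_def)
    have "\<alpha> g (\<chi> ?w) + (- 1) *\<^sub>C \<chi> ?w = 0"
    proof (rule ccontr)
      assume "\<alpha> g (\<chi> ?w) + (- 1) *\<^sub>C \<chi> ?w \<noteq> 0"
      then have "\<alpha> g (\<chi> ?w) + (- 1) *\<^sub>C \<chi> ?w \<notin> {0}" by simp
      then obtain \<psi> :: "'u \<Rightarrow> complex"
        where \<psi>: "clinear \<psi>" "\<psi> (\<alpha> g (\<chi> ?w) + (- 1) *\<^sub>C \<chi> ?w) = 1"
        by (rule exists_functional[OF complex_vector.subspace_single_0]) (rule that)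
      have "(\<lambda>g. \<psi> (F ?w g + (- 1) *\<^sub>C \<chi> ?w)) \<in> Eq" using \<psi>(1) w unfolding Eq_def by blast
      from zero[OF this] have "\<psi> (F ?w g + (- 1) *\<^sub>C \<chi> ?w) = 0" .
      moreover have "\<alpha> g (\<chi> ?w) = F ?w g" using F w g0 by blast
      ultimately show False using \<psi>(2) by simp
    qed
    then show "\<alpha> g (\<iota> (rep_character n u)) = \<iota> (rep_character n u)" by (simp add: \<chi>_def)
  qed
qed

text \<open>Every member of the orbit is the character of a representation with scalar commutant, so
  distinct members are at distance sqrt 2 in the GNS space; the weaker bound 1 suffices.\<close>

lemma finite_orbit:
  assumes gns: "gns_triple hU \<pi> \<Omega>" and comp: "compact_action \<Gamma> \<alpha> \<pi> \<Omega>"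
    and \<alpha>: "\<And>g. g \<in> carrier \<Gamma> \<Longrightarrow> \<alpha> g \<in> cqg_aut tU \<Delta>U" and u: "irreducible_rep t \<Delta> n u"
  shows "finite {\<alpha> g (\<iota> (rep_character n u)) | g. g \<in> carrier \<Gamma>}" (is "finite ?O")
proof -
  let ?f = "\<lambda>y. \<pi> y \<Omega>"
  note w = \<iota>_rep[OF u]
  have ne: "{..<n} \<noteq> {}" using A.irreducible_repD(2)[OF u] by auto
  have sep: "1 \<le> dist (?f y) (?f z)" if yz: "y \<in> ?O" "z \<in> ?O" "y \<noteq> z" for y z
  proof -
    have ex: "\<exists>v. U.urep {..<n} v \<and> U.schur {..<n} v \<and> y = (\<Sum>i<n. v i i)" if y: "y \<in> ?O" for y
    proof -
      from y obtain g where g: "g \<in> carrier \<Gamma>" "y = \<alpha> g (\<iota> (rep_character n u))" by blast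
      have cl: "clinear (\<alpha> g)" using \<alpha>[OF g(1)] by (auto simp: cqg_aut_def intro: star_hom_clinear)
      show ?thesis
        using U.cqg_aut_rep[OF \<alpha>[OF g(1)] w(1)] U.cqg_aut_schur[OF \<alpha>[OF g(1)] w(2)]
        by (intro exI[of _ "\<lambda>i j. \<alpha> g (\<iota>_rep n u i j)"]) (simp add: g(2) \<iota>_character[OF u] clinear_sum[OF cl])
    qed
    obtain v where v: "U.urep {..<n} v" "U.schur {..<n} v" "y = (\<Sum>i<n. v i i)" using ex[OF yz(1)] by blast
    obtain v' where v': "U.urep {..<n} v'" "U.schur {..<n} v'" "z = (\<Sum>i<n. v' i i)" using ex[OF yz(2)] by blast
    have "complex_of_real ((dist (?f y) (?f z))\<^sup>2) = hU (star (y - z) * (y - z))"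
      unfolding dist_norm by (rule U.gns_norm[OF gns])
    also have "\<dots> = 2"
      using U.schur_character_distance[OF v(1,2) ne v'(1,2) ne] yz(3) by (simp add: v(3) v'(3))
    also have "\<dots> = complex_of_real 2" by simp
    finally have "(dist (?f y) (?f z))\<^sup>2 = 2"
      by (simp only: of_real_eq_iff)
    then have "1\<^sup>2 \<le> (dist (?f y) (?f z))\<^sup>2" by simp
    then show ?thesis by (rule power2_le_imp_le) simp
  qed
  have "finite (?f ` ?O)"
  proof (rule finite_separated_subset_compact)
    show "compact (closure {\<pi> (\<alpha> g (\<iota> (rep_character n u))) \<Omega> | g. g \<in> carrier \<Gamma>})"
      using comp by (simp add: compact_action_def)
    show "?f ` ?O \<subseteq> closure {\<pi> (\<alpha> g (\<iota> (rep_character n u))) \<Omega> | g. g \<in> carrier \<Gamma>}"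
      by (rule order_trans[OF _ closure_subset]) auto
  next
    fix a b assume ab: "a \<in> ?f ` ?O" "b \<in> ?f ` ?O" "a \<noteq> b"
    from ab(1) obtain y where y: "a = ?f y" "y \<in> ?O" by (rule imageE)
    from ab(2) obtain z where z: "b = ?f z" "z \<in> ?O" by (rule imageE)
    have "y \<noteq> z" using ab(3) y(1) z(1) by metis
    then show "1 \<le> dist a b" unfolding y(1) z(1) by (rule sep[OF y(2) z(2)])
  qed
  \<comment> \<open>The GNS map may have a kernel; on the orbit it is injective by the separation
    just shown.\<close>
  moreover have "inj_on ?f ?O"
  proof (rule inj_onI, rule ccontr)
    fix y z assume "y \<in> ?O" "z \<in> ?O" "?f y = ?f z" "y \<noteq> z"
    with sep[of y z] show False by simp
  qed
  ultimately show ?thesis by (rule finite_imageD)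
qed

end

section \<open>Finite index of the subgroup fixing all characters\<close>

theorem theorem3p3:
  fixes t :: "'a::unital_cstar_algebra \<Rightarrow> 'a \<Rightarrow> 'b::unital_cstar_algebra"
    and s :: "'b \<Rightarrow> 'a \<Rightarrow> 'c::unital_cstar_algebra"
    and \<Delta> :: "'a \<Rightarrow> 'b"
    and \<iota> :: "'a \<Rightarrow> 'u::unital_cstar_algebra"
    and tU :: "'u \<Rightarrow> 'u \<Rightarrow> 'v::unital_cstar_algebra"
    and \<Delta>U :: "'u \<Rightarrow> 'v"
    and h :: "'a \<Rightarrow> complex"
    and hU :: "'u \<Rightarrow> complex"
    and \<pi> :: "'u \<Rightarrow> 'h::complex_hilbert_space \<Rightarrow> 'h"
    and \<Omega> :: "'h"
    and \<Gamma> :: "('g, 'm) monoid_scheme"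
    and \<alpha> :: "'g \<Rightarrow> 'u \<Rightarrow> 'u"
  assumes "compact_matrix_quantum_group t s \<Delta>"
    and "full_cstar_algebra t \<Delta> \<iota> tU \<Delta>U"
    and "haar_state t \<Delta> h"
    and "haar_state tU \<Delta>U hU" and "\<forall>a \<in> cqg_algebra t \<Delta>. hU (\<iota> a) = h a"
    and "gns_triple hU \<pi> \<Omega>"
    and "cqg_dynamical_system tU \<Delta>U \<Gamma> \<alpha>"
    and "compact_action \<Gamma> \<alpha> \<pi> \<Omega>"
  shows "let \<Gamma>\<chi> = {\<gamma> \<in> carrier \<Gamma>. \<alpha> \<gamma> \<in> cqg_aut_chi t \<Delta> \<iota> tU \<Delta>U}
    in subgroup \<Gamma>\<chi> \<Gamma> \<and> finite (rcosets\<^bsub>\<Gamma>\<^esub> \<Gamma>\<chi>)"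
proof -
  obtain L R where L: "clinear L" "bounded_linear L" "\<And>a b. L (t a b) = h a *\<^sub>C b" "\<And>a. L (\<Delta> a) = h a *\<^sub>C 1"
    and R: "clinear R" "bounded_linear R" "\<And>a b. R (t a b) = h b *\<^sub>C a" "\<And>a. R (\<Delta> a) = h a *\<^sub>C 1"
    using assms(3) unfolding haar_state_def by blast
  obtain LU where LU: "clinear LU" "bounded_linear LU" "\<And>a b. LU (tU a b) = hU a *\<^sub>C b" "\<And>a. LU (\<Delta>U a) = hU a *\<^sub>C 1"
    using assms(4) unfolding haar_state_def by blast
  have cqg: "min_tensor t" "star_hom \<Delta>" "closure (cspan {\<Delta> a * t 1 b | a b. True}) = UNIV"
    "closure (cspan {\<Delta> a * t b 1 | a b. True}) = UNIV"
    using assms(1) unfolding compact_matrix_quantum_group_def compact_quantum_group_def by blast+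
  have full: "star_hom_on (cqg_algebra t \<Delta>) \<iota>" "min_tensor tU" "star_hom \<Delta>U"
    using assms(2) unfolding full_cstar_algebra_def by blast+
  have t: "\<And>a. clinear (\<lambda>b. t a b)" "\<And>b. clinear (\<lambda>a. t a b)"
      "\<And>a b a' b'. t a b * t a' b' = t (a * a') (b * b')" "\<And>a b. star (t a b) = t (star a) (star b)"
      "closure (cspan {t a b | a b. True}) = UNIV"
    using cqg(1) unfolding min_tensor_def by meson+
  have tU: "\<And>a. clinear (\<lambda>b. tU a b)" "\<And>b. clinear (\<lambda>a. tU a b)"
      "\<And>a b a' b'. tU a b * tU a' b' = tU (a * a') (b * b')" "\<And>a b. star (tU a b) = tU (star a) (star b)"
    using full(2) unfolding min_tensor_def by meson+
  have st: "state h" "state hU" using assms(3,4) unfolding haar_state_def by simp_all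
  interpret A: haar_cqg t \<Delta> h L R
    by (intro haar_cqg.intro haar_cqg_axioms.intro haar_bialgebra.intro) (fact t cqg L R st)+
  interpret U: haar_bialgebra tU \<Delta>U hU LU
    by (intro haar_bialgebra.intro) (fact tU full LU st)+
  interpret cqg_completion t \<Delta> h L R tU \<Delta>U hU LU \<iota>
  proof (intro cqg_completion.intro cqg_completion_axioms.intro A.haar_cqg_axioms U.haar_bialgebra_axioms)
    show "star_hom_on (cqg_algebra t \<Delta>) \<iota>" by (rule full(1))
    show "hU (\<iota> a) = h a" if "a \<in> cqg_algebra t \<Delta>" for a using assms(5) that by blast
    show "\<Delta>U (\<iota> a) = (\<Sum>k<n. tU (\<iota> (f k)) (\<iota> (g k)))"
      if "a \<in> cqg_algebra t \<Delta>" "\<And>k. k < n \<Longrightarrow> f k \<in> cqg_algebra t \<Delta> \<and> g k \<in> cqg_algebra t \<Delta>"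
        "\<Delta> a = (\<Sum>k<(n::nat). t (f k) (g k))" for a n f g
      using assms(2) that unfolding full_cstar_algebra_def by blast
  qed
  interpret \<Gamma>: group \<Gamma> using assms(7) by (simp add: cqg_dynamical_system_def)
  have hom: "\<alpha> \<in> hom \<Gamma> (cqg_aut_group tU \<Delta>U)" using assms(7) by (simp add: cqg_dynamical_system_def)
  have aut: "\<alpha> g \<in> cqg_aut tU \<Delta>U" if "g \<in> carrier \<Gamma>" for g
    using hom that by (auto simp: hom_def cqg_aut_group_def)
  have mult: "\<alpha> (g \<otimes>\<^bsub>\<Gamma>\<^esub> g') = \<alpha> g \<circ> \<alpha> g'" if "g \<in> carrier \<Gamma>" "g' \<in> carrier \<Gamma>" for g g'
    using hom that by (auto simp: hom_def cqg_aut_group_def)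
  \<comment> \<open>\<open>hom\<close> records multiplicativity only; the image of the unit is
    idempotent, and injectivity makes it the identity.\<close>
  have one: "\<alpha> \<one>\<^bsub>\<Gamma>\<^esub> = id"
  proof
    fix x
    have "\<alpha> \<one>\<^bsub>\<Gamma>\<^esub> (\<alpha> \<one>\<^bsub>\<Gamma>\<^esub> x) = \<alpha> \<one>\<^bsub>\<Gamma>\<^esub> x"
      using fun_cong[OF mult[of "\<one>\<^bsub>\<Gamma>\<^esub>" "\<one>\<^bsub>\<Gamma>\<^esub>"], of x] by simp
    moreover have "inj (\<alpha> \<one>\<^bsub>\<Gamma>\<^esub>)" using aut[of "\<one>\<^bsub>\<Gamma>\<^esub>"] by (auto simp: cqg_aut_def bij_def)
    ultimately show "\<alpha> \<one>\<^bsub>\<Gamma>\<^esub> x = id x" by (simp add: inj_eq)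
  qed
  let ?S = "{\<gamma> \<in> carrier \<Gamma>. \<alpha> \<gamma> \<in> cqg_aut_chi t \<Delta> \<iota> tU \<Delta>U}"
  have in_S: "g \<in> ?S \<longleftrightarrow> g \<in> carrier \<Gamma> \<and>
      (\<forall>n u. irreducible_rep t \<Delta> n u \<longrightarrow> \<alpha> g (\<iota> (rep_character n u)) = \<iota> (rep_character n u))" for g
    using aut by (auto simp: cqg_aut_chi_def)
  have sub: "subgroup ?S \<Gamma>"
  proof (rule \<Gamma>.subgroupI)
    show "?S \<subseteq> carrier \<Gamma>" by auto
    have "\<one>\<^bsub>\<Gamma>\<^esub> \<in> ?S" unfolding in_S by (simp add: one)
    then show "?S \<noteq> {}" by blast
    show "g \<otimes>\<^bsub>\<Gamma>\<^esub> g' \<in> ?S" if "g \<in> ?S" "g' \<in> ?S" for g g'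
      using that unfolding in_S by (simp add: mult)
    show "inv\<^bsub>\<Gamma>\<^esub> g \<in> ?S" if "g \<in> ?S" for g
    proof -
      have g: "g \<in> carrier \<Gamma>" using that by simp
      have "\<alpha> (inv\<^bsub>\<Gamma>\<^esub> g) (\<alpha> g x) = x" for x
        using fun_cong[OF mult[OF \<Gamma>.inv_closed[OF g] g], of x] g by (simp add: one)
      then show ?thesis
        using that unfolding in_S by (metis \<Gamma>.inv_closed)
    qed
  qed
  obtain n0 u0 where u0: "unitary_rep t \<Delta> n0 u0"
    "\<And>B. unital_cstar_subalgebra B \<Longrightarrow> coefficients n0 u0 \<subseteq> B \<Longrightarrow> B = UNIV"
    using assms(1) unfolding compact_matrix_quantum_group_def by blast
  obtain W where W: "finite W" "\<And>n u. (n, u) \<in> W \<Longrightarrow> irreducible_rep t \<Delta> n u"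
    "closure (star_gen (\<Union>(n, u)\<in>W. coefficients n u)) = UNIV"
    using A.exists_generating_irreducibles[OF u0] by blast
  have "\<exists>E. finite E \<and> (\<forall>(n, u)\<in>E. irreducible_rep t \<Delta> n u) \<and>
    (\<forall>g\<in>carrier \<Gamma>. (\<forall>(n, u)\<in>E. \<alpha> g (\<iota> (rep_character n u)) = \<iota> (rep_character n u)) \<longrightarrow>
      (\<forall>n u. irreducible_rep t \<Delta> n u \<longrightarrow> \<alpha> g (\<iota> (rep_character n u)) = \<iota> (rep_character n u)))"
    by (rule finitely_many_characters_suffice[OF W(1) _ W(3)]) (fact W(2) aut)+
  then obtain E where E: "finite E" "\<forall>(n, u)\<in>E. irreducible_rep t \<Delta> n u"
    "\<forall>g\<in>carrier \<Gamma>. (\<forall>(n, u)\<in>E. \<alpha> g (\<iota> (rep_character n u)) = \<iota> (rep_character n u)) \<longrightarrow>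
      (\<forall>n u. irreducible_rep t \<Delta> n u \<longrightarrow> \<alpha> g (\<iota> (rep_character n u)) = \<iota> (rep_character n u))"
    by (elim exE conjE)
  have "finite (rcosets\<^bsub>\<Gamma>\<^esub> ?S)"
  proof (rule \<Gamma>.finite_index_stabilizer[where a = \<alpha> and X = "(\<lambda>(n, u). \<iota> (rep_character n u)) ` E"])
    show "\<alpha> (g \<otimes>\<^bsub>\<Gamma>\<^esub> g') = \<alpha> g \<circ> \<alpha> g'" if "g \<in> carrier \<Gamma>" "g' \<in> carrier \<Gamma>" for g g'
      using that by (rule mult)
    show "\<alpha> \<one>\<^bsub>\<Gamma>\<^esub> = id" by (rule one)
    show "finite ((\<lambda>(n, u). \<iota> (rep_character n u)) ` E)" using E(1) by simp
    show "finite {\<alpha> g x | g. g \<in> carrier \<Gamma>}" if "x \<in> (\<lambda>(n, u). \<iota> (rep_character n u)) ` E" for x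
      using that E(2) finite_orbit[OF assms(6,8) aut] by auto
    show "subgroup ?S \<Gamma>" by (rule sub)
    show "g \<in> ?S" if "g \<in> carrier \<Gamma>" "\<And>x. x \<in> (\<lambda>(n, u). \<iota> (rep_character n u)) ` E \<Longrightarrow> \<alpha> g x = x" for g
      unfolding in_S
    proof
      have "\<forall>(n, u)\<in>E. \<alpha> g (\<iota> (rep_character n u)) = \<iota> (rep_character n u)"
        using that(2) by force
      then show "\<forall>n u. irreducible_rep t \<Delta> n u \<longrightarrow> \<alpha> g (\<iota> (rep_character n u)) = \<iota> (rep_character n u)"
        using E(3) that(1) by blast
    qed (rule that(1))
  qed
  with sub show ?thesis by (simp add: Let_def)
qed

end
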